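(* Let $n\ge2$, let $\Omega\subset\mathbb R^n$ be an open set, and let $A$ be a finite-valued Young function such that $$\int^\infty\frac{A(t)}{t^{n+1}}\,dt=\infty .$$ Assume that either $n=2$, or $n\ge3$ and $i(A)>n-1$, where $$i(A)=\lim_{\lambda\to\infty}\frac{\log\Big(\liminf_{t\to\infty}\frac{A(\lambda t)}{A(t)}\Big)}{\log\lambda}$$ is the lower Boyd index of $A$ at infinity. Then every weakly monotone function in $W^{1,A}_{\rm loc}(\Omega)$ is continuous in $\Omega$ (that is, it admits a continuous representative).
   Context: Young function: a convex function $A:[0,\infty)\to[0,\infty]$, non-constant in $(0,\infty)$, with $A(0)=0$. An integral $\int^\infty$ with unspecified lower endpoint refers only to behaviour near infinity. Orlicz and Orlicz–Sobolev spaces: for measurable $E\subset\mathbb R^n$, $L^A(E)$ is the space of measurable real-valued $u$ on $E$ with finite Luxemburg norm $\|u\|_{L^A(E)}=\inf\{\lambda>0:\int_E A(|u|/\lambda)\,dx\le1\}$. $W^{1,A}(\Omega)$ is the set of weakly differentiable $u\in L^A(\Omega)$ with $|\nabla u|\in L^A(\Omega)$; $W^{1,A}_{\rm loc}(\Omega)$ is the set of measurable $u$ with $u\in W^{1,A}(\Omega')$ for every bounded open $\Omega'\subset\subset\Omega$. Weakly monotone: $u\in W^{1,1}_{\rm loc}(\Omega)$ is weakly monotone if for every open $\Omega'\subset\subset\Omega$ and every $m,M\in\mathbb R$ with $m\le M$ and $(u-M)_+-(m-u)_+\in W^{1,1}_0(\Omega')$, one has $m\le u\le M$ a.e. in $\Omega'$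 (here $_+$ denotes positive part). *)

theory Defs
  imports "HOL-Analysis.Analysis"
begin

section \<open>Young functions\<close>

text \<open>
  A Young function has domain \<open>[0,\<infinity>)\<close>; it is represented by a function on \<open>real\<close> of which only
  the values at nonnegative arguments are ever used.
\<close>

definition young_function :: "(real \<Rightarrow> ennreal) \<Rightarrow> bool" where
  "young_function A \<longleftrightarrow>
     A 0 = 0 \<and>
     (\<forall>s\<ge>0. \<forall>t\<ge>0. \<forall>\<theta>\<in>{0..1}.
        A (\<theta> * s + (1 - \<theta>) * t) \<le> ennreal \<theta> * A s + ennreal (1 - \<theta>) * A t) \<and>
     \<not> A constant_on {0<..}"

definition finite_valued :: "(real \<Rightarrow> ennreal) \<Rightarrow> bool" where
  "finite_valued A \<longleftrightarrow> (\<forall>t\<ge>0. A t < \<infinity>)"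

definition ln_ennreal :: "ennreal \<Rightarrow> ereal" where
  "ln_ennreal x =
     (if x = 0 then - \<infinity> else if x = \<infinity> then \<infinity> else ereal (ln (enn2real x)))"

text \<open>
  The lower limit of \<open>A (\<lambda> t) / A t\<close> may be infinite (for instance for exponential growth), so the
  index takes values in the extended reals.
\<close>

definition lower_boyd_index :: "(real \<Rightarrow> ennreal) \<Rightarrow> ereal" where
  "lower_boyd_index A =
     Lim at_top (\<lambda>l::real. ln_ennreal (Liminf at_top (\<lambda>t::real. A (l * t) / A t)) / ereal (ln l))"


section \<open>Weak derivatives\<close>

definition partial :: "'n \<Rightarrow> (real ^ 'n \<Rightarrow> real) \<Rightarrow> real ^ 'n::finite \<Rightarrow> real" where
  "partial i f x = frechet_derivative f (at x) (axis i 1)"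

definition grad :: "(real ^ 'n::finite \<Rightarrow> real) \<Rightarrow> real ^ 'n \<Rightarrow> real ^ 'n" where
  "grad f x = (\<chi> i. partial i f x)"

primrec C_k :: "nat \<Rightarrow> (real ^ 'n::finite \<Rightarrow> real) \<Rightarrow> bool" where
  "C_k 0 f \<longleftrightarrow> continuous_on UNIV f"
| "C_k (Suc k) f \<longleftrightarrow> (\<forall>x. f differentiable (at x)) \<and> (\<forall>i. C_k k (partial i f))"

text \<open>The space \<open>C\<^sub>c\<^sup>\<infinity>(\<Omega>)\<close>, its elements being extended by zero to the whole space.\<close>

definition test_functions :: "(real ^ 'n::finite) set \<Rightarrow> (real ^ 'n \<Rightarrow> real) set" where
  "test_functions \<Omega> =
     {\<phi>. (\<forall>k. C_k k \<phi>) \<and> compact (closure {x. \<phi> x \<noteq> 0}) \<and> closure {x. \<phi> x \<noteq> 0} \<subseteq> \<Omega>}"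

definition locally_integrable ::
    "(real ^ 'n::finite) set \<Rightarrow> (real ^ 'n \<Rightarrow> 'b::euclidean_space) \<Rightarrow> bool" where
  "locally_integrable \<Omega> f \<longleftrightarrow> (\<forall>K. compact K \<and> K \<subseteq> \<Omega> \<longrightarrow> integrable (lebesgue_on K) f)"

definition weak_gradient ::
    "(real ^ 'n::finite) set \<Rightarrow> (real ^ 'n \<Rightarrow> real) \<Rightarrow> (real ^ 'n \<Rightarrow> real ^ 'n) \<Rightarrow> bool" where
  "weak_gradient \<Omega> u g \<longleftrightarrow>
     locally_integrable \<Omega> u \<and> locally_integrable \<Omega> g \<and>
     (\<forall>\<phi>\<in>test_functions \<Omega>. \<forall>i.
        (LINT x|lebesgue_on \<Omega>. u x * partial i \<phi> x) = - (LINT x|lebesgue_on \<Omega>. g x $ i * \<phi> x))"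


section \<open>Orlicz and Orlicz--Sobolev spaces\<close>

text \<open>The infimum is taken in \<open>ennreal\<close>, so the norm is infinite if no \<open>\<lambda>\<close> is admissible.\<close>

definition luxemburg_norm ::
    "(real \<Rightarrow> ennreal) \<Rightarrow> (real ^ 'n::finite) set \<Rightarrow> (real ^ 'n \<Rightarrow> real) \<Rightarrow> ennreal" where
  "luxemburg_norm A E u =
     Inf {ennreal l | l. 0 < l \<and> (\<integral>\<^sup>+x. A (\<bar>u x\<bar> / l) \<partial>lebesgue_on E) \<le> 1}"

definition orlicz ::
    "(real \<Rightarrow> ennreal) \<Rightarrow> (real ^ 'n::finite) set \<Rightarrow> (real ^ 'n \<Rightarrow> real) set" where
  "orlicz A E = {u. u \<in> borel_measurable (lebesgue_on E) \<and> luxemburg_norm A E u < \<infinity>}"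

definition orlicz_sobolev ::
    "(real \<Rightarrow> ennreal) \<Rightarrow> (real ^ 'n::finite) set \<Rightarrow> (real ^ 'n \<Rightarrow> real) set" where
  "orlicz_sobolev A \<Omega> =
     {u \<in> orlicz A \<Omega>. \<exists>g. weak_gradient \<Omega> u g \<and> (\<lambda>x. norm (g x)) \<in> orlicz A \<Omega>}"

definition compactly_contained :: "'a::topological_space set \<Rightarrow> 'a set \<Rightarrow> bool" where
  "compactly_contained U \<Omega> \<longleftrightarrow> compact (closure U) \<and> closure U \<subseteq> \<Omega>"

definition orlicz_sobolev_loc ::
    "(real \<Rightarrow> ennreal) \<Rightarrow> (real ^ 'n::finite) set \<Rightarrow> (real ^ 'n \<Rightarrow> real) set" where
  "orlicz_sobolev_loc A \<Omega> =
     {u \<in> borel_measurable (lebesgue_on \<Omega>).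
        \<forall>U. open U \<and> bounded U \<and> compactly_contained U \<Omega> \<longrightarrow> u \<in> orlicz_sobolev A U}"

text \<open>
  The Young function \<open>t \<mapsto> t\<close> yields the spaces \<open>L\<^sup>1\<close> and \<open>W\<^sup>1\<^sup>,\<^sup>1\<close> with their usual norms.
  The space \<open>W\<^sub>0\<^sup>1\<^sup>,\<^sup>1(\<Omega>)\<close> is the closure of the test functions in \<open>W\<^sup>1\<^sup>,\<^sup>1(\<Omega>)\<close>.
\<close>

definition sobolev_11_zero :: "(real ^ 'n::finite) set \<Rightarrow> (real ^ 'n \<Rightarrow> real) set" where
  "sobolev_11_zero \<Omega> =
     {u \<in> orlicz_sobolev ennreal \<Omega>.
        \<exists>g \<phi>. weak_gradient \<Omega> u g \<and> (\<forall>k::nat. \<phi> k \<in> test_functions \<Omega>) \<and>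
          (\<lambda>k. luxemburg_norm ennreal \<Omega> (\<lambda>x. u x - \<phi> k x)) \<longlonglongrightarrow> 0 \<and>
          (\<lambda>k. luxemburg_norm ennreal \<Omega> (\<lambda>x. norm (g x - grad (\<phi> k) x))) \<longlonglongrightarrow> 0}"

definition weakly_monotone :: "(real ^ 'n::finite) set \<Rightarrow> (real ^ 'n \<Rightarrow> real) \<Rightarrow> bool" where
  "weakly_monotone \<Omega> u \<longleftrightarrow>
     u \<in> orlicz_sobolev_loc ennreal \<Omega> \<and>
     (\<forall>U m M. open U \<and> compactly_contained U \<Omega> \<and> m \<le> M \<and>
        (\<lambda>x. max (u x - M) 0 - max (m - u x) 0) \<in> sobolev_11_zero U \<longrightarrow>
        (AE x in lebesgue_on U. m \<le> u x \<and> u x \<le> M))"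

end

theory Submission
  imports Defs "HOL-Computational_Algebra.Polynomial" "HOL-Probability.Probability_Measure"
begin

text \<open>
  Cubes \<open>Q\<^sub>r\<close> replace balls, so that boundaries are flat. For smooth \<open>f\<close>, averaging over a face and
  Jensen's inequality bound the oscillation of \<open>f\<close> on \<open>\<partial>Q\<^sub>r\<close> by \<open>K r T\<close> as soon as the mean of
  \<open>A(\<bar>\<nabla>f\<bar>)\<close> over each face is at most \<open>A(T)\<close>; in dimension \<open>n \<ge> 3\<close> this is Morrey's inequality on the
  \<open>(n-1)\<close>-dimensional faces, and an index above \<open>n - 1\<close> is what makes \<open>t\<^bsup>-(n-1)/q\<^esup>\<close> integrable
  at 0. Apply this to mollifications of \<open>u\<close>. By Fubini and Fatou almost every \<open>r\<close> has finite limiting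
  face energy, and truncating the mollifications at values just outside their range on \<open>\<partial>Q\<^sub>r\<close> gives
  test functions, so weak monotonicity turns the boundary oscillation into an oscillation bound
  for \<open>u\<close> in \<open>Q\<^sub>r\<close>. If the oscillation at a point stayed above \<open>\<epsilon>\<close>, then \<open>r\<^bsup>n-1\<^esup> A(\<kappa>/r)\<close> would be
  integrable at 0, which contradicts the divergence of \<open>\<integral>\<^bsup>\<infinity>\<^esup> A(t) t\<^bsup>-n-1\<^esup> dt\<close>.
\<close>

section \<open>Smooth functions\<close>

text \<open>The integral of \<open>H\<close> over the face where coordinate \<open>i\<close> equals
  \<open>s\<close> is encoded as the integral of \<open>H (upd i s z)\<close> over the whole cube.
  It is larger by the factor \<open>2 * r\<close>, hence the divisions by \<open>2 * r\<close> and
  the two powers \<open>CARD('n)\<close> and \<open>CARD('n) - 1\<close> of \<open>2 * r\<close>.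
  The obstacle is that \<open>u\<close> has no pointwise boundary values on a given cube. Only the
  limit inferior of the face energies is controlled, so the good mollifications form a subsequence
  that depends on \<open>r\<close>. Their boundary values must also stay bounded, since otherwise
  the truncation levels would have no common centre; therefore the energy of a shell contains the
  mass of \<open>f\<close> besides that of its gradient. With \<open>T = \<kappa> / r\<close> the
  oscillation bound \<open>K * r * T\<close> no longer depends on \<open>r\<close>; this is how
  \<open>\<kappa> / r\<close> gets into the divergent integral. The levels avoid the countably many
  values taken on sets of positive measure, because the slopes of the smoothed truncations converge
  only off the levels. The real function \<open>a\<close> is \<open>A\<close> rescaled by a constant
  admissible in the Luxemburg norm of the gradient, so that its energy is finite.\<close>

lemma partial_eqI: "(f has_derivative f') (at x) \<Longrightarrow> partial i f x = f' (axis i 1)"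
  unfolding partial_def using frechet_derivative_at by metis

lemma C_k_imp_continuous_on:
  assumes "C_k k f"
  shows "continuous_on S f"
proof (cases k)
  case 0
  with assms show ?thesis by (simp add: continuous_on_subset[OF _ subset_UNIV])
next
  case (Suc m)
  with assms have "f differentiable_on S"
    by (simp add: differentiable_at_imp_differentiable_on)
  then show ?thesis by (rule differentiable_imp_continuous_on)
qed

lemma C_k_SucD: "C_k (Suc k) f \<Longrightarrow> C_k k f"
proof (induction k arbitrary: f)
  case 0
  then show ?case using C_k_imp_continuous_on[of "Suc 0" f UNIV] by simp
next
  case (Suc k)
  then show ?case by simp
qed

lemma has_derivative_grad:
  fixes f :: "real ^ 'n::finite \<Rightarrow> real"
  assumes "f differentiable (at x)"
  shows "(f has_derivative (\<lambda>h. grad f x \<bullet> h)) (at x)"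
proof -
  have d: "(f has_derivative frechet_derivative f (at x)) (at x)"
    using assms frechet_derivative_works by blast
  then interpret L: linear "frechet_derivative f (at x)"
    by (rule has_derivative_linear)
  have "frechet_derivative f (at x) h = grad f x \<bullet> h" for h
  proof -
    have "frechet_derivative f (at x) h = frechet_derivative f (at x) (\<Sum>i\<in>UNIV. h $ i *\<^sub>R axis i 1)"
      by (simp add: basis_expansion flip: scalar_mult_eq_scaleR)
    also have "\<dots> = (\<Sum>i\<in>UNIV. h $ i * partial i f x)"
      by (simp add: L.sum L.scaleR partial_def)
    finally show ?thesis by (simp add: inner_vec_def grad_def mult.commute)
  qed
  then have "frechet_derivative f (at x) = (\<lambda>h. grad f x \<bullet> h)" by blast
  with d show ?thesis by simp
qed

lemma C_k_const: "C_k k (\<lambda>x. c)"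
proof (induction k arbitrary: c)
  case (Suc k)
  have "partial i (\<lambda>x. c) = (\<lambda>x. 0)" for i :: 'a
    by (auto intro!: ext partial_eqI derivative_eq_intros)
  then show ?case using Suc by simp
qed simp

lemma C_k_add: "C_k k f \<Longrightarrow> C_k k g \<Longrightarrow> C_k k (\<lambda>x. f x + g x)"
proof (induction k arbitrary: f g)
  case 0
  then show ?case by (simp add: continuous_on_add continuous_on_mult)
next
  case (Suc k)
  have "partial i (\<lambda>x. f x + g x) = (\<lambda>x. partial i f x + partial i g x)" for i
  proof
    fix x
    have "((\<lambda>x. f x + g x) has_derivative
       (\<lambda>h. frechet_derivative f (at x) h + frechet_derivative g (at x) h)) (at x)"
      using Suc.prems by (auto intro!: has_derivative_add simp flip: frechet_derivative_works)
    from partial_eqI[OF this] show "partial i (\<lambda>x. f x + g x) x = partial i f x + partial i g x"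
      by (simp add: partial_def)
  qed
  then show ?case using Suc by (auto intro!: differentiable_add)
qed

lemma partial_mult:
  assumes "f differentiable (at x)" "g differentiable (at x)"
  shows "partial i (\<lambda>x. f x * g x) x = f x * partial i g x + partial i f x * g x"
proof -
  have "((\<lambda>x. f x * g x) has_derivative
     (\<lambda>h. f x * frechet_derivative g (at x) h + frechet_derivative f (at x) h * g x)) (at x)"
    using assms by (auto intro!: has_derivative_mult simp flip: frechet_derivative_works)
  from partial_eqI[OF this] show ?thesis by (simp add: partial_def)
qed

lemma C_k_mult: "C_k k f \<Longrightarrow> C_k k g \<Longrightarrow> C_k k (\<lambda>x. f x * g x)"
proof (induction k arbitrary: f g)
  case 0
  then show ?case by (simp add: continuous_on_add continuous_on_mult)
next
  case (Suc k)
  have "partial i (\<lambda>x. f x * g x) = (\<lambda>x. f x * partial i g x + partial i f x * g x)" for i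
    using Suc.prems by (intro ext partial_mult) simp_all
  moreover have "C_k k f" "C_k k g"
    using Suc.prems C_k_SucD by blast+
  ultimately show ?case using Suc by (auto intro!: differentiable_mult C_k_add)
qed

lemma C_k_diff: "C_k k f \<Longrightarrow> C_k k g \<Longrightarrow> C_k k (\<lambda>x. f x - g x)"
  using C_k_add[OF _ C_k_mult[OF C_k_const[of k "-1"]], of f g] by simp

lemma C_k_sum: "finite I \<Longrightarrow> (\<And>i. i \<in> I \<Longrightarrow> C_k k (f i)) \<Longrightarrow> C_k k (\<lambda>x. \<Sum>i\<in>I. f i x)"
  by (induction I rule: finite_induct) (auto intro: C_k_add C_k_const)

lemma C_k_component: "C_k k (\<lambda>x. x $ i)"
proof (cases k)
  case (Suc m)
  have "partial j (\<lambda>x. x $ i) = (\<lambda>x. axis j 1 $ i)" for j :: 'a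
    by (auto intro!: ext partial_eqI bounded_linear_imp_has_derivative bounded_linear_vec_nth)
  then show ?thesis
    by (auto simp: Suc C_k_const intro!: bounded_linear_imp_differentiable bounded_linear_vec_nth)
qed (simp add: continuous_on_component)

lemma C_k_inner_self_diff: "C_k k (\<lambda>x. (x - c) \<bullet> (x - c))"
  unfolding inner_vec_def
  by (auto intro!: C_k_sum C_k_mult C_k_diff C_k_component C_k_const)

text \<open>The witness is the whole sequence of derivatives: the chain rule turns a composition
  with \<open>D j\<close> into one with \<open>D (Suc j)\<close>, and the induction in
  \<open>C_k_compose\<close> needs all of them at once.\<close>

definition smooth_real :: "(real \<Rightarrow> real) \<Rightarrow> bool" where
  "smooth_real h \<longleftrightarrow>
     (\<exists>D. D 0 = h \<and> (\<forall>k t. (D k has_real_derivative D (Suc k :: nat) t) (at t)))"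

lemma C_k_compose:
  assumes "smooth_real h" "C_k k f"
  shows "C_k k (\<lambda>x. h (f x))"
proof -
  obtain D where D: "D 0 = h" "\<And>k t. (D k has_real_derivative D (Suc k) t) (at t)"
    using assms(1) unfolding smooth_real_def by blast
  have "C_k k (\<lambda>x. D j (f x))" for j
    using assms(2)
  proof (induction k arbitrary: j)
    case 0
    have "continuous_on UNIV (D j)"
      using D(2)[of j] by (meson DERIV_continuous_on has_field_derivative_at_within)
    with 0 show ?case by (auto intro: continuous_on_compose2)
  next
    case (Suc k)
    have dv: "((\<lambda>x. D j (f x)) has_derivative
       (\<lambda>h. D (Suc j) (f x) * frechet_derivative f (at x) h)) (at x)" for x
      using has_derivative_compose[of f "frechet_derivative f (at x)" x UNIV "D j" "(*) (D (Suc j) (f x))"]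
        Suc.prems D(2)[of j "f x"]
      by (auto simp: has_field_derivative_def simp flip: frechet_derivative_works)
    then have "partial i (\<lambda>x. D j (f x)) = (\<lambda>x. D (Suc j) (f x) * partial i f x)" for i
      by (auto intro!: ext simp: partial_eqI[OF dv] partial_def)
    moreover have "(\<lambda>x. D j (f x)) differentiable (at x)" for x
      using dv unfolding differentiable_def by blast
    moreover have "C_k k f" using Suc.prems C_k_SucD by blast
    ultimately show ?case using Suc by (auto intro!: C_k_mult)
  qed
  from this[of 0] show ?thesis by (simp add: D(1))
qed

text \<open>Continuity and derivatives depend only on the germ of a function. This gives smoothness
  of functions glued from a smooth piece and zero, as in
  \<open>truncation_in_sobolev_11_zero\<close>.\<close>

lemma C_k_local:
  assumes "\<And>x. \<exists>U g. open U \<and> x \<in> U \<and> C_k k g \<and> (\<forall>y\<in>U. f y = g y)"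
  shows "C_k k f"
  using assms
proof (induction k arbitrary: f)
  case 0
  have "isCont f x" for x
  proof -
    obtain U g where U: "open U" "x \<in> U" "C_k 0 g" "\<forall>y\<in>U. f y = g y"
      using 0 by blast
    then have "isCont g x" by (simp add: continuous_on_eq_continuous_at)
    moreover have "eventually (\<lambda>y. f y = g y) (nhds x)"
      using U eventually_nhds by blast
    ultimately show ?thesis using isCont_cong by blast
  qed
  then show ?case by (simp add: continuous_at_imp_continuous_on)
next
  case (Suc k)
  have d: "f differentiable (at x)" for x
  proof -
    obtain U g where U: "open U" "x \<in> U" "C_k (Suc k) g" "\<forall>y\<in>U. f y = g y"
      using Suc.prems by blast
    then have "g differentiable (at x)" by simp
    then show ?thesis
      using U unfolding differentiable_def
      by (metis has_derivative_transform_within_open)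
  qed
  have "C_k k (partial i f)" for i
  proof (rule Suc.IH)
    fix x
    obtain U g where U: "open U" "x \<in> U" "C_k (Suc k) g" "\<forall>y\<in>U. f y = g y"
      using Suc.prems by blast
    have "partial i f y = partial i g y" if "y \<in> U" for y
      unfolding partial_def
      using frechet_derivative_transform_within_open[OF d U(1) that, of g] U(4) by simp
    then show "\<exists>U g. open U \<and> x \<in> U \<and> C_k k g \<and> (\<forall>y\<in>U. partial i f y = g y)"
      using U by (intro exI[of _ U] exI[of _ "partial i g"]) auto
  qed
  then show ?case using d by simp
qed

section \<open>Smooth functions flat at the origin and a smooth positive part\<close>

definition flat_poly :: "real \<Rightarrow> real poly \<Rightarrow> real \<Rightarrow> real" where
  "flat_poly d P t = (if t > 0 then poly P (1 / t) * exp (- d / t) else 0)"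

text \<open>Splitting off the constant coefficient of the polynomial leaves a shorter one multiplied
  by \<open>x ^ Suc k\<close>, so the induction runs for all powers \<open>k\<close>
  simultaneously.\<close>

lemma poly_div_exp_tendsto_0:
  fixes P :: "real poly"
  assumes "d > 0"
  shows "((\<lambda>x. x ^ k * poly P x * exp (- (d * x))) \<longlongrightarrow> 0) at_top"
proof (induction P arbitrary: k)
  case 0
  then show ?case by simp
next
  case (pCons a P)
  have "((\<lambda>x. (d * x) ^ k / exp (d * x)) \<longlongrightarrow> 0) at_top"
    by (rule filterlim_compose[OF tendsto_power_div_exp_0])
      (use assms in \<open>auto intro!: filterlim_tendsto_pos_mult_at_top filterlim_ident\<close>)
  from tendsto_mult_left[OF this, of "a / d ^ k"]
  have "((\<lambda>x. x ^ k * a * exp (- (d * x))) \<longlongrightarrow> 0) at_top"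
    using assms by (simp add: exp_minus field_simps power_mult_distrib)
  from tendsto_add[OF this pCons(2)[of "Suc k"]] show ?case
    by (simp add: algebra_simps)
qed

text \<open>With \<open>s = 1 / t\<close>, differentiation turns \<open>P s * exp (- d * s)\<close>
  into \<open>s ^ 2 * (d * P s - P' s) * exp (- d * s)\<close>. The family is thus closed under
  differentiation, which makes its members smooth. At 0 the difference quotient tends to 0 because
  the exponential beats every power of \<open>1 / t\<close>.\<close>

lemma flat_poly_has_derivative:
  assumes "d > 0"
  shows "(flat_poly d P has_real_derivative
    flat_poly d ([:0, 0, 1:] * (smult d P - pderiv P)) t) (at t)"
proof -
  consider "t > 0" | "t < 0" | "t = 0" by linarith
  then show ?thesis
  proof cases
    case 1
    have "((\<lambda>t. poly P (1 / t) * exp (- d / t)) has_real_derivative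
       flat_poly d ([:0, 0, 1:] * (smult d P - pderiv P)) t) (at t)"
      using 1 by (auto intro!: derivative_eq_intros simp: flat_poly_def field_simps power2_eq_square)
    then show ?thesis
      by (rule has_field_derivative_transform_within_open[of _ _ _ "{0<..}"])
        (use 1 in \<open>auto simp: flat_poly_def\<close>)
  next
    case 2
    have "((\<lambda>t. 0) has_real_derivative 0) (at t)" by simp
    then have "(flat_poly d P has_real_derivative 0) (at t)"
      by (rule has_field_derivative_transform_within_open[of _ _ _ "{..<0}"])
        (use 2 in \<open>auto simp: flat_poly_def\<close>)
    then show ?thesis using 2 by (simp add: flat_poly_def)
  next
    case 3
    have "((\<lambda>y. flat_poly d P y / y) \<longlongrightarrow> 0) (at_left 0)"
      by (rule Lim_transform_eventually[of "\<lambda>_. 0"])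
        (auto simp: flat_poly_def eventually_at_left_field intro!: exI[of _ "-1"])
    moreover have "((\<lambda>y. flat_poly d P y / y) \<longlongrightarrow> 0) (at_right 0)"
    proof -
      have "((\<lambda>y. inverse y ^ 1 * poly P (inverse y) * exp (- (d * inverse y))) \<longlongrightarrow> 0) (at_right 0)"
        by (rule filterlim_compose[OF poly_div_exp_tendsto_0[OF assms] filterlim_inverse_at_top_right])
      then show ?thesis
        by (rule Lim_transform_eventually)
          (auto simp: flat_poly_def eventually_at_right_field divide_simps intro!: exI[of _ "1"])
    qed
    ultimately have "((\<lambda>y. flat_poly d P y / y) \<longlongrightarrow> 0) (at 0)"
      by (rule filterlim_split_at)
    then show ?thesis
      using 3 by (simp add: has_field_derivative_iff flat_poly_def)
  qed
qed

lemma smooth_real_flat_poly: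
  assumes "d > 0"
  shows "smooth_real (flat_poly d P)"
proof -
  define Q where "Q k = ((\<lambda>P. [:0, 0, 1:] * (smult d P - pderiv P)) ^^ k) P" for k :: nat
  have "(flat_poly d (Q k) has_real_derivative flat_poly d (Q (Suc k)) t) (at t)" for k t
    using flat_poly_has_derivative[OF assms, of "Q k" t] by (simp add: Q_def)
  then show ?thesis
    unfolding smooth_real_def by (intro exI[of _ "\<lambda>k. flat_poly d (Q k)"]) (auto simp: Q_def)
qed

text \<open>A smooth substitute for the positive part that is exactly zero on the nonpositive axis;
  the exact vanishing later makes the truncations compactly supported.\<close>

definition smooth_plus :: "real \<Rightarrow> real \<Rightarrow> real" where
  "smooth_plus d s = (if s > 0 then s * exp (- d / s) else 0)"

lemma smooth_plus_has_derivative: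
  assumes "d > 0"
  shows "(smooth_plus d has_real_derivative flat_poly d [:1, d:] s) (at s)"
proof -
  consider "s > 0" | "s < 0" | "s = 0" by linarith
  then show ?thesis
  proof cases
    case 1
    have "((\<lambda>s. s * exp (- d / s)) has_real_derivative flat_poly d [:1, d:] s) (at s)"
      using 1 by (auto intro!: derivative_eq_intros simp: flat_poly_def field_simps power2_eq_square)
    then show ?thesis
      by (rule has_field_derivative_transform_within_open[of _ _ _ "{0<..}"])
        (use 1 in \<open>auto simp: smooth_plus_def\<close>)
  next
    case 2
    have "((\<lambda>t. 0) has_real_derivative 0) (at s)" by simp
    then have "(smooth_plus d has_real_derivative 0) (at s)"
      by (rule has_field_derivative_transform_within_open[of _ _ _ "{..<0}"])
        (use 2 in \<open>auto simp: smooth_plus_def\<close>)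
    then show ?thesis using 2 by (simp add: flat_poly_def)
  next
    case 3
    \<comment> \<open>At 0 the difference quotient of \<open>smooth_plus d\<close> is itself a flat
      function, so its limit is the continuity of that function.\<close>
    have "(flat_poly d [:1:] \<longlongrightarrow> flat_poly d [:1:] 0) (at 0)"
      using DERIV_isCont[OF flat_poly_has_derivative[OF assms]] isCont_def by blast
    moreover have "eventually (\<lambda>s. flat_poly d [:1:] s = smooth_plus d s / s) (at 0)"
      by (auto simp: eventually_at flat_poly_def smooth_plus_def intro!: exI[of _ 1])
    ultimately have "((\<lambda>s. smooth_plus d s / s) \<longlongrightarrow> flat_poly d [:1:] 0) (at 0)"
      by (rule Lim_transform_eventually)
    then have "((\<lambda>s. smooth_plus d s / s) \<longlongrightarrow> 0) (at 0)"
      by (simp add: flat_poly_def)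
    then show ?thesis using 3 by (simp add: has_field_derivative_iff flat_poly_def smooth_plus_def)
  qed
qed

lemma smooth_real_smooth_plus:
  assumes "d > 0"
  shows "smooth_real (smooth_plus d)"
proof -
  obtain D where D: "D 0 = flat_poly d [:1, d:]" "\<And>k t. (D k has_real_derivative D (Suc k) t) (at t)"
    using smooth_real_flat_poly[OF assms, of "[:1, d:]"] unfolding smooth_real_def by blast
  have "((case k of 0 \<Rightarrow> smooth_plus d | Suc j \<Rightarrow> D j) has_real_derivative D k t) (at t)" for k t
    using D smooth_plus_has_derivative[OF assms] by (cases k) auto
  then show ?thesis
    unfolding smooth_real_def
    by (intro exI[of _ "\<lambda>k. case k of 0 \<Rightarrow> smooth_plus d | Suc j \<Rightarrow> D j"]) auto
qed

text \<open>Both estimates are \<open>1 + x \<le> exp x\<close>, taken at \<open>x = - d / s\<close>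
  for the distance to the positive part and at \<open>x = d / s\<close> for the derivative
  \<open>(1 + d / s) * exp (- d / s)\<close>.\<close>

lemma smooth_plus_bounds:
  assumes "d > 0"
  shows "max s 0 - d \<le> smooth_plus d s" "smooth_plus d s \<le> max s 0"
    and "0 \<le> flat_poly d [:1, d:] s" "flat_poly d [:1, d:] s \<le> 1"
proof -
  show "smooth_plus d s \<le> max s 0"
    using assms by (auto simp: smooth_plus_def)
  have "s - d \<le> s * exp (- d / s)" if "s > 0"
  proof -
    have "s - d = s * (1 + - d / s)" using that by (simp add: field_simps)
    also have "\<dots> \<le> s * exp (- d / s)"
      using that by (intro mult_left_mono exp_ge_add_one_self) auto
    finally show ?thesis .
  qed
  then show "max s 0 - d \<le> smooth_plus d s"
    using assms by (auto simp: smooth_plus_def)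
  show "0 \<le> flat_poly d [:1, d:] s"
    using assms by (auto simp: flat_poly_def)
  have "(1 + d / s) * exp (- (d / s)) \<le> exp (d / s) * exp (- (d / s))"
    by (intro mult_right_mono exp_ge_add_one_self) auto
  also have "\<dots> = 1" by (simp flip: exp_add)
  finally show "flat_poly d [:1, d:] s \<le> 1"
    by (auto simp: flat_poly_def)
qed

text \<open>These are the slopes of the smooth positive parts as their parameter shrinks. At
  \<open>s0 = 0\<close> the outcome would depend on how fast \<open>s k\<close> and
  \<open>d k\<close> vanish; this is why truncation levels must be values attained only on null
  sets.\<close>

lemma flat_poly_tendsto_indicator:
  assumes "d \<longlonglongrightarrow> 0" "s \<longlonglongrightarrow> s0" "s0 \<noteq> 0"
  shows "(\<lambda>k. flat_poly (d k) [:1, d k:] (s k)) \<longlonglongrightarrow> (if s0 > 0 then 1 else 0)"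
proof (cases "s0 > 0")
  case True
  have "(\<lambda>k. (1 + d k / s k) * exp (- d k / s k)) \<longlonglongrightarrow> (1 + 0 / s0) * exp (- 0 / s0)"
    using assms by (intro tendsto_intros) auto
  then have lim: "(\<lambda>k. (1 + d k / s k) * exp (- d k / s k)) \<longlonglongrightarrow> 1"
    by simp
  have "eventually (\<lambda>k. s k > 0) sequentially"
    using assms(2) True order_tendstoD(1) by blast
  then have "eventually (\<lambda>k. (1 + d k / s k) * exp (- d k / s k) = flat_poly (d k) [:1, d k:] (s k)) sequentially"
    by eventually_elim (auto simp: flat_poly_def)
  from Lim_transform_eventually[OF lim this] show ?thesis using True by simp
next
  case False
  then have "s0 < 0" using assms by simp
  then have "eventually (\<lambda>k. s k < 0) sequentially"
    using assms(2) order_tendstoD(2) by blast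
  then have "eventually (\<lambda>k. 0 = flat_poly (d k) [:1, d k:] (s k)) sequentially"
    by eventually_elim (auto simp: flat_poly_def)
  from Lim_transform_eventually[OF tendsto_const this] show ?thesis using False by simp
qed

section \<open>Mollification\<close>

lemma test_functionsD:
  assumes "\<eta> \<in> test_functions \<Omega>"
  shows "C_k k \<eta>" "compact (closure {x. \<eta> x \<noteq> 0})" "closure {x. \<eta> x \<noteq> 0} \<subseteq> \<Omega>"
    "\<eta> differentiable (at x)" "continuous_on S \<eta>" "\<eta> \<in> borel_measurable borel"
proof -
  show k: "C_k k \<eta>" for k using assms by (simp add: test_functions_def)
  show "compact (closure {x. \<eta> x \<noteq> 0})" "closure {x. \<eta> x \<noteq> 0} \<subseteq> \<Omega>"
    using assms by (auto simp: test_functions_def)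
  show "\<eta> differentiable (at x)" using k[of "Suc 0"] by simp
  show c: "continuous_on S \<eta>" for S using C_k_imp_continuous_on[OF k[of 0]] .
  show "\<eta> \<in> borel_measurable borel" using c[of UNIV] by (rule borel_measurable_continuous_onI)
qed

lemma test_functions_partial:
  assumes "\<eta> \<in> test_functions \<Omega>"
  shows "partial i \<eta> \<in> test_functions \<Omega>"
proof -
  let ?S = "closure {x. \<eta> x \<noteq> 0}"
  have "partial i \<eta> x = 0" if "x \<notin> ?S" for x
  proof -
    have "open (- ?S)" "x \<in> - ?S" using that by auto
    moreover have "0 = \<eta> y" if "y \<in> - ?S" for y
      using that closure_subset[of "{x. \<eta> x \<noteq> 0}"] by auto
    ultimately have "(\<eta> has_derivative (\<lambda>h. 0)) (at x)"
      using has_derivative_transform_within_open[OF has_derivative_const[of 0 "at x"], of "- ?S" \<eta>] by blast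
    from partial_eqI[OF this] show ?thesis .
  qed
  then have "{x. partial i \<eta> x \<noteq> 0} \<subseteq> ?S" by blast
  then have "closure {x. partial i \<eta> x \<noteq> 0} \<subseteq> ?S" by (simp add: closure_minimal)
  moreover have "compact (closure {x. partial i \<eta> x \<noteq> 0})"
    using calculation test_functionsD(2)[OF assms]
    by (meson bounded_subset closed_closure compact_eq_bounded_closed)
  moreover have "C_k k (partial i \<eta>)" for k
    using test_functionsD(1)[OF assms, of "Suc k"] by simp
  ultimately show ?thesis
    using assms unfolding test_functions_def
    by auto
qed

lemma test_functions_bounded:
  assumes "\<eta> \<in> test_functions \<Omega>"
  obtains B where "B > 0" "\<And>x. \<bar>\<eta> x\<bar> \<le> B"
proof -
  let ?S = "closure {x. \<eta> x \<noteq> 0}"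
  have "compact (\<eta> ` ?S)"
    using test_functionsD[OF assms] by (intro compact_continuous_image) auto
  then obtain B where B: "B > 0" "\<And>x. x \<in> ?S \<Longrightarrow> \<bar>\<eta> x\<bar> \<le> B"
    using compact_imp_bounded bounded_pos by (metis image_eqI real_norm_def)
  have "\<bar>\<eta> x\<bar> \<le> B" for x
    using B closure_subset[of "{x. \<eta> x \<noteq> 0}"] by (cases "\<eta> x = 0") auto
  with B(1) that show thesis by blast
qed

lemma onorm_inner_le: "onorm (\<lambda>h. v \<bullet> h) \<le> norm v"
  by (rule onorm_bound) (simp_all add: Cauchy_Schwarz_ineq2)

lemma test_functions_lipschitz:
  fixes \<eta> :: "real ^ 'n::finite \<Rightarrow> real"
  assumes "\<eta> \<in> test_functions \<Omega>"
  obtains L where "L > 0" "\<And>x y. \<bar>\<eta> x - \<eta> y\<bar> \<le> L * norm (x - y)"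
proof -
  have "\<exists>B. B > 0 \<and> (\<forall>x. \<bar>partial i \<eta> x\<bar> \<le> B)" for i
    using test_functions_bounded[OF test_functions_partial[OF assms]] by metis
  then obtain B where B: "\<And>i. B i > 0" "\<And>i x. \<bar>partial i \<eta> x\<bar> \<le> B i" by metis
  let ?L = "\<Sum>i\<in>UNIV. B i"
  have "norm (grad \<eta> x) \<le> ?L" for x
  proof -
    have "norm (grad \<eta> x) \<le> (\<Sum>i\<in>UNIV. \<bar>grad \<eta> x $ i\<bar>)" by (rule norm_le_l1_cart)
    also have "\<dots> \<le> ?L" by (intro sum_mono) (simp add: grad_def B)
    finally show ?thesis .
  qed
  then have on: "onorm (\<lambda>h. grad \<eta> x \<bullet> h) \<le> ?L" for x
    by (rule order_trans[OF onorm_inner_le])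
  have "norm (\<eta> x - \<eta> y) \<le> ?L * norm (x - y)" for x y
    by (rule differentiable_bound[of UNIV \<eta> "\<lambda>x h. grad \<eta> x \<bullet> h"])
       (use on test_functionsD(4)[OF assms] in \<open>auto intro!: has_derivative_grad\<close>)
  moreover have "?L > 0" using B(1) by (intro sum_pos) auto
  ultimately show thesis using that by auto
qed

section \<open>Convolution with a test function\<close>

definition conv ::
    "(real ^ 'n::finite \<Rightarrow> real) \<Rightarrow> (real ^ 'n \<Rightarrow> 'b::euclidean_space) \<Rightarrow> real ^ 'n \<Rightarrow> 'b" where
  "conv \<eta> f x = (LINT y|lborel. \<eta> (x - y) *\<^sub>R f y)"

lemma conv_integrable:
  fixes f :: "real ^ 'n::finite \<Rightarrow> 'b::euclidean_space"
  assumes "\<eta> \<in> borel_measurable borel" "\<And>x. \<bar>\<eta> x\<bar> \<le> B" and "integrable lborel f"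
  shows "integrable lborel (\<lambda>y. \<eta> (x - y) *\<^sub>R f y)"
proof -
  have [measurable]: "\<eta> \<in> borel_measurable borel" "f \<in> borel_measurable borel"
    using assms by auto
  show ?thesis
  proof (rule Bochner_Integration.integrable_bound[of _ "\<lambda>y. B *\<^sub>R f y"])
    show "integrable lborel (\<lambda>y. B *\<^sub>R f y)" using assms by auto
    have "norm (\<eta> (x - y) *\<^sub>R f y) \<le> norm (B *\<^sub>R f y)" for y
      using assms(2)[of "x - y"] by (simp add: mult_right_mono)
    then show "AE y in lborel. norm (\<eta> (x - y) *\<^sub>R f y) \<le> norm (B *\<^sub>R f y)" by simp
  qed simp
qed

lemma conv_integrable_test:
  fixes f :: "real ^ 'n::finite \<Rightarrow> 'b::euclidean_space"
  assumes "\<eta> \<in> test_functions \<Omega>" and "integrable lborel f"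
  shows "integrable lborel (\<lambda>y. \<eta> (x - y) *\<^sub>R f y)"
  using assms test_functions_bounded[OF assms(1)] conv_integrable[OF test_functionsD(6)[OF assms(1)]]
  by metis

text \<open>The gradient of \<open>\<eta>\<close> is Lipschitz, so its first-order Taylor remainder
  is at most \<open>M * norm h ^ 2\<close> uniformly in the base point. Integrating it against
  \<open>u\<close> costs only the factor \<open>I\<close>, the L1 norm of \<open>u\<close>.\<close>

lemma conv_has_derivative:
  fixes u :: "real ^ 'n::finite \<Rightarrow> real"
  assumes \<eta>: "\<eta> \<in> test_functions \<Omega>" and u: "integrable lborel u"
  shows "(conv \<eta> u has_derivative (\<lambda>h. \<Sum>i\<in>UNIV. h $ i * conv (partial i \<eta>) u x)) (at x)"
  unfolding has_derivative_at_alt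
proof (intro conjI allI impI)
  show "bounded_linear (\<lambda>h. \<Sum>i\<in>UNIV. h $ i * conv (partial i \<eta>) u x)"
    by (intro bounded_linear_sum bounded_linear_mult_left[THEN bounded_linear_compose] bounded_linear_vec_nth)
  fix e :: real assume "e > 0"
  define I where "I = (LINT y|lborel. \<bar>u y\<bar>)"
  have I: "I \<ge> 0" unfolding I_def by simp
  have "\<exists>L. L > 0 \<and> (\<forall>x y. \<bar>partial i \<eta> x - partial i \<eta> y\<bar> \<le> L * norm (x - y))" for i
    using test_functions_lipschitz[OF test_functions_partial[OF \<eta>]] by metis
  then obtain L where L: "\<And>i. L i > 0"
    "\<And>i x y. \<bar>partial i \<eta> x - partial i \<eta> y\<bar> \<le> L i * norm (x - y)" by metis
  define M where "M = (\<Sum>i\<in>UNIV. L i)"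
  have M: "M > 0" unfolding M_def using L(1) by (intro sum_pos) auto
  have gl: "norm (grad \<eta> a - grad \<eta> b) \<le> M * norm (a - b)" for a b
  proof -
    have "norm (grad \<eta> a - grad \<eta> b) \<le> (\<Sum>i\<in>UNIV. \<bar>(grad \<eta> a - grad \<eta> b) $ i\<bar>)"
      by (rule norm_le_l1_cart)
    also have "\<dots> \<le> (\<Sum>i\<in>UNIV. L i * norm (a - b))"
      by (intro sum_mono) (simp add: grad_def L)
    finally show ?thesis by (simp add: M_def sum_distrib_right)
  qed
  have rem: "\<bar>\<eta> (a + h) - \<eta> a - grad \<eta> a \<bullet> h\<bar> \<le> norm h * (M * norm h)" for a h
  proof -
    have "norm (\<eta> (a + h) - \<eta> a - grad \<eta> a \<bullet> (a + h - a)) \<le> norm (a + h - a) * (M * norm h)"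
    proof (rule differentiable_bound_linearization[where S = "cball a (norm h)" and
          f' = "\<lambda>x h. grad \<eta> x \<bullet> h"])
      fix z assume "z \<in> cball a (norm h)"
      show "(\<eta> has_derivative (\<lambda>h. grad \<eta> z \<bullet> h)) (at z within cball a (norm h))"
        using has_derivative_grad[OF test_functionsD(4)[OF \<eta>]] has_derivative_at_withinI by blast
      have "onorm (\<lambda>h. (grad \<eta> z - grad \<eta> a) \<bullet> h) \<le> norm (grad \<eta> z - grad \<eta> a)"
        by (rule onorm_inner_le)
      also have "\<dots> \<le> M * norm (z - a)" by (rule gl)
      also have "\<dots> \<le> M * norm h"
        using \<open>z \<in> cball a (norm h)\<close> M by (simp add: dist_norm norm_minus_commute)
      finally show "onorm ((\<lambda>h. grad \<eta> z \<bullet> h) - (\<lambda>h. grad \<eta> a \<bullet> h)) \<le> M * norm h"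
        by (simp add: inner_diff_left fun_diff_def)
    next
      fix t :: real assume "t \<in> {0..1}"
      then show "a + t *\<^sub>R (a + h - a) \<in> cball a (norm h)"
        by (auto simp: dist_norm mult_left_le_one_le)
    qed auto
    then show ?thesis by simp
  qed
  \<comment> \<open>Chosen so that \<open>M * d * (I + 1) = e\<close>; the summand 1 keeps the
    denominator positive when \<open>u\<close> vanishes.\<close>
  define d where "d = e / (M * (I + 1))"
  have d: "d > 0" using \<open>e > 0\<close> M I by (simp add: d_def)
  show "\<exists>d>0. \<forall>y. norm (y - x) < d \<longrightarrow> norm (conv \<eta> u y - conv \<eta> u x -
      (\<Sum>i\<in>UNIV. (y - x) $ i * conv (partial i \<eta>) u x)) \<le> e * norm (y - x)"
  proof (intro exI[of _ d] conjI allI impI d)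
    fix y assume y: "norm (y - x) < d"
    define h where "h = y - x"
    note int = conv_integrable_test[OF \<eta> u] conv_integrable_test[OF test_functions_partial[OF \<eta>] u]
    note int' = int[simplified]
    have "conv \<eta> u y - conv \<eta> u x - (\<Sum>i\<in>UNIV. h $ i * conv (partial i \<eta>) u x) =
      (LINT z|lborel. \<eta> (y - z) * u z - \<eta> (x - z) * u z - (\<Sum>i\<in>UNIV. h $ i * (partial i \<eta> (x - z) * u z)))"
      unfolding conv_def using int' by simp
    also have "\<dots> = (LINT z|lborel. (\<eta> ((x - z) + h) - \<eta> (x - z) - grad \<eta> (x - z) \<bullet> h) * u z)"
      by (intro Bochner_Integration.integral_cong refl)
        (simp add: h_def inner_vec_def grad_def algebra_simps sum_distrib_left)
    finally have eq: "conv \<eta> u y - conv \<eta> u x - (\<Sum>i\<in>UNIV. h $ i * conv (partial i \<eta>) u x) = \<dots>" .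
    have "norm (LINT z|lborel. (\<eta> ((x - z) + h) - \<eta> (x - z) - grad \<eta> (x - z) \<bullet> h) * u z)
      \<le> (LINT z|lborel. norm h * (M * norm h) * \<bar>u z\<bar>)"
    proof (rule Bochner_Integration.integral_norm_bound[THEN order_trans], rule integral_mono')
      show "integrable lborel (\<lambda>z. norm h * (M * norm h) * \<bar>u z\<bar>)" using u by auto
      fix z
      show "norm ((\<eta> ((x - z) + h) - \<eta> (x - z) - grad \<eta> (x - z) \<bullet> h) * u z) \<le> norm h * (M * norm h) * \<bar>u z\<bar>"
        unfolding real_norm_def abs_mult by (intro mult_right_mono rem) auto
      show "0 \<le> norm h * (M * norm h) * \<bar>u z\<bar>" using M by simp
    qed
    also have "\<dots> = norm h * (M * norm h * I)" by (simp add: I_def)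
    also have "\<dots> \<le> norm h * (M * d * (I + 1))"
      using y M I d by (intro mult_left_mono mult_mono) (auto simp: h_def)
    also have "M * d * (I + 1) = e" using M I by (simp add: d_def)
    finally have "norm (LINT z|lborel. (\<eta> ((x - z) + h) - \<eta> (x - z) - grad \<eta> (x - z) \<bullet> h) * u z) \<le> norm h * e" .
    then show "norm (conv \<eta> u y - conv \<eta> u x -
      (\<Sum>i\<in>UNIV. (y - x) $ i * conv (partial i \<eta>) u x)) \<le> e * norm (y - x)"
      using eq by (simp add: h_def mult.commute)
  qed
qed

lemma partial_conv:
  fixes u :: "real ^ 'n::finite \<Rightarrow> real"
  assumes \<eta>: "\<eta> \<in> test_functions \<Omega>" and u: "integrable lborel u"
  shows "partial i (conv \<eta> u) = conv (partial i \<eta>) u"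
proof
  fix x
  show "partial i (conv \<eta> u) x = conv (partial i \<eta>) u x"
    unfolding partial_eqI[OF conv_has_derivative[OF assms]]
    by (simp add: axis_def if_distrib[of "\<lambda>c. c * _"] cong: if_cong)
qed

lemma C_k_conv:
  fixes u :: "real ^ 'n::finite \<Rightarrow> real"
  assumes \<eta>: "\<eta> \<in> test_functions \<Omega>" and u: "integrable lborel u"
  shows "C_k k (conv \<eta> u)"
  using \<eta>
proof (induction k arbitrary: \<eta>)
  case 0
  have "isCont (conv \<eta> u) x" for x
    using conv_has_derivative[OF 0 u] has_derivative_continuous by blast
  then show ?case by (simp add: continuous_at_imp_continuous_on)
next
  case (Suc k)
  have "conv \<eta> u differentiable (at x)" for x
    using conv_has_derivative[OF Suc.prems u] unfolding differentiable_def by blast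
  then show ?case
    using Suc by (simp add: partial_conv[OF Suc.prems u] test_functions_partial)
qed

text \<open>For \<open>norm x < d\<close> the numerator is
  \<open>exp (- 1 / (d ^ 2 - norm x ^ 2))\<close>, the standard bump function, and it is 0
  elsewhere. The denominator normalises the total mass to 1.\<close>

definition mollifier :: "real \<Rightarrow> real ^ 'n::finite \<Rightarrow> real" where
  "mollifier d x = flat_poly 1 [:1:] (d\<^sup>2 - x \<bullet> x) /
     (LINT y|lborel. flat_poly 1 [:1:] (d\<^sup>2 - (y::real ^ 'n) \<bullet> y))"

lemma mollifier:
  fixes \<eta> :: "real ^ 'n::finite \<Rightarrow> real"
  assumes "d > 0"
  defines "\<eta> \<equiv> mollifier d"
  shows "\<eta> \<in> test_functions UNIV" "\<eta> x \<ge> 0" "norm x \<ge> d \<Longrightarrow> \<eta> x = 0"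
    "(\<integral>\<^sup>+x. ennreal (\<eta> x) \<partial>lborel) = 1"
proof -
  define b where "b x = flat_poly 1 [:1:] (d\<^sup>2 - x \<bullet> x)" for x :: "real ^ 'n"
  have b: "b x \<ge> 0" "b x > 0 \<longleftrightarrow> norm x < d" for x
  proof -
    have "x \<bullet> x < d\<^sup>2 \<longleftrightarrow> norm x < d"
      using assms(1) by (metis less_eq_real_def norm_eq_sqrt_inner norm_ge_zero power2_norm_eq_inner power_strict_mono power2_less_imp_less pos2)
    then show "b x \<ge> 0" "b x > 0 \<longleftrightarrow> norm x < d" by (auto simp: b_def flat_poly_def)
  qed
  have "C_k k b" for k
    unfolding b_def
    using C_k_compose[OF smooth_real_flat_poly[of 1 "[:1:]"] C_k_diff[OF C_k_const[of k "d\<^sup>2"] C_k_inner_self_diff[of k 0]]]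
    by simp
  moreover have cl: "closure {x. b x \<noteq> 0} \<subseteq> cball 0 d"
  proof (rule closure_minimal)
    show "{x. b x \<noteq> 0} \<subseteq> cball 0 d"
      using b by (auto simp: less_le dist_norm)
  qed simp
  moreover have "compact (closure {x. b x \<noteq> 0})"
    using cl by (meson bounded_cball bounded_subset closed_closure compact_eq_bounded_closed)
  ultimately have tf: "b \<in> test_functions UNIV"
    unfolding test_functions_def by auto
  obtain B where B: "B > 0" "\<And>x. \<bar>b x\<bar> \<le> B" using test_functions_bounded[OF tf] by metis
  have [measurable]: "b \<in> borel_measurable borel" using test_functionsD(6)[OF tf] .
  have int: "integrable lborel b"
  proof (rule Bochner_Integration.integrable_bound[of _ "\<lambda>x. B * indicator (cball 0 d) x"])
    show "integrable lborel (\<lambda>x. B * indicator (cball (0::real^'n) d) x)"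
      using emeasure_bounded_finite[OF bounded_cball, of "0::real^'n" d]
      by (intro integrable_mult_right integrable_real_indicator) simp_all
    show "AE x in lborel. norm (b x) \<le> norm (B * indicator (cball 0 d) x)"
      using B b by (auto intro!: AE_I2 simp: indicator_def dist_norm) (smt (verit))
  qed simp
  define c where "c = (LINT y|lborel. b y)"
  \<comment> \<open>If the integral vanished, the ball on which \<open>b\<close> is positive would
    be a null set.\<close>
  have "c \<noteq> 0"
  proof
    assume "c = 0"
    then have "AE x in lborel. b x = 0"
      using integral_nonneg_eq_0_iff_AE[OF int] b(1) by (simp add: c_def)
    moreover have "b x = 0 \<Longrightarrow> x \<notin> ball 0 d" for x
      using b(2)[of x] by auto
    ultimately have "AE x in lborel. x \<notin> ball (0::real^'n) d"
      by (rule eventually_mono)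
    moreover have "{x \<in> space lborel. \<not> x \<notin> ball 0 d} = ball (0::real^'n) d" by auto
    ultimately have "emeasure lborel (ball (0::real^'n) d) = 0"
      using AE_iff_measurable[of "ball (0::real^'n) d" lborel "\<lambda>x. x \<notin> ball 0 d"] by (metis borel_open open_ball sets_lborel)
    then show False
      using open_not_negligible[of "ball (0::real^'n) d"] assms(1)
      unfolding negligible_iff_null_sets null_sets_def by (simp del: mem_ball)
  qed
  moreover have "c \<ge> 0" unfolding c_def by (simp add: b)
  ultimately have c: "c > 0" by simp
  have eq: "\<eta> = (\<lambda>x. inverse c * b x)"
    unfolding \<eta>_def mollifier_def c_def b_def by (auto simp: field_simps)
  have "{x. \<eta> x \<noteq> 0} = {x. b x \<noteq> 0}" using c by (auto simp: eq)
  moreover have "C_k k \<eta>" for k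
    unfolding eq by (intro C_k_mult C_k_const) (use tf in \<open>auto simp: test_functions_def\<close>)
  ultimately show "\<eta> \<in> test_functions UNIV" using tf unfolding test_functions_def by auto
  show "\<eta> x \<ge> 0" using c b by (simp add: eq)
  show "norm x \<ge> d \<Longrightarrow> \<eta> x = 0" using b(1)[of x] b(2)[of x] by (simp add: eq)
  have "(\<integral>\<^sup>+x. ennreal (\<eta> x) \<partial>lborel) = ennreal (LINT x|lborel. \<eta> x)"
    using c b int by (intro nn_integral_eq_integral) (auto simp: eq)
  also have "(LINT x|lborel. \<eta> x) = 1" using c by (simp add: eq c_def)
  finally show "(\<integral>\<^sup>+x. ennreal (\<eta> x) \<partial>lborel) = 1" by simp
qed

section \<open>Fubini and L1 estimates for convolutions\<close>

lemma nn_integral_lborel_translate: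
  fixes f :: "'a::euclidean_space \<Rightarrow> ennreal"
  assumes [measurable]: "f \<in> borel_measurable borel"
  shows "(\<integral>\<^sup>+x. f (x + c) \<partial>lborel) = (\<integral>\<^sup>+x. f x \<partial>lborel)"
  by (subst (2) lborel_distr_plus[of c, symmetric])
    (simp add: nn_integral_distr add.commute)

lemma nn_integral_lborel_reflect:
  fixes f :: "'a::euclidean_space \<Rightarrow> ennreal"
  assumes [measurable]: "f \<in> borel_measurable borel"
  shows "(\<integral>\<^sup>+x. f (c - x) \<partial>lborel) = (\<integral>\<^sup>+x. f x \<partial>lborel)"
  by (subst (2) lborel_affine[of "-1" c]) (simp_all add: nn_integral_distr density_1)

lemma nn_integral_conv:
  fixes F :: "real ^ 'n::finite \<Rightarrow> ennreal"
  assumes [measurable]: "\<eta> \<in> borel_measurable borel" "F \<in> borel_measurable borel"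
    and "(\<integral>\<^sup>+x. ennreal (\<eta> x) \<partial>lborel) = 1"
  shows "(\<integral>\<^sup>+x. (\<integral>\<^sup>+y. ennreal (\<eta> (x - y)) * F y \<partial>lborel) \<partial>lborel) = (\<integral>\<^sup>+y. F y \<partial>lborel)"
proof -
  have one: "(\<integral>\<^sup>+x. ennreal (\<eta> (x - y)) \<partial>lborel) = 1" for y
    using nn_integral_lborel_translate[of "\<lambda>x. ennreal (\<eta> x)" "- y"] assms by simp
  have "(\<integral>\<^sup>+x. (\<integral>\<^sup>+y. ennreal (\<eta> (x - y)) * F y \<partial>lborel) \<partial>lborel) =
     (\<integral>\<^sup>+y. (\<integral>\<^sup>+x. ennreal (\<eta> (x - y)) * F y \<partial>lborel) \<partial>lborel)"
    by (intro lborel_pair.Fubini') measurable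
  also have "\<dots> = (\<integral>\<^sup>+y. (\<integral>\<^sup>+x. ennreal (\<eta> (x - y)) \<partial>lborel) * F y \<partial>lborel)"
    by (simp add: nn_integral_multc)
  also have "\<dots> = (\<integral>\<^sup>+y. F y \<partial>lborel)" by (simp add: one)
  finally show ?thesis .
qed

lemma norm_conv_le:
  assumes \<eta>: "\<eta> \<in> test_functions \<Omega>" "\<And>x. \<eta> x \<ge> 0" and f: "integrable lborel f"
  shows "ennreal (norm (conv \<eta> f x)) \<le> (\<integral>\<^sup>+y. ennreal (\<eta> (x - y)) * ennreal (norm (f y)) \<partial>lborel)"
proof -
  have "ennreal (norm (conv \<eta> f x)) \<le> (\<integral>\<^sup>+y. ennreal (norm (\<eta> (x - y) *\<^sub>R f y)) \<partial>lborel)"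
    unfolding conv_def by (rule integral_norm_bound_ennreal[OF conv_integrable_test[OF \<eta>(1) f]])
  also have "\<dots> = (\<integral>\<^sup>+y. ennreal (\<eta> (x - y)) * ennreal (norm (f y)) \<partial>lborel)"
    using \<eta>(2) by (simp add: ennreal_mult)
  finally show ?thesis .
qed

lemma borel_measurable_conv:
  assumes [measurable]: "\<eta> \<in> borel_measurable borel" "f \<in> borel_measurable borel"
  shows "conv \<eta> f \<in> borel_measurable borel"
proof -
  have "(\<lambda>x. LINT y|lborel. \<eta> (x - y) *\<^sub>R f y) \<in> borel_measurable lborel"
    by (intro lborel.borel_measurable_lebesgue_integral) measurable
  then show ?thesis by (simp add: conv_def[abs_def])
qed

text \<open>Density of continuous functions in L1, by induction over integrable functions. For an
  indicator, a closed set inside and an open set outside with small difference are joined by a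
  Urysohn function. Boundedness of \<open>g\<close> is carried along for the dominated convergence
  in \<open>nn_integral_conv_diff_tendsto_0\<close>.\<close>

lemma integrable_approx_continuous:
  fixes f :: "'a::euclidean_space \<Rightarrow> 'b::euclidean_space"
  assumes "integrable lborel f" "e > 0"
  shows "\<exists>g. continuous_on UNIV g \<and> bounded (range g) \<and> integrable lborel g \<and>
    (LINT x|lborel. norm (f x - g x)) < e"
  using assms
proof (induction f arbitrary: e rule: integrable_induct)
  case (base A c)
  \<comment> \<open>The summand 1 makes \<open>norm c * e' < e\<close> hold also for
    \<open>c = 0\<close>.\<close>
  define e' where "e' = e / (norm c + 1)"
  have e': "e' > 0" using base(3) by (simp add: e'_def add_nonneg_pos)
  have A: "A \<in> sets lebesgue" using base(1) by simp
  obtain T where T: "closed T" "T \<subseteq> A" "A - T \<in> lmeasurable" "emeasure lebesgue (A - T) < ennreal (e' / 2)"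
    using sets_lebesgue_inner_closed[OF A, of "e' / 2"] e' by auto
  obtain U where U: "open U" "A \<subseteq> U" "U - A \<in> lmeasurable" "emeasure lebesgue (U - A) < ennreal (e' / 2)"
    using sets_lebesgue_outer_open[OF A, of "e' / 2"] e' by auto
  obtain \<phi> :: "'a \<Rightarrow> real" where \<phi>: "continuous_on UNIV \<phi>" "\<And>x. \<phi> x \<in> closed_segment 1 0"
    "\<And>x. x \<in> T \<Longrightarrow> \<phi> x = 1" "\<And>x. x \<in> - U \<Longrightarrow> \<phi> x = 0"
    using Urysohn[of T "- U" "1::real" 0] T(1,2) U(1,2) by (metis Compl_disjoint2 closed_Compl disjoint_eq_subset_Compl double_complement order_trans)
  have \<phi>01: "0 \<le> \<phi> x" "\<phi> x \<le> 1" for x using \<phi>(2)[of x] by (auto simp: closed_segment_eq_real_ivl)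
  have [measurable]: "\<phi> \<in> borel_measurable borel" "U \<in> sets borel" "A \<in> sets borel" "T \<in> sets borel"
    using \<phi>(1) T U base(1) by (auto intro: borel_measurable_continuous_onI)
  have UA: "emeasure lborel (U - A) < ennreal (e' / 2)" "emeasure lborel (A - T) < ennreal (e' / 2)"
    using U T by simp_all
  have "emeasure lborel (U - T) = emeasure lborel ((U - A) \<union> (A - T))"
    using T U by (intro arg_cong[of _ _ "emeasure lborel"]) auto
  also have "\<dots> \<le> emeasure lborel (U - A) + emeasure lborel (A - T)"
    by (rule emeasure_subadditive) auto
  also have "\<dots> < ennreal (e' / 2) + ennreal (e' / 2)" using UA by (rule add_strict_mono)
  also have "\<dots> = ennreal e'" using e' by (simp flip: ennreal_plus)
  finally have UT: "emeasure lborel (U - T) < ennreal e'" .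
  then have UT_fin: "emeasure lborel (U - T) < \<infinity>"
    using order.strict_trans ennreal_less_top by fastforce
  have "emeasure lborel U = emeasure lborel ((U - A) \<union> A)"
    using U by (intro arg_cong[of _ _ "emeasure lborel"]) auto
  also have "\<dots> \<le> emeasure lborel (U - A) + emeasure lborel A"
    by (rule emeasure_subadditive) auto
  also have "\<dots> < \<infinity>" using UA base(2) by (auto simp: less_top intro: order.strict_trans)
  finally have U_fin: "emeasure lborel U < \<infinity>" .
  define g where "g x = \<phi> x *\<^sub>R c" for x
  have "integrable lborel g"
  proof (rule Bochner_Integration.integrable_bound[of _ "\<lambda>x. indicator U x *\<^sub>R c"])
    show "integrable lborel (\<lambda>x. indicator U x *\<^sub>R c)"
      using U_fin by (intro integrable_scaleR_left) simp
    show "AE x in lborel. norm (g x) \<le> norm (indicator U x *\<^sub>R c)"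
      using \<phi>01 \<phi>(4) by (auto intro!: AE_I2 simp: g_def indicator_def mult_left_le_one_le)
  qed (use \<open>\<phi> \<in> borel_measurable borel\<close> in \<open>simp add: g_def[abs_def]\<close>)
  moreover have "continuous_on UNIV g" unfolding g_def using \<phi>(1) by (intro continuous_intros)
  moreover have "norm (g x) \<le> norm c" for x
    using \<phi>01[of x] by (simp add: g_def mult_left_le_one_le)
  then have "bounded (range g)" by (auto simp: bounded_iff)
  moreover have "(LINT x|lborel. norm (indicator A x *\<^sub>R c - g x)) \<le> (LINT x|lborel. norm c * indicator (U - T) x)"
  proof (rule integral_mono')
    show "integrable lborel (\<lambda>x. norm c * indicator (U - T) x)"
      using UT_fin by (intro integrable_mult_right integrable_real_indicator) simp_all
    fix x
    have "\<bar>indicator A x - \<phi> x\<bar> \<le> (indicator (U - T) x :: real)"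
      using \<phi>01[of x] \<phi>(3,4)[of x] T(2) U(2) by (auto simp: indicator_def)
    then show "norm (indicator A x *\<^sub>R c - g x) \<le> norm c * indicator (U - T) x"
      unfolding g_def scaleR_diff_left[symmetric] norm_scaleR by (simp add: mult.commute mult_left_mono)
  qed auto
  moreover have "(LINT x|lborel. norm c * indicator (U - T) x) = norm c * measure lborel (U - T)"
    by simp
  moreover have "measure lborel (U - T) < e'"
    using UT UT_fin e' by (simp add: emeasure_eq_ennreal_measure ennreal_less_iff)
  then have "norm c * measure lborel (U - T) \<le> norm c * e'" by (intro mult_left_mono) auto
  moreover have "norm c * e' < e"
    using base(3) by (simp add: e'_def field_simps add_pos_nonneg)
  ultimately show ?case by (intro exI[of _ g]) auto
next
  case (add f1 f2)
  obtain g1 where g1: "continuous_on UNIV g1" "bounded (range g1)" "integrable lborel g1"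
     "(LINT x|lborel. norm (f1 x - g1 x)) < e / 2"
    using add.IH(1)[of "e / 2"] add.prems by auto
  obtain g2 where g2: "continuous_on UNIV g2" "bounded (range g2)" "integrable lborel g2"
     "(LINT x|lborel. norm (f2 x - g2 x)) < e / 2"
    using add.IH(2)[of "e / 2"] add.prems by auto
  have "(LINT x|lborel. norm (f1 x + f2 x - (g1 x + g2 x))) \<le>
     (LINT x|lborel. norm (f1 x - g1 x) + norm (f2 x - g2 x))"
    using add.hyps g1(3) g2(3) by (intro integral_mono) (auto intro!: norm_diff_triangle_ineq)
  also have "\<dots> < e" using add.hyps g1 g2 by simp
  finally show ?case
    using g1 g2 by (intro exI[of _ "\<lambda>x. g1 x + g2 x"])
      (auto intro!: continuous_on_add bounded_plus_comp)
next
  case (lim f s)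
  have "(\<lambda>i. LINT x|lborel. norm (s i x - f x)) \<longlonglongrightarrow> (LINT x|lborel. norm (f x - f x) + 0 * norm (f x))"
  proof (rule integral_dominated_convergence[where w = "\<lambda>x. 3 * norm (f x)"])
    have [measurable]: "f \<in> borel_measurable borel" "\<And>i. s i \<in> borel_measurable borel"
      using lim.hyps by (auto dest: borel_measurable_integrable)
    show "(\<lambda>x. norm (f x - f x) + 0 * norm (f x)) \<in> borel_measurable lborel" by simp
    show "(\<lambda>x. norm (s i x - f x)) \<in> borel_measurable lborel" for i by measurable
    show "integrable lborel (\<lambda>x. 3 * norm (f x))" using lim.hyps by simp
    show "AE x in lborel. (\<lambda>i. norm (s i x - f x)) \<longlonglongrightarrow> norm (f x - f x) + 0 * norm (f x)"
      using lim.hyps(2) by (auto intro!: AE_I2 tendsto_norm_zero simp: LIM_zero_iff)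
    show "AE x in lborel. norm (norm (s i x - f x)) \<le> 3 * norm (f x)" for i
    proof (rule AE_I2)
      fix x
      have "norm (s i x - f x) \<le> norm (s i x) + norm (f x)" by (rule norm_triangle_ineq4)
      with lim.hyps(3)[of x i] show "norm (norm (s i x - f x)) \<le> 3 * norm (f x)" by simp
    qed
  qed
  then have "(\<lambda>i. LINT x|lborel. norm (s i x - f x)) \<longlonglongrightarrow> 0" by simp
  then obtain i where i: "(LINT x|lborel. norm (s i x - f x)) < e / 2"
    using order_tendstoD(2)[of _ 0 sequentially "e / 2", THEN eventually_happens] lim.prems by auto
  obtain g where g: "continuous_on UNIV g" "bounded (range g)" "integrable lborel g"
     "(LINT x|lborel. norm (s i x - g x)) < e / 2"
    using lim.IH[of "e / 2" i] lim.prems by auto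
  have "(LINT x|lborel. norm (f x - g x)) \<le> (LINT x|lborel. norm (s i x - f x) + norm (s i x - g x))"
  proof (rule integral_mono)
    fix x
    have "norm (f x - g x) = norm ((s i x - g x) - (s i x - f x))" by (simp add: algebra_simps)
    also have "\<dots> \<le> norm (s i x - g x) + norm (s i x - f x)" by (rule norm_triangle_ineq4)
    finally show "norm (f x - g x) \<le> norm (s i x - f x) + norm (s i x - g x)" by simp
  qed (use lim.hyps g in auto)
  also have "\<dots> < e" using lim.hyps g i by simp
  finally show ?case using g by blast
qed

lemma conv_tendsto_continuous:
  fixes g :: "real ^ 'n::finite \<Rightarrow> 'b::euclidean_space"
  assumes g: "continuous_on UNIV g" "integrable lborel g"
    and d: "\<And>k. d k > 0" "d \<longlonglongrightarrow> 0"
  shows "(\<lambda>k. conv (mollifier (d k)) g x) \<longlonglongrightarrow> g x"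
proof (rule metric_LIMSEQ_I)
  fix e :: real assume "e > 0"
  have [measurable]: "g \<in> borel_measurable borel" using g by auto
  have "isCont g x" using g(1) by (simp add: continuous_on_eq_continuous_at)
  then obtain r where r: "r > 0" "\<And>y. dist y x < r \<Longrightarrow> dist (g y) (g x) < e / 2"
    using \<open>e > 0\<close> unfolding continuous_at_eps_delta by (meson half_gt_zero)
  have "eventually (\<lambda>k. d k < r) sequentially" using d(2) r(1) order_tendstoD(2) by blast
  then obtain N where N: "\<And>k. k \<ge> N \<Longrightarrow> d k < r" by (auto simp: eventually_sequentially)
  have "dist (conv (mollifier (d k)) g x) (g x) < e" if "k \<ge> N" for k
  proof -
    let ?\<eta> = "mollifier (d k) :: real ^ 'n \<Rightarrow> real"
    note m = mollifier[OF d(1)[of k], where 'n = 'n]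
    have [measurable]: "?\<eta> \<in> borel_measurable borel" using test_functionsD(6)[OF m(1)] .
    have one: "(\<integral>\<^sup>+y. ennreal (?\<eta> (x - y)) \<partial>lborel) = 1"
      using nn_integral_lborel_reflect[of "\<lambda>y. ennreal (?\<eta> y)" x] m(4) by simp
    have int1: "integrable lborel (\<lambda>y. ?\<eta> (x - y))"
      using one m(2) by (intro integrableI_nonneg) auto
    have "(LINT y|lborel. ?\<eta> (x - y)) = 1"
      using one m(2) int1 by (subst (asm) nn_integral_eq_integral) auto
    then have "g x = (LINT y|lborel. ?\<eta> (x - y) *\<^sub>R g x)"
      using int1 by simp
    then have "conv ?\<eta> g x - g x = (LINT y|lborel. ?\<eta> (x - y) *\<^sub>R g y - ?\<eta> (x - y) *\<^sub>R g x)"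
      unfolding conv_def using int1 conv_integrable_test[OF m(1) g(2)]
      by (subst Bochner_Integration.integral_diff) auto
    then have "ennreal (norm (conv ?\<eta> g x - g x)) \<le>
       (\<integral>\<^sup>+y. ennreal (norm (?\<eta> (x - y) *\<^sub>R g y - ?\<eta> (x - y) *\<^sub>R g x)) \<partial>lborel)"
      using integral_norm_bound_ennreal[of lborel "\<lambda>y. ?\<eta> (x - y) *\<^sub>R g y - ?\<eta> (x - y) *\<^sub>R g x"]
        int1 conv_integrable_test[OF m(1) g(2)] by simp
    also have "\<dots> \<le> (\<integral>\<^sup>+y. ennreal (e / 2) * ennreal (?\<eta> (x - y)) \<partial>lborel)"
    proof (rule nn_integral_mono)
      fix y
      have "norm (?\<eta> (x - y) *\<^sub>R g y - ?\<eta> (x - y) *\<^sub>R g x) = ?\<eta> (x - y) * dist (g y) (g x)"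
        using m(2) by (simp add: dist_norm flip: scaleR_diff_right)
      also have "\<dots> \<le> ?\<eta> (x - y) * (e / 2)"
      proof (cases "dist y x < r")
        case True
        then show ?thesis using r(2)[OF True] m(2) by (intro mult_left_mono) auto
      next
        case False
        then have "d k \<le> norm (x - y)" using N[OF that] by (simp add: dist_norm norm_minus_commute)
        from m(3)[OF this] show ?thesis by simp
      qed
      finally show "ennreal (norm (?\<eta> (x - y) *\<^sub>R g y - ?\<eta> (x - y) *\<^sub>R g x)) \<le> ennreal (e / 2) * ennreal (?\<eta> (x - y))"
        using \<open>e > 0\<close> m(2) by (simp add: mult.commute flip: ennreal_mult)
    qed
    also have "\<dots> = ennreal (e / 2)" by (simp add: nn_integral_cmult one)
    finally show ?thesis using \<open>e > 0\<close> by (simp add: dist_norm)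
  qed
  then show "\<exists>N. \<forall>k\<ge>N. dist (conv (mollifier (d k)) g x) (g x) < e" by blast
qed

text \<open>Replace \<open>f\<close> by a bounded continuous \<open>g\<close> close in L1.
  Convolution does not increase L1 norms, so \<open>f - g\<close> and its mollification contribute
  at most \<open>e' / 4\<close> each, while the mollifications of \<open>g\<close> converge
  pointwise. They are dominated only by a constant, which is integrable because \<open>B\<close> has
  finite measure.\<close>

lemma nn_integral_conv_diff_tendsto_0:
  fixes f :: "real ^ 'n::finite \<Rightarrow> 'b::euclidean_space"
  assumes f: "integrable lborel f" and d: "\<And>k. d k > 0" "d \<longlonglongrightarrow> 0"
    and B: "B \<in> sets borel" "emeasure lborel B < \<infinity>"
  shows "(\<lambda>k. \<integral>\<^sup>+x\<in>B. ennreal (norm (conv (mollifier (d k)) f x - f x)) \<partial>lborel) \<longlonglongrightarrow> 0"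
proof (rule order_tendstoI)
  fix e :: ennreal assume "0 < e"
  then obtain e' where e': "e' > 0" "ennreal e' < e"
    by (metis ennreal_0 ennreal_less_zero_iff dense ennreal_cases less_top order.strict_trans1 top.not_eq_extremum zero_le)
  obtain g where g: "continuous_on UNIV g" "bounded (range g)" "integrable lborel g"
    "(LINT x|lborel. norm (f x - g x)) < e' / 4"
    using integrable_approx_continuous[OF f, of "e' / 4"] e' by auto
  have [measurable]: "f \<in> borel_measurable borel" "g \<in> borel_measurable borel" "B \<in> sets borel"
    using f g B by auto
  obtain C where C: "\<And>x. norm (g x) \<le> C" using g(2) by (auto simp: bounded_iff)
  define m where "m k = (mollifier (d k) :: real ^ 'n \<Rightarrow> real)" for k
  note m = mollifier[OF d(1), where 'n = 'n, folded m_def]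
  have [measurable]: "m k \<in> borel_measurable borel" for k using test_functionsD(6)[OF m(1)] .
  have [measurable]: "conv (m k) f \<in> borel_measurable borel" "conv (m k) g \<in> borel_measurable borel" for k
    by (auto intro!: borel_measurable_conv)
  have fg: "(\<integral>\<^sup>+x. ennreal (norm (f x - g x)) \<partial>lborel) = ennreal (LINT x|lborel. norm (f x - g x))"
    using f g by (intro nn_integral_eq_integral) auto
  have "(\<lambda>k. \<integral>\<^sup>+x. ennreal (norm (conv (m k) g x - g x) * indicator B x) \<partial>lborel) \<longlonglongrightarrow> (\<integral>\<^sup>+(x::real^'n). 0 \<partial>lborel)"
  proof (rule nn_integral_dominated_convergence[where w = "\<lambda>x. ennreal (2 * C) * indicator B x"])
    show "(\<integral>\<^sup>+x. ennreal (2 * C) * indicator B x \<partial>lborel) < \<infinity>"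
      using B by (simp add: nn_integral_cmult_indicator ennreal_mult_less_top)
    show "AE x in lborel. (\<lambda>k. ennreal (norm (conv (m k) g x - g x) * indicator B x)) \<longlonglongrightarrow> 0"
    proof (rule AE_I2)
      fix x
      have "(\<lambda>k. norm (conv (m k) g x - g x) * indicator B x) \<longlonglongrightarrow> 0 * indicator B x"
        using conv_tendsto_continuous[OF g(1,3) d, of x]
        by (intro tendsto_mult tendsto_const) (auto simp: m_def intro: tendsto_norm_zero LIM_zero)
      then show "(\<lambda>k. ennreal (norm (conv (m k) g x - g x) * indicator B x)) \<longlonglongrightarrow> 0"
        using tendsto_ennrealI by fastforce
    qed
    show "AE x in lborel. ennreal (norm (conv (m k) g x - g x) * indicator B x) \<le> ennreal (2 * C) * indicator B x" for k
    proof (rule AE_I2)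
      fix x
      have "ennreal (norm (conv (m k) g x)) \<le> (\<integral>\<^sup>+y. ennreal (m k (x - y)) * ennreal (norm (g y)) \<partial>lborel)"
        by (rule norm_conv_le[OF m(1,2) g(3)])
      also have "\<dots> \<le> (\<integral>\<^sup>+y. ennreal (m k (x - y)) * ennreal C \<partial>lborel)"
        using C by (intro nn_integral_mono mult_left_mono ennreal_leI) auto
      also have "\<dots> = ennreal C"
        using nn_integral_lborel_reflect[of "\<lambda>y. ennreal (m k y)" x] m(4)
        by (simp add: nn_integral_multc)
      finally have "norm (conv (m k) g x) \<le> C"
        using C[of 0] norm_ge_zero[of "g 0"] by (simp del: norm_ge_zero)
      then have "norm (conv (m k) g x - g x) \<le> 2 * C"
        using norm_triangle_ineq4[of "conv (m k) g x" "g x"] C[of x] by simp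
      then show "ennreal (norm (conv (m k) g x - g x) * indicator B x) \<le> ennreal (2 * C) * indicator B x"
        by (auto simp: indicator_def intro: ennreal_leI)
    qed
  qed auto
  then have "eventually (\<lambda>k. (\<integral>\<^sup>+x. ennreal (norm (conv (m k) g x - g x) * indicator B x) \<partial>lborel) < ennreal (e' / 4)) sequentially"
    using e' by (intro order_tendstoD(2)) auto
  then show "eventually (\<lambda>k. (\<integral>\<^sup>+x\<in>B. ennreal (norm (conv (mollifier (d k)) f x - f x)) \<partial>lborel) < e) sequentially"
  proof eventually_elim
    case (elim k)
    have "(\<integral>\<^sup>+x. ennreal (norm (conv (m k) (\<lambda>x. f x - g x) x)) \<partial>lborel) \<le>
       (\<integral>\<^sup>+x. (\<integral>\<^sup>+y. ennreal (m k (x - y)) * ennreal (norm (f y - g y)) \<partial>lborel) \<partial>lborel)"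
      using f g by (intro nn_integral_mono norm_conv_le[OF m(1,2)]) auto
    also have "\<dots> = (\<integral>\<^sup>+x. ennreal (norm (f x - g x)) \<partial>lborel)"
      by (intro nn_integral_conv m(4)) auto
    finally have 1: "(\<integral>\<^sup>+x. ennreal (norm (conv (m k) (\<lambda>x. f x - g x) x)) \<partial>lborel) \<le> ennreal (e' / 4)"
      using g(4) unfolding fg by (meson ennreal_leI less_imp_le order_trans)
    have 2: "(\<integral>\<^sup>+x. ennreal (norm (f x - g x)) \<partial>lborel) \<le> ennreal (e' / 4)"
      using g(4) unfolding fg by (meson ennreal_leI less_imp_le)
    have cm: "conv (m k) (\<lambda>x. f x - g x) x = conv (m k) f x - conv (m k) g x" for x
      unfolding conv_def scaleR_diff_right
      by (intro Bochner_Integration.integral_diff conv_integrable_test[OF m(1)] f g(3))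
    have [measurable]: "conv (m k) (\<lambda>x. f x - g x) \<in> borel_measurable borel"
      by (intro borel_measurable_conv) auto
    have "(\<integral>\<^sup>+x\<in>B. ennreal (norm (conv (m k) f x - f x)) \<partial>lborel) \<le>
      (\<integral>\<^sup>+x. ennreal (norm (conv (m k) (\<lambda>x. f x - g x) x)) +
        (ennreal (norm (conv (m k) g x - g x) * indicator B x) + ennreal (norm (f x - g x))) \<partial>lborel)"
    proof (rule nn_integral_mono)
      fix x
      have "norm (conv (m k) f x - f x) =
        norm (conv (m k) (\<lambda>x. f x - g x) x + ((conv (m k) g x - g x) - (f x - g x)))"
        by (simp add: cm)
      also have "\<dots> \<le> norm (conv (m k) (\<lambda>x. f x - g x) x) + (norm (conv (m k) g x - g x) + norm (f x - g x))"
        by (intro norm_triangle_le add_left_mono norm_triangle_ineq4)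
      finally show "ennreal (norm (conv (m k) f x - f x)) * indicator B x \<le>
        ennreal (norm (conv (m k) (\<lambda>x. f x - g x) x)) +
        (ennreal (norm (conv (m k) g x - g x) * indicator B x) + ennreal (norm (f x - g x)))"
        by (auto simp: indicator_def intro: ennreal_leI simp flip: ennreal_plus)
    qed
    also have "\<dots> = (\<integral>\<^sup>+x. ennreal (norm (conv (m k) (\<lambda>x. f x - g x) x)) \<partial>lborel) +
        ((\<integral>\<^sup>+x. ennreal (norm (conv (m k) g x - g x) * indicator B x) \<partial>lborel) +
          (\<integral>\<^sup>+x. ennreal (norm (f x - g x)) \<partial>lborel))"
      by (subst nn_integral_add; simp)+
    also have "\<dots> \<le> ennreal (e' / 4) + (ennreal (e' / 4) + ennreal (e' / 4))"
      using 1 2 elim by (intro add_mono) auto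
    also have "\<dots> \<le> ennreal e'" using e' by (simp flip: ennreal_plus)
    finally show ?case using e'(2) unfolding m_def by (rule order.strict_trans1)
  qed
qed simp

section \<open>Jensen's inequality and convex energies of mollifications\<close>

lemma jensen_nn_integral:
  fixes a :: "real \<Rightarrow> real"
  assumes "prob_space M" and X: "integrable M X" and a: "convex_on UNIV a" "\<And>t. a t \<ge> 0"
    and [measurable]: "a \<in> borel_measurable borel"
  shows "ennreal (a (LINT x|M. X x)) \<le> (\<integral>\<^sup>+x. ennreal (a (X x)) \<partial>M)"
proof (cases "(\<integral>\<^sup>+x. ennreal (a (X x)) \<partial>M) = \<infinity>")
  case False
  interpret prob_space M by fact
  have [measurable]: "X \<in> borel_measurable M" using X by auto
  have int: "integrable M (\<lambda>x. a (X x))"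
    using False a(2) by (intro integrableI_nonneg) (auto simp: less_top)
  have "a (expectation X) \<le> expectation (\<lambda>x. a (X x))"
    by (rule jensens_inequality[where I = UNIV]) (use X a int in auto)
  then show ?thesis
    using a(2) int by (subst nn_integral_eq_integral) (auto intro: ennreal_leI)
qed simp

text \<open>For fixed \<open>x\<close> the kernel \<open>mollifier d (x - y)\<close> is a
  probability density in \<open>y\<close>, so Jensen's inequality applies pointwise, and Fubini then
  removes the kernel. The resulting energy bound is uniform in \<open>d\<close>.\<close>

lemma nn_integral_convex_conv_le:
  fixes f :: "real ^ 'n::finite \<Rightarrow> 'b::euclidean_space"
  assumes f: "integrable lborel f" and "d > 0"
    and a: "convex_on UNIV a" "\<And>t. a t \<ge> 0" "mono a"
  shows "(\<integral>\<^sup>+x. ennreal (a (norm (conv (mollifier d) f x))) \<partial>lborel) \<le>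
    (\<integral>\<^sup>+x. ennreal (a (norm (f x))) \<partial>lborel)"
proof -
  let ?\<eta> = "mollifier d :: real ^ 'n \<Rightarrow> real"
  note m = mollifier[OF assms(2), where 'n = 'n]
  have [measurable]: "?\<eta> \<in> borel_measurable borel" "f \<in> borel_measurable borel"
    using test_functionsD(6)[OF m(1)] f by auto
  have [measurable]: "a \<in> borel_measurable borel"
    using a(3) by (rule borel_measurable_mono)
  have "ennreal (a (norm (conv ?\<eta> f x))) \<le>
    (\<integral>\<^sup>+y. ennreal (?\<eta> (x - y)) * ennreal (a (norm (f y))) \<partial>lborel)" for x
  proof -
    let ?M = "density lborel (\<lambda>y. ennreal (?\<eta> (x - y)))"
    have one: "(\<integral>\<^sup>+y. ennreal (?\<eta> (x - y)) \<partial>lborel) = 1"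
      using nn_integral_lborel_reflect[of "\<lambda>y. ennreal (?\<eta> y)" x] m(4) by simp
    have M: "prob_space ?M"
      by (rule prob_spaceI) (simp add: emeasure_density one)
    have int: "integrable ?M (\<lambda>y. norm (f y))"
      using conv_integrable_test[OF m(1), of "\<lambda>y. norm (f y)" x] f m(2)
      by (subst integrable_density) (auto simp: mult.commute)
    have "norm (conv ?\<eta> f x) \<le> (LINT y|lborel. norm (?\<eta> (x - y) *\<^sub>R f y))"
      unfolding conv_def by (rule Bochner_Integration.integral_norm_bound)
    also have "\<dots> = (LINT y|?M. norm (f y))"
      using m(2) by (subst integral_density) auto
    finally have "ennreal (a (norm (conv ?\<eta> f x))) \<le> ennreal (a (LINT y|?M. norm (f y)))"
      using a(3) by (intro ennreal_leI) (auto dest: monoD)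
    also have "\<dots> \<le> (\<integral>\<^sup>+y. ennreal (a (norm (f y))) \<partial>?M)"
      by (rule jensen_nn_integral[OF M int a(1,2)]) simp
    also have "\<dots> = (\<integral>\<^sup>+y. ennreal (?\<eta> (x - y)) * ennreal (a (norm (f y))) \<partial>lborel)"
      by (subst nn_integral_density) auto
    finally show ?thesis .
  qed
  then have "(\<integral>\<^sup>+x. ennreal (a (norm (conv ?\<eta> f x))) \<partial>lborel) \<le>
    (\<integral>\<^sup>+x. (\<integral>\<^sup>+y. ennreal (?\<eta> (x - y)) * ennreal (a (norm (f y))) \<partial>lborel) \<partial>lborel)"
    by (rule nn_integral_mono)
  also have "\<dots> = (\<integral>\<^sup>+x. ennreal (a (norm (f x))) \<partial>lborel)"
    by (intro nn_integral_conv m(4)) auto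
  finally show ?thesis .
qed

section \<open>Oscillation on the faces of a cube\<close>

text \<open>The projection onto the hyperplane where coordinate \<open>i\<close> equals
  \<open>s\<close>. It collapses the cube along direction \<open>i\<close>, so that an integral over
  a face can be written as one over the full-dimensional cube.\<close>

definition upd :: "'n \<Rightarrow> real \<Rightarrow> real ^ 'n::finite \<Rightarrow> real ^ 'n" where
  "upd i s x = x + (s - x $ i) *\<^sub>R axis i 1"

definition cube :: "real ^ 'n::finite \<Rightarrow> real \<Rightarrow> (real ^ 'n) set" where
  "cube c r = {x. \<forall>i. \<bar>x $ i - c $ i\<bar> \<le> r}"

lemma upd_nth [simp]: "upd i s x $ j = (if j = i then s else x $ j)"
  by (simp add: upd_def axis_def)

lemma cube_eq_cbox: "cube c r = cbox (\<chi> i. c $ i - r) (\<chi> i. c $ i + r)"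
  unfolding cube_def set_eq_iff mem_box_cart
  by (auto simp: abs_le_iff) (smt (verit))+

lemma borel_measurable_nth [measurable]: "(\<lambda>x. x $ i) \<in> borel_measurable borel"
  by (intro borel_measurable_continuous_onI continuous_on_component continuous_on_id)

lemma sets_cube [measurable]: "cube c r \<in> sets borel"
  by (simp add: cube_eq_cbox)

lemma compact_cube: "compact (cube c r)"
  by (simp add: cube_eq_cbox)

lemma emeasure_cube:
  fixes c :: "real ^ 'n::finite"
  assumes "r > 0"
  shows "emeasure lborel (cube c r) = ennreal ((2 * r) ^ CARD('n))"
proof -
  have ne: "cbox (\<chi> i. c $ i - r) (\<chi> i. c $ i + r) \<noteq> {}"
    using assms by (simp add: interval_ne_empty_cart)
  have "emeasure lborel (cube c r) = ennreal (measure lborel (cube c r))"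
    using emeasure_bounded_finite[OF compact_imp_bounded[OF compact_cube[of c r]]]
    by (intro emeasure_eq_ennreal_measure) auto
  also have "measure lborel (cube c r) = (\<Prod>i\<in>(UNIV::'n set). 2 * r)"
    using content_cbox_cart[OF ne] by (simp add: cube_eq_cbox)
  finally show ?thesis by simp
qed

text \<open>Fubini with coordinate \<open>i\<close> singled out, obtained from translation invariance because the
  types provide no splitting of \<open>real ^ 'n\<close>.\<close>

lemma nn_integral_slices:
  fixes H :: "real ^ 'n::finite \<Rightarrow> ennreal"
  assumes [measurable]: "H \<in> borel_measurable borel" "\<rho> \<in> borel_measurable borel"
    and \<rho>: "\<And>s. \<rho> s \<ge> 0"
  shows "(\<integral>\<^sup>+s. (\<integral>\<^sup>+z. indicator {z. \<bar>z $ i - c\<bar> \<le> \<rho> s} z * H (upd i s z) \<partial>lborel) \<partial>lborel)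
    = (\<integral>\<^sup>+y. ennreal (2 * \<rho> (y $ i)) * H y \<partial>lborel)"
proof -
  let ?e = "axis i 1 :: real ^ 'n"
  \<comment> \<open>After the substitution \<open>s = t + z $ i\<close> the point
    \<open>upd i s z\<close> is the translate \<open>y = z + t *\<^sub>R ?e\<close>. In terms of
    \<open>y\<close> the condition on \<open>z\<close> confines \<open>t\<close> to an interval of
    length \<open>2 * \<rho> (y $ i)\<close>.\<close>
  define K where "K t y = indicator {y. \<bar>y $ i - t - c\<bar> \<le> \<rho> (y $ i)} y * H y" for t y
  have [measurable]: "(\<lambda>(t, y). K t y) \<in> borel_measurable (borel \<Otimes>\<^sub>M borel)"
    unfolding K_def by measurable
  have [measurable]: "(\<lambda>(s, z). indicator {z. \<bar>z $ i - c\<bar> \<le> \<rho> s} z * H (upd i s z)) \<in> borel_measurable (borel \<Otimes>\<^sub>M borel)"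
    unfolding upd_def by measurable
  have "(\<integral>\<^sup>+s. (\<integral>\<^sup>+z. indicator {z. \<bar>z $ i - c\<bar> \<le> \<rho> s} z * H (upd i s z) \<partial>lborel) \<partial>lborel)
    = (\<integral>\<^sup>+z. (\<integral>\<^sup>+s. indicator {z. \<bar>z $ i - c\<bar> \<le> \<rho> s} z * H (upd i s z) \<partial>lborel) \<partial>lborel)"
    by (intro lborel_pair.Fubini') measurable
  also have "\<dots> = (\<integral>\<^sup>+z. (\<integral>\<^sup>+t. K t (z + t *\<^sub>R ?e) \<partial>lborel) \<partial>lborel)"
  proof (rule nn_integral_cong)
    fix z :: "real ^ 'n"
    have "(\<integral>\<^sup>+s. indicator {z. \<bar>z $ i - c\<bar> \<le> \<rho> s} z * H (upd i s z) \<partial>lborel) =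
       (\<integral>\<^sup>+t. indicator {w. \<bar>w $ i - c\<bar> \<le> \<rho> (t + z $ i)} z * H (upd i (t + z $ i) z) \<partial>lborel)"
      by (rule nn_integral_lborel_translate[of "\<lambda>s. indicator {z. \<bar>z $ i - c\<bar> \<le> \<rho> s} z * H (upd i s z)" "z $ i", symmetric]) measurable
    also have "\<dots> = (\<integral>\<^sup>+t. K t (z + t *\<^sub>R ?e) \<partial>lborel)"
      by (intro nn_integral_cong) (simp add: K_def upd_def axis_def indicator_def add.commute)
    finally show "(\<integral>\<^sup>+s. indicator {z. \<bar>z $ i - c\<bar> \<le> \<rho> s} z * H (upd i s z) \<partial>lborel) =
      (\<integral>\<^sup>+t. K t (z + t *\<^sub>R ?e) \<partial>lborel)" .
  qed
  also have "\<dots> = (\<integral>\<^sup>+t. (\<integral>\<^sup>+z. K t (z + t *\<^sub>R ?e) \<partial>lborel) \<partial>lborel)"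
    by (intro lborel_pair.Fubini') measurable
  also have "\<dots> = (\<integral>\<^sup>+t. (\<integral>\<^sup>+y. K t y \<partial>lborel) \<partial>lborel)"
    by (rule nn_integral_cong, rule nn_integral_lborel_translate) measurable
  also have "\<dots> = (\<integral>\<^sup>+y. (\<integral>\<^sup>+t. K t y \<partial>lborel) \<partial>lborel)"
    by (intro lborel_pair.Fubini') measurable
  also have "\<dots> = (\<integral>\<^sup>+y. ennreal (2 * \<rho> (y $ i)) * H y \<partial>lborel)"
  proof (intro nn_integral_cong)
    fix y :: "real ^ 'n"
    have "(\<integral>\<^sup>+t. K t y \<partial>lborel) = (\<integral>\<^sup>+t. indicator {y $ i - c - \<rho> (y $ i)..y $ i - c + \<rho> (y $ i)} t * H y \<partial>lborel)"
      by (intro nn_integral_cong) (auto simp: K_def indicator_def abs_le_iff)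
    also have "\<dots> = ennreal (2 * \<rho> (y $ i)) * H y"
      using \<rho>[of "y $ i"] by (simp add: nn_integral_multc)
    finally show "(\<integral>\<^sup>+t. K t y \<partial>lborel) = ennreal (2 * \<rho> (y $ i)) * H y" .
  qed
  finally show ?thesis .
qed

lemma increment_le_nn_integral:
  fixes g h :: "real \<Rightarrow> real"
  assumes "\<alpha> \<le> \<beta>" and g: "\<And>t. (g has_real_derivative g' t) (at t)"
    and h: "continuous_on UNIV h" "\<And>t. t \<in> {\<alpha>..\<beta>} \<Longrightarrow> \<bar>g' t\<bar> \<le> h t"
  shows "ennreal \<bar>g \<beta> - g \<alpha>\<bar> \<le> (\<integral>\<^sup>+t\<in>{\<alpha>..\<beta>}. ennreal (h t) \<partial>lborel)"
proof -
  have "(g' has_integral (g \<beta> - g \<alpha>)) {\<alpha>..\<beta>}"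
    using assms(1) g
    by (intro fundamental_theorem_of_calculus)
      (auto intro: has_field_derivative_at_within simp flip: has_real_derivative_iff_has_vector_derivative)
  moreover have hi: "h integrable_on {\<alpha>..\<beta>}"
    using h(1) by (intro integrable_continuous_interval continuous_on_subset[OF h(1)]) auto
  ultimately have "norm (g \<beta> - g \<alpha>) \<le> integral {\<alpha>..\<beta>} h"
    using h(2) by (metis integral_norm_bound_integral has_integral_integrable integral_unique real_norm_def)
  have hn: "h t \<ge> 0" if "t \<in> {\<alpha>..\<beta>}" for t using h(2)[OF that] by linarith
  have [measurable]: "h \<in> borel_measurable borel" using h(1) by (rule borel_measurable_continuous_onI)
  have "(\<lambda>t. h t * indicator {\<alpha>..\<beta>} t) = (\<lambda>t. if t \<in> {\<alpha>..\<beta>} then h t else 0)"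
    by (auto simp: indicator_def)
  then have "((\<lambda>t. h t * indicator {\<alpha>..\<beta>} t) has_integral integral {\<alpha>..\<beta>} h) UNIV"
    using integrable_integral[OF hi] has_integral_restrict_UNIV[of "{\<alpha>..\<beta>}" h] by metis
  then have "(\<integral>\<^sup>+t. ennreal (h t * indicator {\<alpha>..\<beta>} t) \<partial>lborel) = ennreal (integral {\<alpha>..\<beta>} h)"
    by (intro nn_integral_has_integral_lborel) (auto simp: indicator_def intro: hn)
  moreover have "(\<integral>\<^sup>+t. ennreal (h t * indicator {\<alpha>..\<beta>} t) \<partial>lborel) = (\<integral>\<^sup>+t\<in>{\<alpha>..\<beta>}. ennreal (h t) \<partial>lborel)"
    by (intro nn_integral_cong) (simp add: indicator_def)
  ultimately show ?thesis
    using \<open>norm (g \<beta> - g \<alpha>) \<le> integral {\<alpha>..\<beta>} h\<close> by (metis ennreal_leI real_norm_def)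
qed

text \<open>\<open>a\<close> is a Young function extended by zero to the negative axis.\<close>

locale real_young =
  fixes a :: "real \<Rightarrow> real"
  assumes convex: "convex_on UNIV a" and mono: "mono a" and zero: "a 0 = 0" and nonneg: "\<And>t. a t \<ge> 0"
begin

lemma borel_measurable [measurable]: "a \<in> borel_measurable borel"
  using mono by (rule borel_measurable_mono)

lemma superlinear:
  assumes "0 < p" "p \<le> q"
  shows "q / p * a p \<le> a q"
proof -
  have "a ((1 - p / q) *\<^sub>R 0 + (p / q) *\<^sub>R q) \<le> (1 - p / q) * a 0 + (p / q) * a q"
    using assms by (intro convex_onD[OF convex]) auto
  then have "a p \<le> (p / q) * a q" using assms by (simp add: zero)
  then show ?thesis using assms by (simp add: field_simps)
qed

text \<open>From a positive value on, superlinear growth makes \<open>a\<close> strictly increasing,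
  so the inequality can be inverted there although \<open>a\<close> may vanish on an initial
  interval.\<close>

lemma le_of_value_le:
  assumes "a q \<le> a p" "0 < p" "0 < a p"
  shows "q \<le> p"
proof (rule ccontr)
  assume "\<not> q \<le> p"
  then have "q / p * a p \<le> a q" using assms by (intro superlinear) auto
  moreover have "a p < q / p * a p" using assms \<open>\<not> q \<le> p\<close> by (simp add: field_simps)
  ultimately show False using assms by simp
qed

text \<open>Jensen's inequality on the normalised cube bounds \<open>a\<close> of the mean of
  \<open>X\<close> by \<open>a U\<close>, and \<open>le_of_value_le\<close> then strips off
  \<open>a\<close>.\<close>

lemma mean_le:
  fixes X :: "real ^ 'n::finite \<Rightarrow> real"
  assumes "r > 0" and X: "continuous_on UNIV X" "\<And>z. X z \<ge> 0"
    and U: "U > 0" "a U > 0"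
    and S: "(\<integral>\<^sup>+z\<in>cube c r. ennreal (a (X z)) \<partial>lborel) \<le> ennreal ((2 * r) ^ CARD('n) * a U)"
  shows "(\<integral>\<^sup>+z\<in>cube c r. ennreal (X z) \<partial>lborel) \<le> ennreal ((2 * r) ^ CARD('n) * U)"
proof -
  let ?Q = "cube c r" and ?v = "(2 * r) ^ CARD('n)"
  let ?M = "uniform_measure lborel ?Q"
  have v: "?v > 0" using assms(1) by simp
  have [measurable]: "X \<in> borel_measurable borel" using X(1) by (rule borel_measurable_continuous_onI)
  interpret M: prob_space ?M
    using v assms(1) by (intro prob_space_uniform_measure) (simp_all add: emeasure_cube[OF assms(1)])
  have eqM: "(\<integral>\<^sup>+z. g z \<partial>?M) = (\<integral>\<^sup>+z\<in>?Q. g z \<partial>lborel) / ennreal ?v" if "g \<in> borel_measurable borel" for g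
    using nn_integral_uniform_measure[of g lborel ?Q] that by (simp add: emeasure_cube[OF assms(1)])
  have "bounded (X ` ?Q)"
    using X(1) by (intro compact_imp_bounded compact_continuous_image compact_cube continuous_on_subset[OF X(1)]) auto
  then obtain B where B: "\<And>z. z \<in> ?Q \<Longrightarrow> norm (X z) \<le> B" by (auto simp: bounded_iff)
  have int: "integrable ?M X"
  proof (rule M.integrable_const_bound[where B = B])
    show "AE x in ?M. norm (X x) \<le> B"
      using B v assms(1) by (intro AE_uniform_measureI) (auto simp: emeasure_cube[OF assms(1)])
  qed simp
  have "ennreal (a (M.expectation X)) \<le> (\<integral>\<^sup>+z. ennreal (a (X z)) \<partial>?M)"
    by (rule jensen_nn_integral[OF M.prob_space_axioms int convex nonneg]) simp
  also have "\<dots> \<le> ennreal (?v * a U) / ennreal ?v"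
    using divide_right_mono_ennreal[OF S, of "ennreal ?v"] by (subst eqM) measurable
  also have "\<dots> = ennreal (a U)"
    using v U assms(1) by (simp add: divide_ennreal)
  finally have "a (M.expectation X) \<le> a U"
    using ennreal_le_iff[OF nonneg[of U], of "a (M.expectation X)"] by blast
  then have "M.expectation X \<le> U"
    by (rule le_of_value_le[OF _ U])
  then have "(\<integral>\<^sup>+z. ennreal (X z) \<partial>?M) \<le> ennreal U"
    using int X(2) by (subst nn_integral_eq_integral) (auto intro: ennreal_leI)
  then have "(\<integral>\<^sup>+z\<in>?Q. ennreal (X z) \<partial>lborel) / ennreal ?v \<le> ennreal U"
    by (subst (asm) eqM) auto
  then have "ennreal ?v * ((\<integral>\<^sup>+z\<in>?Q. ennreal (X z) \<partial>lborel) / ennreal ?v) \<le> ennreal ?v * ennreal U"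
    by (intro mult_left_mono) auto
  also have "ennreal ?v * ((\<integral>\<^sup>+z\<in>?Q. ennreal (X z) \<partial>lborel) / ennreal ?v) = (\<integral>\<^sup>+z\<in>?Q. ennreal (X z) \<partial>lborel)"
    using v by (simp only: ennreal_times_divide mult.commute[of "ennreal ?v"]) (rule ennreal_mult_divide_eq, use assms(1) in auto)
  finally show ?thesis using v U by (simp add: ennreal_mult)
qed

end

text \<open>The homothety with centre \<open>x\<close> and ratio \<open>t\<close> maps the cube into
  itself. As \<open>F\<close> ignores coordinate \<open>i\<close>, the homothety may be replaced by
  a map that leaves this coordinate alone; its Jacobian is \<open>t ^ (CARD('n) - 1)\<close> instead
  of \<open>t ^ CARD('n)\<close>. This gain of one dimension is why the index is compared with
  \<open>n - 1\<close>.\<close>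

lemma scaled_face_integral_le:
  fixes F :: "real ^ 'n::finite \<Rightarrow> ennreal"
  assumes [measurable]: "F \<in> borel_measurable borel" and F: "\<And>z s. F (upd i s z) = F z"
    and t: "0 < t" "t \<le> 1" and x: "x \<in> cube c r"
  shows "ennreal (t ^ (CARD('n) - 1)) * (\<integral>\<^sup>+z\<in>cube c r. F (x + t *\<^sub>R (z - x)) \<partial>lborel) \<le> (\<integral>\<^sup>+z\<in>cube c r. F z \<partial>lborel)"
proof -
  let ?B = "Basis :: (real ^ 'n) set" and ?Q = "cube c r"
  \<comment> \<open>The ratios of the map \<open>T\<close>, which contracts towards \<open>x\<close>
    in all coordinates but \<open>i\<close>; it is written in the diagonal form required by the
    change of variables for \<open>lborel\<close>.\<close>
  define k where "k b = (if b = axis i 1 then 1 else t)" for b :: "real ^ 'n"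
  define x0 where "x0 = x - (\<Sum>j\<in>?B. (k j * (x \<bullet> j)) *\<^sub>R j)"
  define T where "T z = x0 + (\<Sum>j\<in>?B. (k j * (z \<bullet> j)) *\<^sub>R j)" for z
  have k: "k j \<noteq> 0" for j using t by (simp add: k_def)
  have T_nth: "T z $ j = x $ j + (if j = i then 1 else t) * (z $ j - x $ j)" for z j
  proof -
    have T: "T z = x + (\<Sum>j\<in>?B. (k j * ((z - x) \<bullet> j)) *\<^sub>R j)"
      unfolding T_def x0_def by (simp add: inner_diff_left algebra_simps sum_subtractf)
    have "T z $ j = T z \<bullet> axis j 1" by (simp add: inner_axis)
    also have "\<dots> = x $ j + k (axis j 1) * (z - x) $ j"
      unfolding T inner_add_left
      by (subst inner_sum_left_Basis) (simp_all add: axis_in_Basis_iff inner_axis)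
    finally show ?thesis by (simp add: k_def axis_eq_axis)
  qed
  have prod: "(\<Prod>j\<in>?B. \<bar>k j\<bar>) = t ^ (CARD('n) - 1)"
  proof -
    have "(\<Prod>j\<in>?B. \<bar>k j\<bar>) = \<bar>k (axis i 1)\<bar> * (\<Prod>j\<in>?B - {axis i 1}. \<bar>k j\<bar>)"
      by (rule prod.remove) (auto simp: axis_in_Basis_iff)
    also have "(\<Prod>j\<in>?B - {axis i 1}. \<bar>k j\<bar>) = (\<Prod>j\<in>?B - {axis i 1}. t)"
      using t by (intro prod.cong) (auto simp: k_def)
    also have "\<dots> = t ^ (CARD('n) - 1)"
      by (simp add: card_Diff_singleton axis_in_Basis_iff)
    finally show ?thesis by (simp add: k_def)
  qed
  have [measurable]: "T \<in> borel_measurable borel"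
    unfolding T_def by measurable
  have eq: "F (x + t *\<^sub>R (z - x)) = F (T z)" for z
  proof -
    have "upd i 0 (x + t *\<^sub>R (z - x)) = upd i 0 (T z)"
      by (auto simp: vec_eq_iff T_nth)
    then show ?thesis using F by metis
  qed
  have TQ: "T z \<in> ?Q" if "z \<in> ?Q" for z
    unfolding cube_def
  proof (intro CollectI allI)
    fix j
    let ?l = "if j = i then 1 else t"
    have l: "0 \<le> ?l" "?l \<le> 1" using t by auto
    have "\<bar>T z $ j - c $ j\<bar> = \<bar>(1 - ?l) * (x $ j - c $ j) + ?l * (z $ j - c $ j)\<bar>"
      by (simp add: T_nth algebra_simps)
    also have "\<dots> \<le> (1 - ?l) * \<bar>x $ j - c $ j\<bar> + ?l * \<bar>z $ j - c $ j\<bar>"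
      using l by (intro order_trans[OF abs_triangle_ineq]) (simp add: abs_mult)
    also have "\<dots> \<le> (1 - ?l) * r + ?l * r"
      using l x that unfolding cube_def by (intro add_mono mult_left_mono) auto
    finally show "\<bar>T z $ j - c $ j\<bar> \<le> r" by (simp add: algebra_simps)
  qed
  have "ennreal (t ^ (CARD('n) - 1)) * (\<integral>\<^sup>+z\<in>?Q. F (x + t *\<^sub>R (z - x)) \<partial>lborel) \<le>
     ennreal (t ^ (CARD('n) - 1)) * (\<integral>\<^sup>+z. F (T z) * indicator ?Q (T z) \<partial>lborel)"
    using TQ by (intro mult_left_mono nn_integral_mono) (auto simp: eq indicator_def)
  also have "\<dots> = (\<integral>\<^sup>+z. ennreal (t ^ (CARD('n) - 1)) * (F z * indicator ?Q z) \<partial>distr lborel borel T)"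
    by (simp add: nn_integral_distr nn_integral_cmult)
  also have "\<dots> = (\<integral>\<^sup>+z. F z * indicator ?Q z \<partial>density (distr lborel borel T) (\<lambda>_. ennreal (t ^ (CARD('n) - 1))))"
    by (simp add: nn_integral_density)
  also have "density (distr lborel borel T) (\<lambda>_. ennreal (t ^ (CARD('n) - 1))) = lborel"
    using lborel_affine_euclidean[of k x0] k unfolding T_def[symmetric] prod by simp
  finally show ?thesis .
qed

lemma continuous_on_upd: "continuous_on UNIV (upd i s)"
  unfolding upd_def by (intro continuous_intros)

lemma continuous_on_norm_grad:
  assumes "C_k (Suc 0) f"
  shows "continuous_on S (\<lambda>z. norm (grad f z))"
proof -
  have "continuous_on S (grad f)"
    unfolding grad_def using assms by (auto intro!: continuous_on_vec_lambda intro: continuous_on_subset)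
  then show ?thesis by (rule continuous_on_norm)
qed

lemma continuous_on_norm_grad_upd:
  assumes "C_k (Suc 0) f"
  shows "continuous_on UNIV (\<lambda>z. norm (grad f (upd i s z)))"
  using continuous_on_compose2[OF continuous_on_norm_grad[OF assms, of UNIV] continuous_on_upd] by auto

lemma line_increment_le:
  fixes f :: "real ^ 'n::finite \<Rightarrow> real"
  assumes f: "C_k (Suc 0) f" and "\<alpha> \<le> \<beta>" and w: "norm w \<le> L"
  shows "ennreal \<bar>f (p + \<beta> *\<^sub>R w) - f (p + \<alpha> *\<^sub>R w)\<bar> \<le>
    (\<integral>\<^sup>+t\<in>{\<alpha>..\<beta>}. ennreal (L * norm (grad f (p + t *\<^sub>R w))) \<partial>lborel)"
proof (rule increment_le_nn_integral[OF assms(2), of "\<lambda>t. f (p + t *\<^sub>R w)" "\<lambda>t. grad f (p + t *\<^sub>R w) \<bullet> w"])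
  fix t
  have "((\<lambda>t. p + t *\<^sub>R w) has_derivative (\<lambda>h. h *\<^sub>R w)) (at t)"
    by (auto intro!: derivative_eq_intros)
  moreover have "(f has_derivative (\<lambda>h. grad f (p + t *\<^sub>R w) \<bullet> h)) (at (p + t *\<^sub>R w))"
    using f by (intro has_derivative_grad) simp
  ultimately have "((\<lambda>t. f (p + t *\<^sub>R w)) has_derivative (\<lambda>h. grad f (p + t *\<^sub>R w) \<bullet> (h *\<^sub>R w))) (at t)"
    by (rule has_derivative_compose)
  then show "((\<lambda>t. f (p + t *\<^sub>R w)) has_real_derivative grad f (p + t *\<^sub>R w) \<bullet> w) (at t)"
    by (simp add: has_field_derivative_def mult.commute[of _ "_ \<bullet> _"])
  have "\<bar>grad f (p + t *\<^sub>R w) \<bullet> w\<bar> \<le> norm (grad f (p + t *\<^sub>R w)) * norm w"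
    by (rule Cauchy_Schwarz_ineq2)
  also have "\<dots> \<le> L * norm (grad f (p + t *\<^sub>R w))"
    using w by (subst mult.commute) (intro mult_right_mono, auto)
  finally show "\<bar>grad f (p + t *\<^sub>R w) \<bullet> w\<bar> \<le> L * norm (grad f (p + t *\<^sub>R w))" .
next
  show "continuous_on UNIV (\<lambda>t. L * norm (grad f (p + t *\<^sub>R w)))"
    by (intro continuous_on_mult continuous_on_const continuous_on_compose2[OF continuous_on_norm_grad[OF f, of UNIV]])
      (auto intro!: continuous_intros)
qed

lemma nn_integral_powr_0_1:
  assumes "\<alpha> > - 1"
  shows "(\<integral>\<^sup>+t\<in>{0..1}. ennreal (t powr \<alpha>) \<partial>lborel) = ennreal (1 / (\<alpha> + 1))"
proof -
  have "((\<lambda>t. t powr \<alpha>) has_integral (1 / (\<alpha> + 1))) {0..1}"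
    using has_integral_powr_from_0[OF assms, of 1] by simp
  moreover have "(\<lambda>t::real. t powr \<alpha> * indicator {0..1} t) = (\<lambda>t. if t \<in> {0..1} then t powr \<alpha> else 0)"
    by (auto simp: indicator_def)
  ultimately have "((\<lambda>t. t powr \<alpha> * indicator {0..1} t) has_integral (1 / (\<alpha> + 1))) UNIV"
    using has_integral_restrict_UNIV[of "{0..1::real}" "\<lambda>t. t powr \<alpha>"] by simp
  then have "(\<integral>\<^sup>+t. ennreal (t powr \<alpha> * indicator {0..1} t) \<partial>lborel) = ennreal (1 / (\<alpha> + 1))"
    by (intro nn_integral_has_integral_lborel) auto
  then show ?thesis by (simp add: ennreal_mult ennreal_indicator)
qed

section \<open>Morrey-type oscillation bounds on one face\<close>

context real_young
begin

text \<open>This is \<open>2 * r\<close> times the integral over the face, since the integrand is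
  constant in coordinate \<open>i\<close>. The full gradient dominates the tangential one, and it is
  the quantity controlled by the Orlicz energy.\<close>

definition face_energy :: "(real ^ 'n::finite \<Rightarrow> real) \<Rightarrow> real ^ 'n \<Rightarrow> real \<Rightarrow> 'n \<Rightarrow> real \<Rightarrow> ennreal" where
  "face_energy f c r i s = (\<integral>\<^sup>+z\<in>cube c r. ennreal (a (norm (grad f (upd i s z)))) \<partial>lborel)"

text \<open>For \<open>n = 2\<close> a face is a segment: the increment of \<open>f\<close> is at
  most the integral of the gradient norm along it, which is \<open>2 * r\<close> times its mean, and
  \<open>mean_le\<close> bounds this mean by \<open>T\<close>.\<close>

lemma face_oscillation_2:
  fixes f :: "real ^ 'n::finite \<Rightarrow> real"
  assumes f: "C_k (Suc 0) f" and "r > 0" and card: "CARD('n) = 2"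
    and T: "T > 0" "a T > 0"
    and S: "face_energy f c r i s \<le> ennreal ((2 * r) ^ CARD('n) * a T)"
    and x: "x \<in> cube c r" and y: "y \<in> cube c r"
  shows "\<bar>f (upd i s x) - f (upd i s y)\<bar> \<le> 2 * r * T"
proof -
  let ?Q = "cube c r"
  define v where "v = (2 * r) ^ CARD('n)"
  have v: "v > 0" using \<open>r > 0\<close> by (simp add: v_def)
  note S = S[folded v_def]
  define V where "V z = norm (grad f (upd i s z))" for z
  have Vc: "continuous_on UNIV V" unfolding V_def using f by (rule continuous_on_norm_grad_upd)
  have [measurable]: "V \<in> borel_measurable borel" using Vc by (rule borel_measurable_continuous_onI)
  have mean: "(\<integral>\<^sup>+z\<in>?Q. ennreal (V z) \<partial>lborel) \<le> ennreal (v * T)"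
    using mean_le[OF assms(2) Vc _ T, folded v_def] S unfolding face_energy_def V_def by simp
  have "card (UNIV - {i}) = 1" using card by (simp add: card_Diff_singleton)
  then obtain j where j: "UNIV - {i} = {j}" using card_1_singletonE by blast
  then have ji: "j \<noteq> i" "\<And>k. k = i \<or> k = j" by blast+
  have "ennreal (v * \<bar>f (upd i s x) - f (upd i s y)\<bar>) \<le> ennreal (v * (2 * r * T))"
    if xy: "x \<in> ?Q" "y \<in> ?Q" "y $ j \<le> x $ j" for x y
  proof -
    define p where "p = upd i s (upd j 0 x)"
    have p: "upd i s z = p + z $ j *\<^sub>R axis j 1" for z
      using ji by (auto simp: vec_eq_iff p_def axis_def)
    have "ennreal \<bar>f (upd i s x) - f (upd i s y)\<bar> \<le> (\<integral>\<^sup>+t\<in>{y $ j..x $ j}. ennreal (1 * norm (grad f (p + t *\<^sub>R axis j 1))) \<partial>lborel)"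
      unfolding p using xy by (intro line_increment_le[OF f]) (auto simp: norm_eq_sqrt_inner inner_axis_axis)
    then have "ennreal (v * \<bar>f (upd i s x) - f (upd i s y)\<bar>) \<le> ennreal v * (\<integral>\<^sup>+t\<in>{y $ j..x $ j}. ennreal (norm (grad f (p + t *\<^sub>R axis j 1))) \<partial>lborel)"
      using v by (simp add: ennreal_mult mult_left_mono)
    also have "\<dots> = (\<integral>\<^sup>+t. ennreal v * (ennreal (norm (grad f (p + t *\<^sub>R axis j 1))) * indicator {y $ j..x $ j} t) \<partial>lborel)"
    proof (rule nn_integral_cmult[symmetric])
      have "continuous_on UNIV (\<lambda>t. norm (grad f (p + t *\<^sub>R axis j 1)))"
        by (intro continuous_on_compose2[OF continuous_on_norm_grad[OF f, of UNIV]]) (auto intro!: continuous_intros)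
      then have [measurable]: "(\<lambda>t. norm (grad f (p + t *\<^sub>R axis j 1))) \<in> borel_measurable borel"
        by (rule borel_measurable_continuous_onI)
      show "(\<lambda>t. ennreal (norm (grad f (p + t *\<^sub>R axis j 1))) * indicator {y $ j..x $ j} t) \<in> borel_measurable lborel"
        by measurable
    qed
    \<comment> \<open>The factor \<open>v\<close> is the volume of the cube. Spreading the value at
      \<open>t\<close> over all \<open>z\<close> produces the double integral of
      \<open>nn_integral_slices\<close> with constant width \<open>r\<close>.\<close>
    also have "\<dots> \<le> (\<integral>\<^sup>+t. (\<integral>\<^sup>+z. indicator {z. \<bar>z $ j - c $ j\<bar> \<le> r} z *
       (indicator ?Q (upd j t z) * ennreal (V (upd j t z))) \<partial>lborel) \<partial>lborel)"
    proof (rule nn_integral_mono)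
      fix t
      show "ennreal v * (ennreal (norm (grad f (p + t *\<^sub>R axis j 1))) * indicator {y $ j..x $ j} t) \<le>
        (\<integral>\<^sup>+z. indicator {z. \<bar>z $ j - c $ j\<bar> \<le> r} z * (indicator ?Q (upd j t z) * ennreal (V (upd j t z))) \<partial>lborel)"
      proof (cases "t \<in> {y $ j..x $ j}")
        case True
        have "\<bar>x $ j - c $ j\<bar> \<le> r" "\<bar>y $ j - c $ j\<bar> \<le> r"
          using xy unfolding cube_def by blast+
        then have t: "\<bar>t - c $ j\<bar> \<le> r" using True by auto
        have "ennreal v * (ennreal (norm (grad f (p + t *\<^sub>R axis j 1))) * indicator {y $ j..x $ j} t) =
           (\<integral>\<^sup>+z. ennreal (norm (grad f (p + t *\<^sub>R axis j 1))) * indicator ?Q z \<partial>lborel)"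
          using True emeasure_cube[OF \<open>r > 0\<close>, of c, folded v_def]
          by (subst nn_integral_cmult_indicator) (auto simp: mult.commute)
        also have "\<dots> \<le> (\<integral>\<^sup>+z. indicator {z. \<bar>z $ j - c $ j\<bar> \<le> r} z * (indicator ?Q (upd j t z) * ennreal (V (upd j t z))) \<partial>lborel)"
        proof (rule nn_integral_mono)
          fix z
          have "V (upd j t z) = norm (grad f (p + t *\<^sub>R axis j 1))"
            unfolding V_def p by simp
          moreover have "upd j t z \<in> ?Q \<and> \<bar>z $ j - c $ j\<bar> \<le> r" if "z \<in> ?Q"
            using that t unfolding cube_def by auto
          ultimately show "ennreal (norm (grad f (p + t *\<^sub>R axis j 1))) * indicator ?Q z \<le>
            indicator {z. \<bar>z $ j - c $ j\<bar> \<le> r} z * (indicator ?Q (upd j t z) * ennreal (V (upd j t z)))"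
            by (cases "z \<in> ?Q") auto
        qed
        finally show ?thesis .
      qed simp
    qed
    also have "\<dots> = (\<integral>\<^sup>+z. ennreal (2 * r) * (indicator ?Q z * ennreal (V z)) \<partial>lborel)"
      using \<open>r > 0\<close> by (intro nn_integral_slices) auto
    also have "\<dots> = ennreal (2 * r) * (\<integral>\<^sup>+z\<in>?Q. ennreal (V z) \<partial>lborel)"
      by (simp add: nn_integral_cmult mult.commute)
    also have "\<dots> \<le> ennreal (2 * r) * ennreal (v * T)"
      by (intro mult_left_mono mean) simp
    also have "\<dots> = ennreal (v * (2 * r * T))"
      using \<open>r > 0\<close> T v by (simp add: ac_simps flip: ennreal_mult)
    finally show ?thesis .
  qed
  from this[of x y] this[of y x] x y
  have "ennreal (v * \<bar>f (upd i s x) - f (upd i s y)\<bar>) \<le> ennreal (v * (2 * r * T))"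
    by (cases "y $ j \<le> x $ j") (auto simp: abs_minus_commute)
  then show ?thesis using \<open>r > 0\<close> T v by (simp add: mult_le_cancel_left)
qed

text \<open>Morrey's argument: the increment from \<open>x\<close> to \<open>z\<close> is bounded by
  an integral along the segment and then averaged over \<open>z\<close>. At parameter
  \<open>t\<close>, contracting the face raises the mean energy by at most the factor
  \<open>t powr (- (n - 1))\<close>. Growth with exponent \<open>q\<close> absorbs it by passing
  from \<open>T\<close> to \<open>\<mu> * T\<close> with \<open>\<mu>\<close> of order
  \<open>t powr (- (n - 1) / q)\<close>, and this is integrable at 0 because
  \<open>q > n - 1\<close>.\<close>

lemma face_oscillation_growth:
  fixes f :: "real ^ 'n::finite \<Rightarrow> real"
  assumes f: "C_k (Suc 0) f" and "r > 0"
    and q: "q > real CARD('n) - 1" "q > 0" and \<kappa>: "0 < \<kappa>" "\<kappa> \<le> 1"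
    and growth: "\<And>\<mu>. \<mu> \<ge> 1 \<Longrightarrow> \<kappa> * \<mu> powr q * a T \<le> a (\<mu> * T)"
    and T: "T > 0" "a T > 0"
    and S: "face_energy f c r i s \<le> ennreal ((2 * r) ^ CARD('n) * a T)"
    and x: "x \<in> cube c r" and y: "y \<in> cube c r"
  shows "\<bar>f (upd i s x) - f (upd i s y)\<bar> \<le>
    4 * real CARD('n) * \<kappa> powr (- 1 / q) / (1 - (real CARD('n) - 1) / q) * r * T"
proof -
  let ?Q = "cube c r" and ?n = "real CARD('n)"
  define v where "v = (2 * r) ^ CARD('n)"
  note S = S[folded v_def]
  define \<alpha> where "\<alpha> = - ((?n - 1) / q)"
  \<comment> \<open>An upper bound for the length of segments inside a face, from the sum of the
    \<open>n\<close> coordinate differences.\<close>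
  define L where "L = ?n * (2 * r)"
  define V where "V z = norm (grad f (upd i s z))" for z
  have \<alpha>: "\<alpha> > - 1" "\<alpha> + 1 = 1 - (?n - 1) / q" using q by (auto simp: \<alpha>_def field_simps)
  have v: "v > 0" and L: "L > 0" using \<open>r > 0\<close> by (auto simp: L_def v_def)
  have Vc: "continuous_on UNIV V" unfolding V_def using f by (rule continuous_on_norm_grad_upd)
  have [measurable]: "V \<in> borel_measurable borel" using Vc by (rule borel_measurable_continuous_onI)
  have Vi: "V (upd i s' z) = V z" for s' z
  proof -
    have "upd i s (upd i s' z) = upd i s z" by (auto simp: vec_eq_iff)
    then show ?thesis by (simp add: V_def)
  qed
  have mean: "(\<integral>\<^sup>+z\<in>?Q. ennreal (V (x + t *\<^sub>R (z - x))) \<partial>lborel) \<le> ennreal (v * (\<kappa> powr (- 1 / q) * t powr \<alpha> * T))"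
    if x: "x \<in> ?Q" and t: "0 < t" "t \<le> 1" for x t
  proof -
    \<comment> \<open>The solution of \<open>\<kappa> * \<mu> powr q = t powr (- (n - 1))\<close>:
      the growth condition then compensates exactly the factor lost in
      \<open>scaled_face_integral_le\<close>.\<close>
    define \<mu> where "\<mu> = \<kappa> powr (- 1 / q) * t powr \<alpha>"
    have "\<kappa> powr (- 1 / q) \<ge> 1" using \<kappa> q powr_mono2'[of "- 1 / q" \<kappa> 1] by simp
    moreover have "\<alpha> \<le> 0" using q by (simp add: \<alpha>_def Suc_leI)
    then have "t powr \<alpha> \<ge> 1" using t powr_mono2'[of \<alpha> t 1] by simp
    ultimately have \<mu>1: "\<mu> \<ge> 1" unfolding \<mu>_def using mult_mono[of 1 "\<kappa> powr (- 1 / q)" 1 "t powr \<alpha>"] by simp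
    have \<mu>q: "\<kappa> * \<mu> powr q = t powr (- (?n - 1))"
    proof -
      have "\<mu> powr q = \<kappa> powr (- 1 / q * q) * t powr (\<alpha> * q)"
        unfolding \<mu>_def by (simp add: powr_mult powr_powr)
      moreover have "- 1 / q * q = - 1" "\<alpha> * q = - (?n - 1)"
        using q by (simp_all add: \<alpha>_def)
      ultimately show ?thesis using \<kappa> by (simp add: powr_minus field_simps)
    qed
    have tn: "t powr (- (?n - 1)) = inverse (t ^ (CARD('n) - 1))"
    proof -
      have "real (CARD('n) - 1) = ?n - 1" by (simp add: of_nat_diff Suc_leI)
      then show ?thesis
        using powr_minus[of t "?n - 1"] powr_realpow[OF t(1), of "CARD('n) - 1"] by simp
    qed
    have aT: "a T \<le> a (\<mu> * T)"
      using monoD[OF mono, of T "\<mu> * T"] \<mu>1 T by simp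
    have c: "continuous_on UNIV (\<lambda>z. V (x + t *\<^sub>R (z - x)))"
      by (intro continuous_on_compose2[OF Vc]) (auto intro!: continuous_intros)
    have "ennreal (t ^ (CARD('n) - 1)) * (\<integral>\<^sup>+z\<in>?Q. ennreal (a (V (x + t *\<^sub>R (z - x)))) \<partial>lborel) \<le> (\<integral>\<^sup>+z\<in>?Q. ennreal (a (V z)) \<partial>lborel)"
      by (rule scaled_face_integral_le[where i = i and F = "\<lambda>z. ennreal (a (V z))"]) (use t x Vi in auto)
    also have "\<dots> \<le> ennreal (v * a T)"
      using S unfolding face_energy_def V_def .
    finally have "ennreal (inverse (t ^ (CARD('n) - 1))) * (ennreal (t ^ (CARD('n) - 1)) * (\<integral>\<^sup>+z\<in>?Q. ennreal (a (V (x + t *\<^sub>R (z - x)))) \<partial>lborel))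
      \<le> ennreal (inverse (t ^ (CARD('n) - 1))) * ennreal (v * a T)"
      by (rule mult_left_mono) simp
    also have "ennreal (inverse (t ^ (CARD('n) - 1))) * (ennreal (t ^ (CARD('n) - 1)) * (\<integral>\<^sup>+z\<in>?Q. ennreal (a (V (x + t *\<^sub>R (z - x)))) \<partial>lborel))
       = (\<integral>\<^sup>+z\<in>?Q. ennreal (a (V (x + t *\<^sub>R (z - x)))) \<partial>lborel)"
      using t by (simp add: mult.assoc[symmetric] flip: ennreal_mult)
    also have "ennreal (inverse (t ^ (CARD('n) - 1))) * ennreal (v * a T) = ennreal (v * (\<kappa> * \<mu> powr q * a T))"
      unfolding \<mu>q tn using t v T by (simp add: ac_simps flip: ennreal_mult)
    also have "\<dots> \<le> ennreal (v * a (\<mu> * T))"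
      using growth[OF \<mu>1] v by (intro ennreal_leI mult_left_mono) auto
    finally have "(\<integral>\<^sup>+z\<in>?Q. ennreal (V (x + t *\<^sub>R (z - x))) \<partial>lborel) \<le> ennreal (v * (\<mu> * T))"
      using \<mu>1 T aT by (intro mean_le[OF \<open>r > 0\<close> c, folded v_def]) (auto simp: V_def)
    then show ?thesis by (simp add: \<mu>_def)
  qed
  define I where "I = L * v * \<kappa> powr (- 1 / q) * T * (1 / (\<alpha> + 1))"
  have I: "I \<ge> 0" using L v T \<alpha>(1) by (simp add: I_def)
  have J: "(\<integral>\<^sup>+z\<in>?Q. ennreal \<bar>f (upd i s x) - f (upd i s z)\<bar> \<partial>lborel) \<le> ennreal I"
    if x: "x \<in> ?Q" for x
  proof -
    have "(\<integral>\<^sup>+z\<in>?Q. ennreal \<bar>f (upd i s x) - f (upd i s z)\<bar> \<partial>lborel) \<le>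
      (\<integral>\<^sup>+z. (\<integral>\<^sup>+t. ennreal (L * V (x + t *\<^sub>R (z - x))) * indicator {0..1} t * indicator ?Q z \<partial>lborel) \<partial>lborel)"
    proof (rule nn_integral_mono)
      fix z
      show "ennreal \<bar>f (upd i s x) - f (upd i s z)\<bar> * indicator ?Q z \<le>
        (\<integral>\<^sup>+t. ennreal (L * V (x + t *\<^sub>R (z - x))) * indicator {0..1} t * indicator ?Q z \<partial>lborel)"
      proof (cases "z \<in> ?Q")
        case True
        define w where "w = upd i s z - upd i s x"
        have "norm w \<le> (\<Sum>j\<in>UNIV. \<bar>w $ j\<bar>)" by (rule norm_le_l1_cart)
        also have "\<dots> \<le> (\<Sum>j\<in>(UNIV::'n set). 2 * r)"
        proof (rule sum_mono)
          fix j
          have "\<bar>z $ j - c $ j\<bar> \<le> r" "\<bar>x $ j - c $ j\<bar> \<le> r"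
            using True x unfolding cube_def by blast+
          then show "\<bar>w $ j\<bar> \<le> 2 * r" using \<open>r > 0\<close> by (auto simp: w_def)
        qed
        finally have w: "norm w \<le> L" by (simp add: L_def)
        have p: "upd i s x + t *\<^sub>R w = upd i s (x + t *\<^sub>R (z - x))" for t
          by (auto simp: vec_eq_iff w_def)
        from line_increment_le[OF f _ w, of 0 1 "upd i s x", unfolded p] show ?thesis
          using True by (simp add: abs_minus_commute V_def)
      qed simp
    qed
    also have "\<dots> = (\<integral>\<^sup>+t. (\<integral>\<^sup>+z. ennreal (L * V (x + t *\<^sub>R (z - x))) * indicator {0..1} t * indicator ?Q z \<partial>lborel) \<partial>lborel)"
      by (rule lborel_pair.Fubini') measurable
    also have "\<dots> \<le> (\<integral>\<^sup>+t. ennreal (L * v * \<kappa> powr (- 1 / q) * T) * (ennreal (t powr \<alpha>) * indicator {0..1} t) \<partial>lborel)"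
    proof (rule nn_integral_mono_AE)
      \<comment> \<open>At \<open>t = 0\<close> the right-hand side is 0, since
        \<open>0 powr \<alpha> = 0\<close>; this point is discarded as a null set.\<close>
      have "AE t in lborel. t \<noteq> (0::real)" by (rule AE_lborel_singleton)
      then show "AE t in lborel. (\<integral>\<^sup>+z. ennreal (L * V (x + t *\<^sub>R (z - x))) * indicator {0..1} t * indicator ?Q z \<partial>lborel)
        \<le> ennreal (L * v * \<kappa> powr (- 1 / q) * T) * (ennreal (t powr \<alpha>) * indicator {0..1} t)"
      proof eventually_elim
        case (elim t)
        show ?case
        proof (cases "t \<in> {0..1}")
          case True
          then have "(\<integral>\<^sup>+z. ennreal (L * V (x + t *\<^sub>R (z - x))) * indicator {0..1} t * indicator ?Q z \<partial>lborel) =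
             (\<integral>\<^sup>+z. ennreal L * (ennreal (V (x + t *\<^sub>R (z - x))) * indicator ?Q z) \<partial>lborel)"
            using L by (intro nn_integral_cong) (simp add: ennreal_mult V_def mult.assoc)
          also have "\<dots> = ennreal L * (\<integral>\<^sup>+z\<in>?Q. ennreal (V (x + t *\<^sub>R (z - x))) \<partial>lborel)"
            by (rule nn_integral_cmult) measurable
          also have "\<dots> \<le> ennreal L * ennreal (v * (\<kappa> powr (- 1 / q) * t powr \<alpha> * T))"
            using True elim by (intro mult_left_mono mean x) auto
          also have "\<dots> = ennreal (L * v * \<kappa> powr (- 1 / q) * T) * (ennreal (t powr \<alpha>) * indicator {0..1} t)"
            using True L v T by (simp add: ac_simps flip: ennreal_mult)
          finally show ?thesis .
        qed simp
      qed
    qed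
    also have "\<dots> = ennreal (L * v * \<kappa> powr (- 1 / q) * T) * ennreal (1 / (\<alpha> + 1))"
      using nn_integral_powr_0_1[OF \<alpha>(1)] by (subst nn_integral_cmult) auto
    also have "\<dots> = ennreal I"
      unfolding I_def using L v T \<alpha>(1) by (intro ennreal_mult[symmetric]) auto
    finally show ?thesis .
  qed
  have fm [measurable]: "(\<lambda>z. f (upd i s z)) \<in> borel_measurable borel"
    using continuous_on_compose2[OF C_k_imp_continuous_on[OF f, of UNIV] continuous_on_upd]
    by (intro borel_measurable_continuous_onI) auto
  \<comment> \<open>Both values are compared with \<open>f (upd i s z)\<close> and averaged over
    \<open>z\<close>, which doubles the constant.\<close>
  have "ennreal \<bar>f (upd i s x) - f (upd i s y)\<bar> * ennreal v = (\<integral>\<^sup>+z\<in>?Q. ennreal \<bar>f (upd i s x) - f (upd i s y)\<bar> \<partial>lborel)"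
    using emeasure_cube[OF \<open>r > 0\<close>, of c, folded v_def] by (simp add: nn_integral_cmult_indicator)
  also have "\<dots> \<le> (\<integral>\<^sup>+z. ennreal \<bar>f (upd i s x) - f (upd i s z)\<bar> * indicator ?Q z + ennreal \<bar>f (upd i s y) - f (upd i s z)\<bar> * indicator ?Q z \<partial>lborel)"
    by (intro nn_integral_mono) (auto simp: indicator_def simp flip: ennreal_plus intro!: ennreal_leI)
  also have "\<dots> = (\<integral>\<^sup>+z\<in>?Q. ennreal \<bar>f (upd i s x) - f (upd i s z)\<bar> \<partial>lborel) + (\<integral>\<^sup>+z\<in>?Q. ennreal \<bar>f (upd i s y) - f (upd i s z)\<bar> \<partial>lborel)"
    by (intro nn_integral_add) measurable
  also have "\<dots> \<le> ennreal I + ennreal I" by (intro add_mono J x y)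
  finally have "ennreal (\<bar>f (upd i s x) - f (upd i s y)\<bar> * v) \<le> ennreal (2 * I)"
    using I v by (simp add: ennreal_mult flip: ennreal_plus)
  then have "\<bar>f (upd i s x) - f (upd i s y)\<bar> * v \<le> 2 * I" using I by simp
  then have "\<bar>f (upd i s x) - f (upd i s y)\<bar> \<le> 2 * I / v" using v by (simp add: pos_le_divide_eq)
  also have "2 * I / v = 4 * ?n * \<kappa> powr (- 1 / q) / (\<alpha> + 1) * r * T"
    using v by (simp add: I_def L_def ac_simps)
  finally show ?thesis using \<alpha>(2) by simp
qed

end

text \<open>Any two boundary points are joined by a path through at most three faces. Faces in
  different directions share a point; for equal or opposite faces the path passes through a face in
  a further direction, which exists because \<open>n \<ge> 2\<close>.\<close>

lemma cube_boundary_oscillation_le: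
  fixes f :: "real ^ 'n::finite \<Rightarrow> real"
  assumes card: "CARD('n) \<ge> 2" and "r > 0"
    and D: "\<And>i \<sigma> x y. \<bar>\<sigma>\<bar> = 1 \<Longrightarrow> x \<in> cube c r \<Longrightarrow> y \<in> cube c r \<Longrightarrow>
      \<bar>f (upd i (c $ i + \<sigma> * r) x) - f (upd i (c $ i + \<sigma> * r) y)\<bar> \<le> D"
    and x: "x \<in> cube c r" "\<bar>x $ i - c $ i\<bar> = r" and y: "y \<in> cube c r" "\<bar>y $ j - c $ j\<bar> = r"
  shows "\<bar>f x - f y\<bar> \<le> 3 * D"
proof -
  have D': "\<bar>f p - f p'\<bar> \<le> D"
    if "\<bar>\<sigma>\<bar> = 1" "p \<in> cube c r" "p' \<in> cube c r" "p $ k = c $ k + \<sigma> * r" "p' $ k = c $ k + \<sigma> * r" for k \<sigma> p p'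
  proof -
    have "upd k (c $ k + \<sigma> * r) p = p" "upd k (c $ k + \<sigma> * r) p' = p'"
      using that by (auto simp: vec_eq_iff)
    then show ?thesis using D[OF that(1-3), of k] by simp
  qed
  have sg: "\<exists>\<sigma>. \<bar>\<sigma>\<bar> = 1 \<and> z $ k = c $ k + \<sigma> * r" if "\<bar>z $ k - c $ k\<bar> = r" for z k
  proof (cases "z $ k - c $ k \<ge> 0")
    case True
    then show ?thesis using that by (intro exI[of _ 1]) auto
  next
    case False
    then show ?thesis using that by (intro exI[of _ "-1"]) auto
  qed
  obtain \<sigma> \<tau> where \<sigma>: "\<bar>\<sigma>\<bar> = 1" "x $ i = c $ i + \<sigma> * r" and \<tau>: "\<bar>\<tau>\<bar> = 1" "y $ j = c $ j + \<tau> * r"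
    using sg[OF x(2)] sg[OF y(2)] by blast
  have in_cube: "upd k (c $ k + s * r) z \<in> cube c r" if "z \<in> cube c r" "\<bar>s\<bar> = 1" for k s z
    using that \<open>r > 0\<close> by (auto simp: cube_def abs_mult)
  have c: "c \<in> cube c r" using \<open>r > 0\<close> by (simp add: cube_def)
  have D0: "D \<ge> 0" using D[OF \<sigma>(1) c c, of i] by simp
  show ?thesis
  proof (cases "i = j")
    case False
    define p where "p = upd i (c $ i + \<sigma> * r) (upd j (c $ j + \<tau> * r) c)"
    have p: "p \<in> cube c r" "p $ i = c $ i + \<sigma> * r" "p $ j = c $ j + \<tau> * r"
      unfolding p_def using False by (auto intro!: in_cube c \<sigma> \<tau>)
    show ?thesis
      using D'[OF \<sigma>(1) x(1) p(1) \<sigma>(2) p(2)] D'[OF \<tau>(1) p(1) y(1) p(3) \<tau>(2)] D0 by linarith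
  next
    case True
    have "\<exists>k. k \<noteq> i"
    proof (rule ccontr)
      assume "\<nexists>k. k \<noteq> i"
      then have "(UNIV :: 'n set) = {i}" by auto
      then have "CARD('n) = card {i}" by presburger
      then show False using card by simp
    qed
    then obtain k where k: "k \<noteq> i" by blast
    define p where "p = upd i (c $ i + \<sigma> * r) (upd k (c $ k + 1 * r) c)"
    define p' where "p' = upd i (c $ i + \<tau> * r) (upd k (c $ k + 1 * r) c)"
    have p: "p \<in> cube c r" "p $ i = c $ i + \<sigma> * r" "p $ k = c $ k + 1 * r"
      unfolding p_def using k by (auto intro!: in_cube c \<sigma> in_cube[of _ 1, simplified])
    have p': "p' \<in> cube c r" "p' $ j = c $ j + \<tau> * r" "p' $ k = c $ k + 1 * r"
      unfolding p'_def using k True by (auto intro!: in_cube c \<tau> in_cube[of _ 1, simplified])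
    show ?thesis
      using D'[OF \<sigma>(1) x(1) p(1) \<sigma>(2) p(2)] D'[OF _ p(1) p'(1) p(3) p'(3)] 
        D'[OF \<tau>(1) p'(1) y(1) p'(2) \<tau>(2)] by simp
  qed
qed

text \<open>As \<open>r\<close> runs through the interval, one face sweeps out a pyramid with apex
  \<open>c\<close> inside the big cube, and dividing by \<open>2 * r\<close> cancels the thickness
  contained in the cube integral. Formally this is \<open>nn_integral_slices\<close> with a width
  that varies with the height.\<close>

lemma nn_integral_faces_le:
  fixes H :: "real ^ 'n::finite \<Rightarrow> ennreal"
  assumes [measurable]: "H \<in> borel_measurable borel" and \<sigma>: "\<bar>\<sigma>\<bar> = 1"
  shows "(\<integral>\<^sup>+r\<in>{0<..<R}. (\<integral>\<^sup>+z\<in>cube c r. H (upd i (c $ i + \<sigma> * r) z) \<partial>lborel) / ennreal (2 * r) \<partial>lborel) \<le>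
    (\<integral>\<^sup>+z\<in>cube c R. H z \<partial>lborel)"
proof -
  define \<rho> where "\<rho> s = \<bar>s - c $ i\<bar>" for s
  \<comment> \<open>The pyramid: the offset in direction \<open>i\<close>, with sign
    \<open>\<sigma>\<close>, is positive, below \<open>R\<close>, and dominates all other offsets.
    On it \<open>\<rho>\<close> recovers the radius of the face through the given point.\<close>
  define N where "N = {y. 0 < \<sigma> * (y $ i - c $ i) \<and> \<sigma> * (y $ i - c $ i) < R \<and> (\<forall>j\<in>UNIV. \<bar>y $ j - c $ j\<bar> \<le> \<rho> (y $ i))}"
  define H' where "H' y = indicator N y * H y / ennreal (2 * \<rho> (y $ i))" for y
  have [measurable]: "\<rho> \<in> borel_measurable borel" unfolding \<rho>_def by measurable
  have [measurable]: "N \<in> sets borel" unfolding N_def by measurable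
  have [measurable]: "H' \<in> borel_measurable borel" unfolding H'_def by measurable
  have \<sigma>\<sigma>: "\<sigma> * \<sigma> = 1" using \<sigma> by (metis abs_mult_self_eq mult_1)
  have [measurable]: "(\<lambda>(s, z). indicator {z. \<bar>z $ i - c $ i\<bar> \<le> \<rho> s} z * H' (upd i s z)) \<in> borel_measurable (borel \<Otimes>\<^sub>M borel)"
    unfolding upd_def by measurable
  have "(\<integral>\<^sup>+r\<in>{0<..<R}. (\<integral>\<^sup>+z\<in>cube c r. H (upd i (c $ i + \<sigma> * r) z) \<partial>lborel) / ennreal (2 * r) \<partial>lborel) \<le>
    (\<integral>\<^sup>+r. (\<integral>\<^sup>+z. indicator {z. \<bar>z $ i - c $ i\<bar> \<le> \<rho> (c $ i + \<sigma> * r)} z * H' (upd i (c $ i + \<sigma> * r) z) \<partial>lborel) \<partial>lborel)"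
  proof (rule nn_integral_mono)
    fix r :: real
    show "(\<integral>\<^sup>+z\<in>cube c r. H (upd i (c $ i + \<sigma> * r) z) \<partial>lborel) / ennreal (2 * r) * indicator {0<..<R} r \<le>
      (\<integral>\<^sup>+z. indicator {z. \<bar>z $ i - c $ i\<bar> \<le> \<rho> (c $ i + \<sigma> * r)} z * H' (upd i (c $ i + \<sigma> * r) z) \<partial>lborel)"
    proof (cases "r \<in> {0<..<R}")
      case True
      have \<rho>r: "\<rho> (c $ i + \<sigma> * r) = r" using True \<sigma> by (simp add: \<rho>_def abs_mult)
      have [measurable]: "(\<lambda>z. H (upd i (c $ i + \<sigma> * r) z)) \<in> borel_measurable borel"
        unfolding upd_def by measurable
      have "(\<integral>\<^sup>+z\<in>cube c r. H (upd i (c $ i + \<sigma> * r) z) \<partial>lborel) / ennreal (2 * r) * indicator {0<..<R} r =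
        (\<integral>\<^sup>+z. H (upd i (c $ i + \<sigma> * r) z) * indicator (cube c r) z / ennreal (2 * r) \<partial>lborel)"
        using True by (simp add: nn_integral_divide)
      also have "\<dots> \<le> (\<integral>\<^sup>+z. indicator {z. \<bar>z $ i - c $ i\<bar> \<le> \<rho> (c $ i + \<sigma> * r)} z * H' (upd i (c $ i + \<sigma> * r) z) \<partial>lborel)"
      proof (rule nn_integral_mono)
        fix z
        have "upd i (c $ i + \<sigma> * r) z \<in> N" "\<bar>z $ i - c $ i\<bar> \<le> r" if "z \<in> cube c r"
          using that True \<sigma>\<sigma> \<sigma> by (auto simp: N_def \<rho>r cube_def abs_mult simp flip: mult.assoc)
        then show "H (upd i (c $ i + \<sigma> * r) z) * indicator (cube c r) z / ennreal (2 * r) \<le>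
          indicator {z. \<bar>z $ i - c $ i\<bar> \<le> \<rho> (c $ i + \<sigma> * r)} z * H' (upd i (c $ i + \<sigma> * r) z)"
          by (cases "z \<in> cube c r") (auto simp: H'_def \<rho>r)
      qed
      finally show ?thesis .
    qed simp
  qed
  also have "\<dots> = (\<integral>\<^sup>+s. (\<integral>\<^sup>+z. indicator {z. \<bar>z $ i - c $ i\<bar> \<le> \<rho> s} z * H' (upd i s z) \<partial>lborel) \<partial>lborel)"
    using \<sigma> by (subst nn_integral_real_affine[of "\<lambda>s. \<integral>\<^sup>+z. indicator {z. \<bar>z $ i - c $ i\<bar> \<le> \<rho> s} z * H' (upd i s z) \<partial>lborel" \<sigma> "c $ i"]) auto
  also have "\<dots> = (\<integral>\<^sup>+y. ennreal (2 * \<rho> (y $ i)) * H' y \<partial>lborel)"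
    by (rule nn_integral_slices) (auto simp: \<rho>_def)
  also have "\<dots> \<le> (\<integral>\<^sup>+y\<in>cube c R. H y \<partial>lborel)"
  proof (rule nn_integral_mono)
    fix y :: "real ^ 'n"
    show "ennreal (2 * \<rho> (y $ i)) * H' y \<le> H y * indicator (cube c R) y"
    proof (cases "y \<in> N")
      case True
      have "\<rho> (y $ i) = \<sigma> * (y $ i - c $ i)"
        using True \<sigma> by (auto simp: N_def \<rho>_def abs_if split: if_splits)
      then have \<rho>: "0 < \<rho> (y $ i)" "\<rho> (y $ i) < R" using True by (auto simp: N_def)
      then have "y \<in> cube c R" using True by (auto simp: N_def cube_def intro: order_trans less_imp_le)
      moreover have "ennreal (2 * \<rho> (y $ i)) * H' y = H y"
        unfolding H'_def ennreal_times_divide using True \<rho>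
        by (subst mult.commute) (simp add: ennreal_mult_divide_eq)
      ultimately show ?thesis by simp
    qed (simp add: H'_def)
  qed
  finally show ?thesis .
qed

lemma measurable_face_integral:
  fixes H :: "real ^ 'n::finite \<Rightarrow> ennreal"
  assumes [measurable]: "H \<in> borel_measurable borel"
  shows "(\<lambda>r. (\<integral>\<^sup>+z\<in>cube c r. H (upd i (c $ i + \<sigma> * r) z) \<partial>lborel) / ennreal (2 * r)) \<in> borel_measurable borel"
proof -
  have "(\<lambda>(r, z). H (upd i (c $ i + \<sigma> * r) z) * indicator {z. \<forall>j\<in>UNIV. \<bar>z $ j - c $ j\<bar> \<le> r} z) \<in> borel_measurable (borel \<Otimes>\<^sub>M borel)"
    unfolding upd_def by measurable
  then have "(\<lambda>(r, z). H (upd i (c $ i + \<sigma> * r) z) * indicator (cube c r) z) \<in> borel_measurable (borel \<Otimes>\<^sub>M borel)"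
    by (simp add: cube_def)
  then have [measurable]: "(\<lambda>r. \<integral>\<^sup>+z\<in>cube c r. H (upd i (c $ i + \<sigma> * r) z) \<partial>lborel) \<in> borel_measurable borel"
    by (intro lborel.borel_measurable_nn_integral) simp
  show ?thesis by measurable
qed

section \<open>Energies over all faces and their limit inferior\<close>

context real_young
begin

text \<open>Unites the two cases on the dimension. The constant is fixed before the function, the
  cube and the level \<open>T\<close>, so one \<open>K\<close> serves all mollifications and all
  radii.\<close>

lemma face_oscillation:
  assumes "CARD('n::finite) = 2 \<or> CARD('n) \<ge> 2 \<and> (\<exists>q \<kappa>. q > real CARD('n) - 1 \<and> 0 < \<kappa> \<and> \<kappa> \<le> 1 \<and>
    (\<forall>t\<ge>t0. \<forall>\<mu>\<ge>1. \<kappa> * \<mu> powr q * a t \<le> a (\<mu> * t)))"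
  shows "\<exists>K>0. \<forall>(f :: real ^ 'n \<Rightarrow> real) c r i s T x y. C_k (Suc 0) f \<longrightarrow> r > 0 \<longrightarrow> T \<ge> t0 \<longrightarrow> T > 0 \<longrightarrow> a T > 0 \<longrightarrow>
    face_energy f c r i s \<le> ennreal ((2 * r) ^ CARD('n) * a T) \<longrightarrow> x \<in> cube c r \<longrightarrow> y \<in> cube c r \<longrightarrow>
    \<bar>f (upd i s x) - f (upd i s y)\<bar> \<le> K * r * T"
  using assms
proof (elim disjE conjE exE)
  assume "CARD('n) = 2"
  then show ?thesis using face_oscillation_2[where 'n = 'n] by (intro exI[of _ 2] conjI) (simp, blast)
next
  fix q \<kappa>
  assume q: "CARD('n) \<ge> 2" "q > real CARD('n) - 1" "0 < \<kappa>" "\<kappa> \<le> 1"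
    and gr: "\<forall>t\<ge>t0. \<forall>\<mu>\<ge>1. \<kappa> * \<mu> powr q * a t \<le> a (\<mu> * t)"
  have q0: "q > 0" using q by linarith
  let ?K = "4 * real CARD('n) * \<kappa> powr (- 1 / q) / (1 - (real CARD('n) - 1) / q)"
  have "?K > 0" using q q0 by (intro divide_pos_pos) auto
  then show ?thesis
    using face_oscillation_growth[OF _ _ q(2) q0 q(3,4)] gr by (intro exI[of _ ?K]) blast
qed

text \<open>Gradient energy and L1 mass, summed over the \<open>2 * CARD('n)\<close> faces and
  scaled to genuine face integrals by \<open>2 * r\<close>. The mass term locates the boundary
  values; the gradient term alone would only bound their oscillation.\<close>

definition shell_energy :: "(real ^ 'n::finite \<Rightarrow> real) \<Rightarrow> real ^ 'n \<Rightarrow> real \<Rightarrow> ennreal" where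
  "shell_energy f c r =
    (\<Sum>i\<in>UNIV. \<Sum>\<sigma>\<in>{1, - 1}. face_energy f c r i (c $ i + \<sigma> * r) / ennreal (2 * r) +
      (\<integral>\<^sup>+z\<in>cube c r. ennreal \<bar>f (upd i (c $ i + \<sigma> * r) z)\<bar> \<partial>lborel) / ennreal (2 * r))"

lemma measurable_energy_density:
  fixes f :: "real ^ 'n::finite \<Rightarrow> real"
  assumes "C_k (Suc 0) f"
  shows "(\<lambda>z. ennreal (a (norm (grad f z)))) \<in> borel_measurable borel" "(\<lambda>z. ennreal \<bar>f z\<bar>) \<in> borel_measurable borel"
proof -
  have [measurable]: "(\<lambda>z. norm (grad f z)) \<in> borel_measurable borel" "f \<in> borel_measurable borel"
    using continuous_on_norm_grad[OF assms] C_k_imp_continuous_on[OF assms]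
    by (auto intro: borel_measurable_continuous_onI)
  show "(\<lambda>z. ennreal (a (norm (grad f z)))) \<in> borel_measurable borel" "(\<lambda>z. ennreal \<bar>f z\<bar>) \<in> borel_measurable borel"
    by measurable
qed

text \<open>The factor counts the faces: \<open>nn_integral_faces_le\<close> bounds the contribution
  of each by the integral over the full cube.\<close>

lemma shell_energy:
  fixes f :: "real ^ 'n::finite \<Rightarrow> real"
  assumes f: "C_k (Suc 0) f"
  shows "shell_energy f c \<in> borel_measurable borel"
    "(\<integral>\<^sup>+r\<in>{0<..<R}. shell_energy f c r \<partial>lborel) \<le> of_nat (2 * CARD('n)) *
      ((\<integral>\<^sup>+z\<in>cube c R. ennreal (a (norm (grad f z))) \<partial>lborel) + (\<integral>\<^sup>+z\<in>cube c R. ennreal \<bar>f z\<bar> \<partial>lborel))"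
proof -
  note m = measurable_face_integral[OF measurable_energy_density(1)[OF f], where c = c]
    measurable_face_integral[OF measurable_energy_density(2)[OF f], where c = c]
  note [measurable] = m
  show ms: "shell_energy f c \<in> borel_measurable borel"
    unfolding shell_energy_def face_energy_def by measurable
  let ?A = "(\<integral>\<^sup>+z\<in>cube c R. ennreal (a (norm (grad f z))) \<partial>lborel)" and ?B = "(\<integral>\<^sup>+z\<in>cube c R. ennreal \<bar>f z\<bar> \<partial>lborel)"
  define F where "F i \<sigma> r = (\<integral>\<^sup>+z\<in>cube c r. ennreal (a (norm (grad f (upd i (c $ i + \<sigma> * r) z)))) \<partial>lborel) / ennreal (2 * r)" for i \<sigma> r
  define F' where "F' i \<sigma> r = (\<integral>\<^sup>+z\<in>cube c r. ennreal \<bar>f (upd i (c $ i + \<sigma> * r) z)\<bar> \<partial>lborel) / ennreal (2 * r)" for i \<sigma> r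
  have [measurable]: "F i \<sigma> \<in> borel_measurable borel" "F' i \<sigma> \<in> borel_measurable borel" for i \<sigma>
    using m[where i = i and \<sigma> = \<sigma>] unfolding F_def F'_def by simp_all
  have "(\<integral>\<^sup>+r\<in>{0<..<R}. shell_energy f c r \<partial>lborel) =
    (\<integral>\<^sup>+r. (\<Sum>i\<in>UNIV. \<Sum>\<sigma>\<in>{1, - 1}. F i \<sigma> r * indicator {0<..<R} r + F' i \<sigma> r * indicator {0<..<R} r) \<partial>lborel)"
    unfolding shell_energy_def face_energy_def F_def[symmetric] F'_def[symmetric]
    by (simp only: sum_distrib_right distrib_right)
  also have "\<dots> = (\<Sum>i\<in>UNIV. \<Sum>\<sigma>\<in>{1, - 1}. (\<integral>\<^sup>+r\<in>{0<..<R}. F i \<sigma> r \<partial>lborel) + (\<integral>\<^sup>+r\<in>{0<..<R}. F' i \<sigma> r \<partial>lborel))"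
    by (simp add: nn_integral_sum nn_integral_add)
  also have "\<dots> \<le> (\<Sum>i\<in>(UNIV::'n set). \<Sum>\<sigma>\<in>{1, - 1::real}. ?A + ?B)"
    unfolding F_def F'_def
    by (intro sum_mono add_mono nn_integral_faces_le measurable_energy_density f) auto
  also have "\<dots> = of_nat (2 * CARD('n)) * (?A + ?B)"
    by (simp add: algebra_simps)
  finally show "(\<integral>\<^sup>+r\<in>{0<..<R}. shell_energy f c r \<partial>lborel) \<le> of_nat (2 * CARD('n)) * (?A + ?B)" .
qed

text \<open>A single face term is at most the whole sum, and multiplication by \<open>2 * r\<close>
  raises the power from \<open>CARD('n) - 1\<close> to \<open>CARD('n)\<close>. If
  \<open>\<bar>f\<bar>\<close> exceeded \<open>\<beta> + 1\<close> on an entire face, its mean there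
  would exceed \<open>\<beta>\<close>.\<close>

lemma shell_energy_less:
  fixes f :: "real ^ 'n::finite \<Rightarrow> real"
  assumes f: "C_k (Suc 0) f" and r: "r > 0" and less: "shell_energy f c r < ennreal ((2 * r) ^ (CARD('n) - 1) * \<beta>)"
    and \<sigma>: "\<bar>\<sigma>\<bar> = 1" and \<beta>: "\<beta> \<ge> 0"
  shows "face_energy f c r i (c $ i + \<sigma> * r) \<le> ennreal ((2 * r) ^ CARD('n) * \<beta>)"
    "\<exists>z\<in>cube c r. \<bar>f (upd i (c $ i + \<sigma> * r) z)\<bar> \<le> \<beta> + 1"
proof -
  let ?F = "\<lambda>i \<sigma>. face_energy f c r i (c $ i + \<sigma> * r) / ennreal (2 * r)"
  let ?G = "\<lambda>i \<sigma>. (\<integral>\<^sup>+z\<in>cube c r. ennreal \<bar>f (upd i (c $ i + \<sigma> * r) z)\<bar> \<partial>lborel) / ennreal (2 * r)"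
  have "\<sigma> \<in> {1, - 1}" using \<sigma> by auto
  then have "?F i \<sigma> + ?G i \<sigma> \<le> (\<Sum>\<sigma>\<in>{1, - 1}. ?F i \<sigma> + ?G i \<sigma>)"
    by (intro member_le_sum) auto
  also have "\<dots> \<le> shell_energy f c r"
    unfolding shell_energy_def by (rule member_le_sum) auto
  finally have le: "?F i \<sigma> + ?G i \<sigma> < ennreal ((2 * r) ^ (CARD('n) - 1) * \<beta>)" using less by (rule order.strict_trans1)
  have pw: "(2 * r) ^ CARD('n) = (2 * r) * (2 * r) ^ (CARD('n) - 1)"
    by (metis power_minus_mult mult.commute zero_less_card_finite)
  have mult: "X \<le> ennreal ((2 * r) ^ CARD('n) * \<beta>)" if "X / ennreal (2 * r) \<le> ennreal ((2 * r) ^ (CARD('n) - 1) * \<beta>)" for X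
  proof -
    have "X = ennreal (2 * r) * (X / ennreal (2 * r))"
      using r by (simp add: ennreal_times_divide) (metis ennreal_eq_0_iff ennreal_mult_divide_eq ennreal_neq_top mult.commute mult_pos_pos not_le zero_less_numeral)
    also have "\<dots> \<le> ennreal (2 * r) * ennreal ((2 * r) ^ (CARD('n) - 1) * \<beta>)"
      using that by (rule mult_left_mono) simp
    also have "\<dots> = ennreal ((2 * r) ^ CARD('n) * \<beta>)"
      using r \<beta> unfolding pw by (simp add: mult.assoc flip: ennreal_mult)
    finally show ?thesis .
  qed
  have "?F i \<sigma> \<le> ?F i \<sigma> + ?G i \<sigma>" "?G i \<sigma> \<le> ?F i \<sigma> + ?G i \<sigma>" by simp_all
  then have FG: "?F i \<sigma> \<le> ennreal ((2 * r) ^ (CARD('n) - 1) * \<beta>)" "?G i \<sigma> \<le> ennreal ((2 * r) ^ (CARD('n) - 1) * \<beta>)"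
    using le by (meson less_imp_le order_trans)+
  show "face_energy f c r i (c $ i + \<sigma> * r) \<le> ennreal ((2 * r) ^ CARD('n) * \<beta>)"
    using FG(1) by (rule mult)
  show "\<exists>z\<in>cube c r. \<bar>f (upd i (c $ i + \<sigma> * r) z)\<bar> \<le> \<beta> + 1"
  proof (rule ccontr)
    assume "\<not> ?thesis"
    then have gt: "\<beta> + 1 < \<bar>f (upd i (c $ i + \<sigma> * r) z)\<bar>" if "z \<in> cube c r" for z using that by force
    have "ennreal ((\<beta> + 1) * (2 * r) ^ CARD('n)) = ennreal (\<beta> + 1) * ennreal ((2 * r) ^ CARD('n))"
      using \<beta> r by (intro ennreal_mult) auto
    also have "\<dots> = (\<integral>\<^sup>+z\<in>cube c r. ennreal (\<beta> + 1) \<partial>lborel)"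
      by (simp only: nn_integral_cmult_indicator sets_lborel sets_cube emeasure_cube[OF r])
    also have "\<dots> \<le> (\<integral>\<^sup>+z\<in>cube c r. ennreal \<bar>f (upd i (c $ i + \<sigma> * r) z)\<bar> \<partial>lborel)"
      using gt by (intro nn_integral_mono) (auto simp: indicator_def intro!: ennreal_leI less_imp_le)
    also have "\<dots> \<le> ennreal ((2 * r) ^ CARD('n) * \<beta>)"
      using FG(2) by (rule mult)
    finally have "(\<beta> + 1) * (2 * r) ^ CARD('n) \<le> \<beta> * (2 * r) ^ CARD('n)"
      using \<beta> r by (simp add: mult.commute)
    then show False using r by (simp add: mult_le_cancel_right)
  qed
qed

text \<open>A limit inferior below the threshold gives infinitely many good \<open>k\<close>. For
  these each face oscillates by at most \<open>K * r * T\<close> and the boundary by three times as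
  much, while the mass term bounds the value at one boundary point; Bolzano-Weierstrass at that
  point supplies the centre \<open>m\<close>.\<close>

lemma boundary_values_subsequence:
  fixes f :: "nat \<Rightarrow> real ^ 'n::finite \<Rightarrow> real"
  assumes card: "CARD('n) \<ge> 2" and f: "\<And>k. C_k (Suc 0) (f k)" and r: "r > 0" and T: "a T > 0" "K * r * T \<ge> 0"
    and K: "\<And>(f :: real ^ 'n \<Rightarrow> real) i s x y. C_k (Suc 0) f \<Longrightarrow>
      face_energy f c r i s \<le> ennreal ((2 * r) ^ CARD('n) * a T) \<Longrightarrow> x \<in> cube c r \<Longrightarrow> y \<in> cube c r \<Longrightarrow>
      \<bar>f (upd i s x) - f (upd i s y)\<bar> \<le> K * r * T"
    and less: "liminf (\<lambda>k. shell_energy (f k) c r) < ennreal ((2 * r) ^ (CARD('n) - 1) * a T)"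
  obtains \<phi> :: "nat \<Rightarrow> nat" and m where "strict_mono \<phi>"
    "\<And>\<delta>. \<delta> > 0 \<Longrightarrow> eventually (\<lambda>k. \<forall>x\<in>cube c r. (\<exists>i. \<bar>x $ i - c $ i\<bar> = r) \<longrightarrow> \<bar>f (\<phi> k) x - m\<bar> < 3 * K * r * T + \<delta>) sequentially"
proof -
  define S where "S = {k. shell_energy (f k) c r < ennreal ((2 * r) ^ (CARD('n) - 1) * a T)}"
  have "infinite S"
  proof
    assume "finite S"
    then obtain N where N: "\<And>k. k \<in> S \<Longrightarrow> k < N" unfolding finite_nat_set_iff_bounded by auto
    then have "eventually (\<lambda>k. ennreal ((2 * r) ^ (CARD('n) - 1) * a T) \<le> shell_energy (f k) c r) sequentially"
    proof (intro eventually_sequentiallyI[of N])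
      fix k assume "N \<le> k"
      with N have "k \<notin> S" by (meson not_less)
      then show "ennreal ((2 * r) ^ (CARD('n) - 1) * a T) \<le> shell_energy (f k) c r"
        unfolding S_def by (simp only: mem_Collect_eq not_less)
    qed
    then have "ennreal ((2 * r) ^ (CARD('n) - 1) * a T) \<le> liminf (\<lambda>k. shell_energy (f k) c r)"
      by (rule Liminf_bounded)
    from leD[OF this] less show False by contradiction
  qed
  \<comment> \<open>Only fixes some coordinate direction, so that the reference point
    \<open>p\<close> can be placed on the boundary.\<close>
  obtain i :: 'n where True by simp
  define p where "p = upd i (c $ i + 1 * r) c"
  have p: "p \<in> cube c r" "\<bar>p $ i - c $ i\<bar> = r"
    using r by (auto simp: p_def cube_def)
  have SD: "shell_energy (f k) c r < ennreal ((2 * r) ^ (CARD('n) - 1) * a T)" if "k \<in> S" for k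
    using that unfolding S_def by (rule CollectD)
  have Kf: "\<bar>f k (upd j (c $ j + \<sigma> * r) x) - f k (upd j (c $ j + \<sigma> * r) y)\<bar> \<le> K * r * T"
    if "k \<in> S" "\<bar>\<sigma>\<bar> = 1" "x \<in> cube c r" "y \<in> cube c r" for k j \<sigma> x y
    by (rule K[OF f shell_energy_less(1)[OF f r SD[OF that(1)] that(2) less_imp_le[OF T(1)]] that(3,4)])
  have osc: "\<bar>f k x - f k y\<bar> \<le> 3 * (K * r * T)"
    if "k \<in> S" "x \<in> cube c r" "y \<in> cube c r" "\<bar>x $ i - c $ i\<bar> = r" "\<bar>y $ j - c $ j\<bar> = r" for k x y i j
    using Kf[OF that(1)] by (rule cube_boundary_oscillation_le[OF card r _ that(2,4,3,5)])
  \<comment> \<open>Some point of the face has a value of size at most \<open>a T + 1\<close>, and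
    the boundary oscillation carries this bound over to \<open>p\<close>.\<close>
  have bd: "\<bar>f k p\<bar> \<le> 3 * (K * r * T) + a T + 1" if kS: "k \<in> S" for k
  proof -
    obtain z where z: "z \<in> cube c r" "\<bar>f k (upd i (c $ i + 1 * r) z)\<bar> \<le> a T + 1"
      using shell_energy_less(2)[OF f r SD[OF kS] _ less_imp_le[OF T(1)], of 1 i] by auto
    have "upd i (c $ i + 1 * r) z \<in> cube c r" using z r by (auto simp: cube_def)
    from osc[OF kS p(1) this p(2), of i] r z(2) show ?thesis by auto
  qed
  define e where "e = enumerate S"
  have e: "strict_mono e" "\<And>k. e k \<in> S"
    unfolding e_def using \<open>infinite S\<close> by (auto intro: strict_mono_enumerate enumerate_in_set)
  have "bounded (range (\<lambda>k. f (e k) p))"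
    using bd[OF e(2)] by (auto simp: bounded_iff)
  then obtain m \<psi> where \<psi>: "strict_mono \<psi>" "((\<lambda>k. f (e k) p) \<circ> \<psi>) \<longlonglongrightarrow> m"
    using bounded_imp_convergent_subsequence by blast
  show thesis
  proof (rule that[of "e \<circ> \<psi>" m])
    show "strict_mono (e \<circ> \<psi>)" using e \<psi> by (intro strict_mono_o)
    fix \<delta> :: real assume "\<delta> > 0"
    from tendstoD[OF \<psi>(2) this]
    show "eventually (\<lambda>k. \<forall>x\<in>cube c r. (\<exists>i. \<bar>x $ i - c $ i\<bar> = r) \<longrightarrow> \<bar>f ((e \<circ> \<psi>) k) x - m\<bar> < 3 * K * r * T + \<delta>) sequentially"
    proof eventually_elim
      case (elim k)
      show ?case
      proof (intro ballI impI, elim exE)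
        fix x j assume x: "x \<in> cube c r" "\<bar>x $ j - c $ j\<bar> = r"
        from osc[OF e(2)[of "\<psi> k"] x(1) p(1) x(2) p(2)] elim
        show "\<bar>f ((e \<circ> \<psi>) k) x - m\<bar> < 3 * K * r * T + \<delta>"
          by (simp add: dist_real_def)
      qed
    qed
  qed
qed

text \<open>Fatou's lemma in the radius, applied to bounds that are uniform in
  \<open>k\<close>.\<close>

lemma liminf_shell_energy:
  fixes f :: "nat \<Rightarrow> real ^ 'n::finite \<Rightarrow> real"
  assumes f: "\<And>k. C_k (Suc 0) (f k)"
    and "\<And>k. (\<integral>\<^sup>+z\<in>cube c R. ennreal (a (norm (grad (f k) z))) \<partial>lborel) \<le> C1"
    and "\<And>k. (\<integral>\<^sup>+z\<in>cube c R. ennreal \<bar>f k z\<bar> \<partial>lborel) \<le> C2"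
  shows "(\<integral>\<^sup>+r\<in>{0<..<R}. liminf (\<lambda>k. shell_energy (f k) c r) \<partial>lborel) \<le> of_nat (2 * CARD('n)) * (C1 + C2)"
proof -
  note [measurable] = shell_energy(1)[OF f]
  have "(\<integral>\<^sup>+r\<in>{0<..<R}. liminf (\<lambda>k. shell_energy (f k) c r) \<partial>lborel) \<le> (\<integral>\<^sup>+r. liminf (\<lambda>k. shell_energy (f k) c r * indicator {0<..<R} r) \<partial>lborel)"
    by (intro nn_integral_mono) (auto simp: indicator_def)
  also have "\<dots> \<le> liminf (\<lambda>k. \<integral>\<^sup>+r\<in>{0<..<R}. shell_energy (f k) c r \<partial>lborel)"
    by (rule nn_integral_liminf) measurable
  also have "\<dots> \<le> liminf (\<lambda>k::nat. of_nat (2 * CARD('n)) * (C1 + C2))"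
    using assms by (intro Liminf_mono always_eventually allI order_trans[OF shell_energy(2)] mult_left_mono add_mono) auto
  finally show ?thesis by (simp add: Liminf_const)
qed

end

section \<open>Truncations with zero boundary values\<close>

lemma lebesgue_on_integral_eq_lborel:
  fixes h :: "'a::euclidean_space \<Rightarrow> 'b::{banach, second_countable_topology}"
  assumes [measurable]: "h \<in> borel_measurable borel" "U \<in> sets borel" and "\<And>x. x \<notin> U \<Longrightarrow> h x = 0"
  shows "(LINT x|lebesgue_on U. h x) = (LINT x|lborel. h x)"
proof -
  have "(LINT x|lebesgue_on U. h x) = (LINT x|lebesgue. indicator U x *\<^sub>R h x)"
    by (subst integral_restrict_space) auto
  also have "(\<lambda>x. indicator U x *\<^sub>R h x) = h"
    using assms(3) by (auto simp: indicator_def)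
  also have "(LINT x|lebesgue. h x) = (LINT x|lborel. h x)"
    by (rule integral_completion) simp
  finally show ?thesis .
qed

lemma lebesgue_on_nn_integral_eq_lborel:
  fixes h :: "'a::euclidean_space \<Rightarrow> ennreal"
  assumes [measurable]: "U \<in> sets borel"
  shows "(\<integral>\<^sup>+x. h x \<partial>lebesgue_on U) = (\<integral>\<^sup>+x\<in>U. h x \<partial>lborel)"
  by (subst nn_integral_restrict_space) (auto simp: nn_integral_completion)

lemma test_functions_integrable:
  assumes "\<eta> \<in> test_functions \<Omega>"
  shows "integrable lborel \<eta>"
proof -
  obtain B where B: "\<And>x. \<bar>\<eta> x\<bar> \<le> B" using test_functions_bounded[OF assms] by metis
  let ?S = "closure {x. \<eta> x \<noteq> 0}"
  have c: "compact ?S" using test_functionsD(2)[OF assms] .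
  show ?thesis
  proof (rule Bochner_Integration.integrable_bound[of _ "\<lambda>x. B * indicator ?S x"])
    show "integrable lborel (\<lambda>x. B * indicator ?S x)"
      using emeasure_bounded_finite[OF compact_imp_bounded[OF c]]
      by (intro integrable_mult_right integrable_real_indicator) auto
    have "\<bar>\<eta> x\<bar> \<le> \<bar>B * indicator ?S x\<bar>" for x
      using B[of x] closure_subset[of "{x. \<eta> x \<noteq> 0}"] by (cases "\<eta> x = 0") (auto simp: indicator_def)
    then show "AE x in lborel. norm (\<eta> x) \<le> norm (B * indicator ?S x)" by auto
  qed (use test_functionsD(6)[OF assms] in simp)
qed

text \<open>Near the origin, the convolution of \<open>\<eta>\<close> with the indicator of a large ball is constant.\<close>

lemma integral_partial_test_function:
  fixes \<eta> :: "real ^ 'n::finite \<Rightarrow> real"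
  assumes \<eta>: "\<eta> \<in> test_functions \<Omega>"
  shows "(LINT x|lborel. partial i \<eta> x) = 0"
proof -
  obtain b where b: "\<And>x. \<eta> x \<noteq> 0 \<Longrightarrow> norm x \<le> b"
    using compact_imp_bounded[OF test_functionsD(2)[OF \<eta>]] closure_subset
    unfolding bounded_iff by (metis (mono_tags, lifting) mem_Collect_eq subset_iff)
  obtain b' where b': "\<And>x. partial i \<eta> x \<noteq> 0 \<Longrightarrow> norm x \<le> b'"
    using compact_imp_bounded[OF test_functionsD(2)[OF test_functions_partial[OF \<eta>, of i]]] closure_subset
    unfolding bounded_iff by (metis (mono_tags, lifting) mem_Collect_eq subset_iff)
  \<comment> \<open>With this radius the ball contains the support of the reflected
    \<open>\<eta>\<close> shifted by any \<open>x\<close> with \<open>norm x < 1\<close>, as well as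
    that of its reflected partial derivative.\<close>
  define R where "R = max b b' + 1"
  define u where "u = (indicator (ball 0 (R + 1)) :: real ^ 'n \<Rightarrow> real)"
  have u: "integrable lborel u"
    unfolding u_def using emeasure_bounded_finite[OF bounded_ball, of "0 :: real ^ 'n" "R + 1"]
    by (intro integrable_real_indicator) auto
  have shift: "(LINT y|lborel. h (x - y)) = (LINT y|lborel. h y)"
    if [measurable]: "h \<in> borel_measurable borel" for h :: "real ^ 'n \<Rightarrow> real" and x
  proof -
    have "lborel = distr lborel borel (\<lambda>y. x + - 1 *\<^sub>R y)"
      using lborel_affine[of "-1" x] by (simp add: density_1)
    then have "(LINT y|lborel. h y) = (LINT y|distr lborel borel (\<lambda>y. x + - 1 *\<^sub>R y). h y)" by simp
    also have "\<dots> = (LINT y|lborel. h (x - y))" by (subst integral_distr) auto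
    finally show ?thesis ..
  qed
  have "conv \<eta> u x = (LINT y|lborel. \<eta> y)" if "norm x < 1" for x
  proof -
    have "\<eta> (x - y) * u y = \<eta> (x - y)" for y
    proof (cases "\<eta> (x - y) = 0")
      case False
      have "norm y \<le> norm x + norm (x - y)" by (metis norm_minus_commute norm_triangle_sub add.commute)
      then have "norm y < R + 1" using b[OF False] that by (simp add: R_def)
      then show ?thesis by (simp add: u_def)
    qed simp
    then have "(\<lambda>y. \<eta> (x - y) * u y) = (\<lambda>y. \<eta> (x - y))" by blast
    then show ?thesis unfolding conv_def using shift[OF test_functionsD(6)[OF \<eta>], of x] by simp
  qed
  then have "(conv \<eta> u has_derivative (\<lambda>h. 0)) (at 0)"
    using has_derivative_transform_within_open[OF has_derivative_const[of "LINT y|lborel. \<eta> y" "at 0"], of "ball 0 1" "conv \<eta> u"]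
    by simp
  then have "partial i (conv \<eta> u) 0 = 0" by (rule partial_eqI)
  then have "conv (partial i \<eta>) u 0 = 0"
    using partial_conv[OF \<eta> u, of i] by simp
  moreover have "partial i \<eta> (0 - y) * u y = partial i \<eta> (0 - y)" for y
  proof (cases "partial i \<eta> (0 - y) = 0")
    case False
    from b'[OF this] show ?thesis by (simp add: u_def R_def)
  qed simp
  then have "(\<lambda>y. partial i \<eta> (0 - y) * u y) = (\<lambda>y. partial i \<eta> (0 - y))" by blast
  then have "conv (partial i \<eta>) u 0 = (LINT y|lborel. partial i \<eta> (0 - y))"
    unfolding conv_def by simp
  ultimately show ?thesis using shift[OF test_functionsD(6)[OF test_functions_partial[OF \<eta>, of i]], of 0] by simp
qed

section \<open>Integration by parts and weak gradients of limits\<close>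

lemma test_functions_mult:
  assumes "\<eta> \<in> test_functions \<Omega>" "\<zeta> \<in> test_functions \<Omega>'"
  shows "(\<lambda>x. \<eta> x * \<zeta> x) \<in> test_functions \<Omega>"
proof -
  have sub: "closure {x. \<eta> x * \<zeta> x \<noteq> 0} \<subseteq> closure {x. \<eta> x \<noteq> 0}"
    by (rule closure_mono) auto
  then have "compact (closure {x. \<eta> x * \<zeta> x \<noteq> 0})"
    using test_functionsD(2)[OF assms(1)] by (meson bounded_subset closed_closure compact_eq_bounded_closed)
  moreover have "C_k k (\<lambda>x. \<eta> x * \<zeta> x)" for k
    using assms by (intro C_k_mult) (auto simp: test_functions_def)
  ultimately show ?thesis
    using sub test_functionsD(3)[OF assms(1)] unfolding test_functions_def by auto
qed

lemma integral_by_parts_test_functions: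
  fixes \<eta> :: "real ^ 'n::finite \<Rightarrow> real"
  assumes \<eta>: "\<eta> \<in> test_functions \<Omega>" and \<zeta>: "\<zeta> \<in> test_functions \<Omega>'"
  shows "(LINT x|lborel. \<eta> x * partial i \<zeta> x) = - (LINT x|lborel. partial i \<eta> x * \<zeta> x)"
proof -
  have p: "partial i (\<lambda>x. \<eta> x * \<zeta> x) x = \<eta> x * partial i \<zeta> x + partial i \<eta> x * \<zeta> x" for x
    by (intro partial_mult test_functionsD(4)[OF \<eta>] test_functionsD(4)[OF \<zeta>])
  have "integrable lborel (\<lambda>x. \<eta> x * partial i \<zeta> x)" "integrable lborel (\<lambda>x. partial i \<eta> x * \<zeta> x)"
    using test_functions_integrable[OF test_functions_mult[OF \<eta> test_functions_partial[OF \<zeta>]]]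
      test_functions_integrable[OF test_functions_mult[OF test_functions_partial[OF \<eta>] \<zeta>]] by auto
  then show ?thesis
    using integral_partial_test_function[OF test_functions_mult[OF \<eta> \<zeta>], of i] by (simp add: p)
qed

text \<open>For \<open>\<phi> k\<close> the defining identity is integration by parts of two test
  functions. Both of its sides pass to the L1 limit because \<open>\<zeta>\<close> and its partial
  derivatives are bounded.\<close>

lemma weak_gradient_limit:
  fixes w :: "real ^ 'n::finite \<Rightarrow> real" and g :: "real ^ 'n \<Rightarrow> real ^ 'n"
  assumes U: "open U" and w: "integrable (lebesgue_on U) w" and g: "integrable (lebesgue_on U) g"
    and \<phi>: "\<And>k::nat. \<phi> k \<in> test_functions U"
    and lim: "(\<lambda>k. \<integral>\<^sup>+x. ennreal \<bar>w x - \<phi> k x\<bar> \<partial>lebesgue_on U) \<longlonglongrightarrow> 0"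
      "(\<lambda>k. \<integral>\<^sup>+x. ennreal (norm (g x - grad (\<phi> k) x)) \<partial>lebesgue_on U) \<longlonglongrightarrow> 0"
  shows "weak_gradient U w g"
  unfolding weak_gradient_def
proof (intro conjI ballI allI)
  have Us: "U \<in> sets lebesgue" using U by auto
  have loc: "locally_integrable U h" if "integrable (lebesgue_on U) h" for h :: "real ^ 'n \<Rightarrow> 'c::euclidean_space"
    unfolding locally_integrable_def
  proof (intro allI impI)
    fix K assume K: "compact K \<and> K \<subseteq> U"
    have "set_integrable lebesgue U h"
      using that Us unfolding set_integrable_def by (subst (asm) integrable_restrict_space) auto
    then have "set_integrable lebesgue K h"
      by (rule set_integrable_subset) (use K in \<open>auto dest: compact_imp_closed\<close>)
    then show "integrable (lebesgue_on K) h"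
      using K unfolding set_integrable_def by (subst integrable_restrict_space) (auto dest: compact_imp_closed)
  qed
  show "locally_integrable U w" "locally_integrable U g" using w g by (auto intro: loc)
  fix \<zeta> i assume \<zeta>: "\<zeta> \<in> test_functions U"
  \<comment> \<open>Used twice: for \<open>w\<close> against the partial derivative of
    \<open>\<zeta>\<close>, and for a component of \<open>g\<close> against \<open>\<zeta>\<close>
    itself.\<close>
  have lim0: "(\<lambda>k. LINT x|lebesgue_on U. h k x * z x) \<longlonglongrightarrow> (LINT x|lebesgue_on U. H x * z x)"
    if h: "\<And>k. integrable (lebesgue_on U) (h k)" and H: "integrable (lebesgue_on U) H"
      and z: "z \<in> test_functions U"
      and l: "(\<lambda>k. \<integral>\<^sup>+x. ennreal \<bar>H x - h k x\<bar> \<partial>lebesgue_on U) \<longlonglongrightarrow> 0" for h :: "nat \<Rightarrow> real ^ 'n \<Rightarrow> real" and H z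
  proof -
    obtain B where B: "B > 0" "\<And>x. \<bar>z x\<bar> \<le> B" using test_functions_bounded[OF z] by metis
    have mz: "z \<in> borel_measurable (lebesgue_on U)"
      using test_functionsD(6)[OF z] by (intro measurable_restrict_space1 measurable_completion) simp
    have int: "integrable (lebesgue_on U) (\<lambda>x. F x * z x)" if "integrable (lebesgue_on U) F" for F :: "real ^ 'n \<Rightarrow> real"
    proof (rule Bochner_Integration.integrable_bound[of _ "\<lambda>x. B * F x"])
      show "integrable (lebesgue_on U) (\<lambda>x. B * F x)" using that by simp
      show "(\<lambda>x. F x * z x) \<in> borel_measurable (lebesgue_on U)" using that mz by auto
      have "\<bar>F x * z x\<bar> \<le> \<bar>B * F x\<bar>" for x
        using B by (simp add: abs_mult mult.commute[of "\<bar>F x\<bar>"] mult_right_mono)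
      then show "AE x in lebesgue_on U. norm (F x * z x) \<le> norm (B * F x)" by simp
    qed
    have "((\<lambda>k. ennreal B * (\<integral>\<^sup>+x. ennreal \<bar>H x - h k x\<bar> \<partial>lebesgue_on U)) \<longlonglongrightarrow> ennreal B * 0)"
      by (intro ennreal_tendsto_cmult l) simp
    then have t0: "((\<lambda>k. ennreal B * (\<integral>\<^sup>+x. ennreal \<bar>H x - h k x\<bar> \<partial>lebesgue_on U)) \<longlonglongrightarrow> 0)" by simp
    have "(\<integral>\<^sup>+x. ennreal (norm (h k x * z x - H x * z x)) \<partial>lebesgue_on U) \<le> ennreal B * (\<integral>\<^sup>+x. ennreal \<bar>H x - h k x\<bar> \<partial>lebesgue_on U)" for k
    proof -
      have [measurable]: "H \<in> borel_measurable (lebesgue_on U)" "h k \<in> borel_measurable (lebesgue_on U)"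
        using H h by auto
      have "(\<integral>\<^sup>+x. ennreal (norm (h k x * z x - H x * z x)) \<partial>lebesgue_on U) \<le> (\<integral>\<^sup>+x. ennreal B * ennreal \<bar>H x - h k x\<bar> \<partial>lebesgue_on U)"
      proof (rule nn_integral_mono)
        fix x
        have "h k x * z x - H x * z x = - (z x * (H x - h k x))" by (simp add: algebra_simps)
        then have "norm (h k x * z x - H x * z x) = \<bar>z x\<bar> * \<bar>H x - h k x\<bar>"
          by (simp only: real_norm_def abs_minus_cancel abs_mult)
        also have "\<dots> \<le> B * \<bar>H x - h k x\<bar>" using B by (intro mult_right_mono) auto
        finally show "ennreal (norm (h k x * z x - H x * z x)) \<le> ennreal B * ennreal \<bar>H x - h k x\<bar>"
          using B(1) by (simp add: ennreal_leI flip: ennreal_mult)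
      qed
      also have "\<dots> = ennreal B * (\<integral>\<^sup>+x. ennreal \<bar>H x - h k x\<bar> \<partial>lebesgue_on U)"
        by (rule nn_integral_cmult) measurable
      finally show ?thesis .
    qed
    then have "(\<lambda>k. \<integral>\<^sup>+x. ennreal (norm (h k x * z x - H x * z x)) \<partial>lebesgue_on U) \<longlonglongrightarrow> 0"
      by (intro tendsto_sandwich[OF always_eventually always_eventually tendsto_const t0]) auto
    then show ?thesis
      by (intro tendsto_L1_int int h H)
  qed
  have tfi: "integrable (lebesgue_on U) \<eta>" if "\<eta> \<in> test_functions U" for \<eta> :: "real ^ 'n \<Rightarrow> real"
  proof -
    have "integrable lebesgue \<eta>" using test_functions_integrable[OF that] by (simp add: integrable_completion)
    then show ?thesis
      using integrable_mult_indicator[OF Us, of \<eta>] Us by (subst integrable_restrict_space) auto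
  qed
  have lim2: "(\<lambda>k. \<integral>\<^sup>+x. ennreal \<bar>g x $ i - partial i (\<phi> k) x\<bar> \<partial>lebesgue_on U) \<longlonglongrightarrow> 0"
  proof (rule tendsto_sandwich[OF always_eventually always_eventually tendsto_const lim(2)]; intro allI)
    fix k
    show "(\<integral>\<^sup>+x. ennreal \<bar>g x $ i - partial i (\<phi> k) x\<bar> \<partial>lebesgue_on U) \<le> (\<integral>\<^sup>+x. ennreal (norm (g x - grad (\<phi> k) x)) \<partial>lebesgue_on U)"
    proof (intro nn_integral_mono ennreal_leI)
      fix x
      show "\<bar>g x $ i - partial i (\<phi> k) x\<bar> \<le> norm (g x - grad (\<phi> k) x)"
        using component_le_norm_cart[of "g x - grad (\<phi> k) x" i] by (simp add: grad_def)
    qed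
  qed simp
  have gi: "integrable (lebesgue_on U) (\<lambda>x. g x $ i)"
    using integrable_bounded_linear[OF bounded_linear_vec_nth g] .
  have "(\<lambda>k. LINT x|lebesgue_on U. \<phi> k x * partial i \<zeta> x) \<longlonglongrightarrow> (LINT x|lebesgue_on U. w x * partial i \<zeta> x)"
    by (intro lim0 tfi \<phi> w test_functions_partial \<zeta> lim(1))
  moreover have "(LINT x|lebesgue_on U. \<phi> k x * partial i \<zeta> x) = - (LINT x|lebesgue_on U. partial i (\<phi> k) x * \<zeta> x)" for k
  proof -
    note t = test_functions_mult[OF \<phi>[of k] test_functions_partial[OF \<zeta>, of i]] test_functions_mult[OF test_functions_partial[OF \<phi>[of k], of i] \<zeta>]
    have z: "h x = 0" if "h \<in> test_functions U" "x \<notin> U" for h x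
      using test_functionsD(3)[OF that(1)] closure_subset[of "{x. h x \<noteq> 0}"] that(2) by auto
    have "(LINT x|lebesgue_on U. \<phi> k x * partial i \<zeta> x) = (LINT x|lborel. \<phi> k x * partial i \<zeta> x)"
      using U z[OF \<phi>[of k]] by (intro lebesgue_on_integral_eq_lborel test_functionsD(6)[OF t(1)]) auto
    moreover have "(LINT x|lebesgue_on U. partial i (\<phi> k) x * \<zeta> x) = (LINT x|lborel. partial i (\<phi> k) x * \<zeta> x)"
      using U z[OF \<zeta>] by (intro lebesgue_on_integral_eq_lborel test_functionsD(6)[OF t(2)]) auto
    ultimately show ?thesis
      using integral_by_parts_test_functions[OF \<phi>[of k] \<zeta>, of i] by simp
  qed
  moreover have "(\<lambda>k. - (LINT x|lebesgue_on U. partial i (\<phi> k) x * \<zeta> x)) \<longlonglongrightarrow> - (LINT x|lebesgue_on U. g x $ i * \<zeta> x)"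
    by (intro tendsto_minus lim0 tfi \<phi> gi test_functions_partial \<zeta> lim2)
  ultimately show "(LINT x|lebesgue_on U. w x * partial i \<zeta> x) = - (LINT x|lebesgue_on U. g x $ i * \<zeta> x)"
    using LIMSEQ_unique by auto
qed

text \<open>For the Young function \<open>t \<mapsto> t\<close> the condition on \<open>l\<close>
  says that the L1 norm is at most \<open>l\<close>, so any \<open>l\<close> above that norm is
  admissible.\<close>

lemma luxemburg_norm_L1_le:
  fixes f :: "real ^ 'n::finite \<Rightarrow> real"
  assumes [measurable]: "f \<in> borel_measurable (lebesgue_on E)"
  shows "luxemburg_norm ennreal E f \<le> (\<integral>\<^sup>+x. ennreal \<bar>f x\<bar> \<partial>lebesgue_on E)" (is "_ \<le> ?I")
proof (rule ennreal_le_epsilon)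
  fix e :: real assume I: "?I < top" and e: "0 < e"
  \<comment> \<open>Adding \<open>e\<close> keeps \<open>l\<close> positive when the integral is
    0.\<close>
  define l where "l = enn2real ?I + e"
  have l: "l > 0" "ennreal l = ?I + ennreal e"
    using I e by (auto simp: l_def ennreal_plus add_nonneg_pos)
  have "(\<integral>\<^sup>+x. ennreal (\<bar>f x\<bar> / l) \<partial>lebesgue_on E) = (\<integral>\<^sup>+x. ennreal \<bar>f x\<bar> / ennreal l \<partial>lebesgue_on E)"
    using l(1) by (simp add: divide_ennreal)
  also have "\<dots> = ?I / ennreal l" by (rule nn_integral_divide) measurable
  also have "\<dots> \<le> ennreal l / ennreal l" using l by (intro divide_right_mono_ennreal) simp
  also have "\<dots> = 1" using l(1) by (simp add: divide_ennreal)
  finally have "luxemburg_norm ennreal E f \<le> ennreal l"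
    unfolding luxemburg_norm_def using l(1) by (intro Inf_lower) auto
  then show "luxemburg_norm ennreal E f \<le> ?I + ennreal e" by (simp add: l(2))
qed

lemma orlicz_L1:
  fixes f :: "real ^ 'n::finite \<Rightarrow> real"
  assumes "integrable (lebesgue_on E) f"
  shows "f \<in> orlicz ennreal E"
proof -
  have "f \<in> borel_measurable (lebesgue_on E)" using assms by auto
  moreover have "(\<integral>\<^sup>+x. ennreal \<bar>f x\<bar> \<partial>lebesgue_on E) < \<infinity>"
    using assms unfolding integrable_iff_bounded by simp
  ultimately show ?thesis
    unfolding orlicz_def using luxemburg_norm_L1_le[of f E] order.strict_trans1 by blast
qed

section \<open>Truncation between two levels on a cube\<close>

definition ocube :: "real ^ 'n::finite \<Rightarrow> real \<Rightarrow> (real ^ 'n) set" where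
  "ocube c r = {x. \<forall>i. \<bar>x $ i - c $ i\<bar> < r}"

lemma ocube_eq_box: "ocube c r = box (\<chi> i. c $ i - r) (\<chi> i. c $ i + r)"
  unfolding ocube_def set_eq_iff mem_box_cart
  by (auto simp: abs_less_iff) (smt (verit))+

lemma open_ocube: "open (ocube c r)" by (simp add: ocube_eq_box open_box)

lemma ocube_subset_cube: "ocube c r \<subseteq> cube c r"
  by (auto simp: ocube_def cube_def intro: less_imp_le)

lemma closed_cube: "closed (cube c r)" using compact_cube by (rule compact_imp_closed)

lemma not_ocube: "x \<in> cube c r \<Longrightarrow> x \<notin> ocube c r \<Longrightarrow> \<exists>i. \<bar>x $ i - c $ i\<bar> = r"
  by (auto simp: ocube_def cube_def not_less intro: order.antisym)

text \<open>On the boundary of the cube \<open>f k\<close> lies strictly between the levels, so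
  composing it with a smooth function that vanishes on \<open>[m, M]\<close> gives a test function.
  These converge in the Sobolev norm because the truncation is Lipschitz and the slopes of its
  smoothings converge off the levels, which \<open>v\<close> attains only on null sets. Here
  \<open>v\<close> is a Borel representative of the given \<open>u\<close>.\<close>

lemma truncation_in_sobolev_11_zero:
  fixes u v :: "real ^ 'n::finite \<Rightarrow> real" and g :: "real ^ 'n \<Rightarrow> real ^ 'n"
  assumes r: "r > 0" and f: "\<And>k j. C_k j (f k)"
    and u: "u \<in> borel_measurable (lebesgue_on (ocube c r))" "AE x in lebesgue_on (ocube c r). u x = v x"
    and v: "integrable lborel v" and g: "integrable lborel g"
    and lim_v: "(\<lambda>k::nat. \<integral>\<^sup>+x\<in>cube c r. ennreal \<bar>f k x - v x\<bar> \<partial>lborel) \<longlonglongrightarrow> 0"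
    and lim_g: "(\<lambda>k. \<integral>\<^sup>+x\<in>cube c r. ennreal (norm (grad (f k) x - g x)) \<partial>lborel) \<longlonglongrightarrow> 0"
    and pw: "AE x in lborel. x \<in> cube c r \<longrightarrow> (\<lambda>k. f k x) \<longlonglongrightarrow> v x"
    and mM: "m \<le> M" and lev: "AE x in lborel. x \<in> cube c r \<longrightarrow> v x \<noteq> m \<and> v x \<noteq> M"
    and bd: "\<And>k x. x \<in> cube c r \<Longrightarrow> x \<notin> ocube c r \<Longrightarrow> m < f k x \<and> f k x < M"
  shows "(\<lambda>x. max (u x - M) 0 - max (m - u x) 0) \<in> sobolev_11_zero (ocube c r)"
proof -
  let ?U = "ocube c r" and ?Q = "cube c r"
  have Us [measurable]: "?U \<in> sets borel" "?U \<in> sets lebesgue" using open_ocube[of c r] by auto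
  have [measurable]: "v \<in> borel_measurable borel" "g \<in> borel_measurable borel" using v g by auto
  have fm [measurable]: "f k \<in> borel_measurable borel" for k
    using C_k_imp_continuous_on[OF f[of 0 k], of UNIV] by (rule borel_measurable_continuous_onI)
  define \<Psi> where "\<Psi> s = max (s - M) 0 - max (m - s) 0" for s
  define d where "d k = 1 / real (Suc k)" for k
  have d: "d k > 0" for k by (simp add: d_def)
  have d0: "d \<longlonglongrightarrow> 0" unfolding d_def by (rule LIMSEQ_Suc[OF lim_1_over_n])
  \<comment> \<open>Both smooth positive parts vanish on \<open>[m, M]\<close>, so
    \<open>P k\<close> keeps the flat piece of \<open>\<Psi>\<close> exactly.\<close>
  define P where "P k s = smooth_plus (d k) (s - M) - smooth_plus (d k) (m - s)" for k s
  define P' where "P' k s = flat_poly (d k) [:1, d k:] (s - M) + flat_poly (d k) [:1, d k:] (m - s)" for k s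
  define \<phi> where "\<phi> k x = (if x \<in> ?U then P k (f k x) else 0)" for k x
  define w where "w x = \<Psi> (v x)" for x
  \<comment> \<open>The chain rule candidate: \<open>\<Psi>\<close> has slope 1 above
    \<open>M\<close> and below \<open>m\<close>, and slope 0 between them.\<close>
  define gw where "gw x = (indicator {M<..} (v x) + indicator {..<m} (v x)) *\<^sub>R g x" for x
  have P_deriv: "(P k has_real_derivative P' k s) (at s)" for k s
    unfolding P_def P'_def
    by (auto intro!: derivative_eq_intros DERIV_chain2[OF smooth_plus_has_derivative[OF d]])
  have P0: "P k s = 0" if "m \<le> s" "s \<le> M" for k s
    using that by (auto simp: P_def smooth_plus_def)
  have P_close: "\<bar>P k s - \<Psi> s\<bar> \<le> 2 * d k" for k s
    using smooth_plus_bounds(1,2)[OF d[of k], of "s - M"] smooth_plus_bounds(1,2)[OF d[of k], of "m - s"]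
    by (auto simp: P_def \<Psi>_def)
  have P'_bd: "0 \<le> P' k s" "P' k s \<le> 2" for k s
    using smooth_plus_bounds(3,4)[OF d[of k], of "s - M"] smooth_plus_bounds(3,4)[OF d[of k], of "m - s"]
    by (auto simp: P'_def)
  have \<Psi>_lip: "\<bar>\<Psi> s - \<Psi> t\<bar> \<le> 2 * \<bar>s - t\<bar>" for s t
    by (auto simp: \<Psi>_def max_def abs_if)
  have CkP: "C_k j (\<lambda>x. P k (f k x))" for j k
    unfolding P_def
    by (intro C_k_diff C_k_compose[OF smooth_real_smooth_plus[OF d]] f C_k_const)
  \<comment> \<open>Such a point is either off the closed cube or on its boundary. In the second
    case \<open>f k\<close> stays between the levels in a whole neighbourhood, where
    \<open>P k\<close> gives 0.\<close>
  have out: "\<exists>V. open V \<and> x \<in> V \<and> (\<forall>y\<in>V. \<phi> k y = 0)" if x: "x \<notin> ?U" for x k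
  proof (cases "x \<in> ?Q")
    case False
    then show ?thesis
      using closed_cube[of c r] ocube_subset_cube[of c r] by (intro exI[of _ "- ?Q"]) (auto simp: \<phi>_def)
  next
    case True
    have "open ((\<lambda>y. f k y) -` {m<..<M})"
      using C_k_imp_continuous_on[OF f[of 0 k], of UNIV] by (intro open_vimage) auto
    then show ?thesis
      using bd[OF True x, of k] by (intro exI[of _ "f k -` {m<..<M}"]) (auto simp: \<phi>_def P0)
  qed
  have \<phi>_tf: "\<phi> k \<in> test_functions ?U" for k
  proof -
    have "C_k j (\<phi> k)" for j
    proof (rule C_k_local)
      fix x
      show "\<exists>V h. open V \<and> x \<in> V \<and> C_k j h \<and> (\<forall>y\<in>V. \<phi> k y = h y)"
      proof (cases "x \<in> ?U")
        case True
        then show ?thesis using open_ocube[of c r] CkP[of j k]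
          by (intro exI[of _ ?U] exI[of _ "\<lambda>x. P k (f k x)"]) (auto simp: \<phi>_def)
      next
        case False
        from out[OF this, of k] show ?thesis using C_k_const[of j 0] by (metis (mono_tags, lifting))
      qed
    qed
    moreover have cl: "closure {x. \<phi> k x \<noteq> 0} \<subseteq> ?U"
    proof
      fix x assume x: "x \<in> closure {x. \<phi> k x \<noteq> 0}"
      show "x \<in> ?U"
      proof (rule ccontr)
        assume "x \<notin> ?U"
        from out[OF this, of k] obtain V where "open V" "x \<in> V" "\<forall>y\<in>V. \<phi> k y = 0" by blast
        with x show False unfolding closure_iff_nhds_not_empty by blast
      qed
    qed
    moreover have "compact (closure {x. \<phi> k x \<noteq> 0})"
    proof -
      have "bounded ?U" using compact_imp_bounded[OF compact_cube] ocube_subset_cube by (rule bounded_subset)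
      then show ?thesis using cl by (meson bounded_subset closed_closure compact_eq_bounded_closed)
    qed
    ultimately show ?thesis unfolding test_functions_def by auto
  qed
  have grad_\<phi>: "grad (\<phi> k) x = P' k (f k x) *\<^sub>R grad (f k) x" if x: "x \<in> ?U" for k x
  proof -
    have "partial i (\<phi> k) x = P' k (f k x) * partial i (f k) x" for i
    proof -
      have fd: "(f k has_derivative frechet_derivative (f k) (at x)) (at x)"
        using f[of "Suc 0" k] by (simp flip: frechet_derivative_works)
      have "((\<lambda>x. P k (f k x)) has_derivative (\<lambda>h. P' k (f k x) * frechet_derivative (f k) (at x) h)) (at x)"
        using has_derivative_compose[OF fd, of "P k" "(*) (P' k (f k x))"] P_deriv[of k "f k x"]
        by (simp add: has_field_derivative_def)
      then have "(\<phi> k has_derivative (\<lambda>h. P' k (f k x) * frechet_derivative (f k) (at x) h)) (at x)"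
        by (rule has_derivative_transform_within_open[OF _ open_ocube x]) (simp add: \<phi>_def)
      from partial_eqI[OF this] show ?thesis by (simp add: partial_def)
    qed
    then show ?thesis by (simp add: grad_def vec_eq_iff)
  qed
  have wint: "integrable (lebesgue_on ?U) w" and gint: "integrable (lebesgue_on ?U) gw"
  proof -
    have intU: "integrable (lebesgue_on ?U) h"
      if h: "h \<in> borel_measurable borel" "integrable lborel H" "\<And>x. x \<in> ?U \<Longrightarrow> norm (h x) \<le> H x"
      for h :: "real ^ 'n \<Rightarrow> 'c::euclidean_space" and H
    proof -
      have "integrable lborel (\<lambda>x. indicator ?U x *\<^sub>R h x)"
      proof (rule Bochner_Integration.integrable_bound[OF h(2)])
        show "(\<lambda>x. indicator ?U x *\<^sub>R h x) \<in> borel_measurable lborel" using h(1) by simp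
        have "norm (indicator ?U x *\<^sub>R h x) \<le> norm (H x)" for x
          using h(3)[of x] by (cases "x \<in> ?U") auto
        then show "AE x in lborel. norm (indicator ?U x *\<^sub>R h x) \<le> norm (H x)" by simp
      qed
      then have "integrable lebesgue (\<lambda>x. indicator ?U x *\<^sub>R h x)"
        using h(1) by (subst integrable_completion) auto
      then show ?thesis by (subst integrable_restrict_space) auto
    qed
    have "integrable lborel (\<lambda>x. \<bar>v x\<bar> + (\<bar>m\<bar> + \<bar>M\<bar>) * indicator ?Q x)"
      using v emeasure_bounded_finite[OF compact_imp_bounded[OF compact_cube[of c r]]]
      by (intro Bochner_Integration.integrable_add integrable_mult_right integrable_real_indicator integrable_abs) auto
    then show "integrable (lebesgue_on ?U) w"
    proof (rule intU[rotated])
      show "w \<in> borel_measurable borel" unfolding w_def \<Psi>_def by measurable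
      fix x assume "x \<in> ?U"
      then have "x \<in> ?Q" using ocube_subset_cube by blast
      then show "norm (w x) \<le> \<bar>v x\<bar> + (\<bar>m\<bar> + \<bar>M\<bar>) * indicator ?Q x"
        by (auto simp: w_def \<Psi>_def max_def abs_if)
    qed
    have "integrable lborel (\<lambda>x. 2 * norm (g x))" using g by simp
    then show "integrable (lebesgue_on ?U) gw"
    proof (rule intU[rotated])
      show "gw \<in> borel_measurable borel" unfolding gw_def by measurable
    qed (auto simp: gw_def indicator_def)
  qed
  have l1: "(\<lambda>k. \<integral>\<^sup>+x. ennreal \<bar>w x - \<phi> k x\<bar> \<partial>lebesgue_on ?U) \<longlonglongrightarrow> 0"
  proof -
    have "(\<lambda>k. 2 * d k * (2 * r) ^ CARD('n)) \<longlonglongrightarrow> 2 * 0 * (2 * r) ^ CARD('n)"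
      by (intro tendsto_intros d0)
    from tendsto_ennrealI[OF this]
    have "(\<lambda>k. ennreal (2 * d k) * emeasure lborel ?Q) \<longlonglongrightarrow> 0"
      using d r by (simp only: emeasure_cube[OF r]) (simp add: ennreal_mult less_imp_le)
    from tendsto_add[OF this ennreal_tendsto_cmult[OF _ lim_v, of "ennreal 2"]]
    have "(\<lambda>k. ennreal (2 * d k) * emeasure lborel ?Q + ennreal 2 * (\<integral>\<^sup>+x\<in>?Q. ennreal \<bar>f k x - v x\<bar> \<partial>lborel)) \<longlonglongrightarrow> 0" by simp
    note t = this
    have "(\<integral>\<^sup>+x. ennreal \<bar>w x - \<phi> k x\<bar> \<partial>lebesgue_on ?U) \<le> ennreal (2 * d k) * emeasure lborel ?Q + ennreal 2 * (\<integral>\<^sup>+x\<in>?Q. ennreal \<bar>f k x - v x\<bar> \<partial>lborel)" for k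
    proof -
      have "(\<integral>\<^sup>+x. ennreal \<bar>w x - \<phi> k x\<bar> \<partial>lebesgue_on ?U) \<le> (\<integral>\<^sup>+x. ennreal (2 * d k) * indicator ?Q x + ennreal 2 * (ennreal \<bar>f k x - v x\<bar> * indicator ?Q x) \<partial>lborel)"
        unfolding lebesgue_on_nn_integral_eq_lborel[OF Us(1)]
      proof (rule nn_integral_mono)
        fix x
        have "ennreal \<bar>w x - \<phi> k x\<bar> \<le> ennreal (2 * d k) + ennreal 2 * ennreal \<bar>f k x - v x\<bar>" if "x \<in> ?U"
        proof -
          have "\<bar>w x - \<phi> k x\<bar> \<le> 2 * d k + 2 * \<bar>f k x - v x\<bar>"
            using that P_close[of k "f k x"] \<Psi>_lip[of "f k x" "v x"] by (simp add: \<phi>_def w_def)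
          from ennreal_leI[OF this] show ?thesis using d[of k] by (simp add: ennreal_plus ennreal_mult less_imp_le)
        qed
        then show "ennreal \<bar>w x - \<phi> k x\<bar> * indicator ?U x \<le> ennreal (2 * d k) * indicator ?Q x + ennreal 2 * (ennreal \<bar>f k x - v x\<bar> * indicator ?Q x)"
          using ocube_subset_cube[of c r] by (auto simp: indicator_def)
      qed
      also have "\<dots> = ennreal (2 * d k) * emeasure lborel ?Q + ennreal 2 * (\<integral>\<^sup>+x\<in>?Q. ennreal \<bar>f k x - v x\<bar> \<partial>lborel)"
        by (subst nn_integral_add) (auto simp: nn_integral_cmult nn_integral_cmult_indicator)
      finally show ?thesis .
    qed
    then show ?thesis
      by (intro tendsto_sandwich[OF always_eventually always_eventually tendsto_const t]) auto
  qed
  have l2: "(\<lambda>k. \<integral>\<^sup>+x. ennreal (norm (gw x - grad (\<phi> k) x)) \<partial>lebesgue_on ?U) \<longlonglongrightarrow> 0"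
  proof -
    define sel where "sel x = (indicator {M<..} (v x) + indicator {..<m} (v x) :: real)" for x
    have [measurable]: "sel \<in> borel_measurable borel" unfolding sel_def by measurable
    have P'm: "continuous_on UNIV (P' k)" for k
    proof -
      have F: "continuous_on UNIV (flat_poly (d k) [:1, d k:])"
        using DERIV_isCont[OF flat_poly_has_derivative[OF d]] by (intro continuous_at_imp_continuous_on) blast
      show ?thesis
        unfolding P'_def
        by (intro continuous_on_add continuous_on_compose2[OF F]) (auto intro: continuous_on_diff)
    qed
    have [measurable]: "P' k \<in> borel_measurable borel" for k using P'm by (rule borel_measurable_continuous_onI)
    \<comment> \<open>Dominated convergence: \<open>sel\<close> and the slopes \<open>P' k\<close>
      lie between 0 and 2, and the slopes converge wherever \<open>f k x\<close> tends to a value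
      \<open>v x\<close> different from both levels.\<close>
    have "(\<lambda>k. \<integral>\<^sup>+x. ennreal (\<bar>sel x - P' k (f k x)\<bar> * norm (g x)) * indicator ?Q x \<partial>lborel) \<longlonglongrightarrow> (\<integral>\<^sup>+(x::real^'n). 0 \<partial>lborel)"
    proof (rule nn_integral_dominated_convergence[where w = "\<lambda>x. ennreal (4 * norm (g x))"])
      show "(\<integral>\<^sup>+x. ennreal (4 * norm (g x)) \<partial>lborel) < \<infinity>"
        using g unfolding integrable_iff_bounded by (simp add: ennreal_mult nn_integral_cmult ennreal_mult_less_top)
      show "AE x in lborel. (\<lambda>k. ennreal (\<bar>sel x - P' k (f k x)\<bar> * norm (g x)) * indicator ?Q x) \<longlonglongrightarrow> 0"
        using pw lev
      proof eventually_elim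
        case (elim x)
        show ?case
        proof (cases "x \<in> ?Q")
          case True
          then have fx: "(\<lambda>k. f k x) \<longlonglongrightarrow> v x" and ne: "v x \<noteq> m" "v x \<noteq> M" using elim by auto
          have "(\<lambda>k. P' k (f k x)) \<longlonglongrightarrow> (if v x - M > 0 then 1 else 0) + (if m - v x > 0 then 1 else 0)"
            unfolding P'_def using ne
            by (intro tendsto_add flat_poly_tendsto_indicator[OF d0] tendsto_intros fx) auto
          also have "(if v x - M > 0 then 1 else 0) + (if m - v x > 0 then 1 else 0) = sel x"
            by (auto simp: sel_def)
          finally have "(\<lambda>k. \<bar>sel x - P' k (f k x)\<bar> * norm (g x)) \<longlonglongrightarrow> \<bar>sel x - sel x\<bar> * norm (g x)"
            by (intro tendsto_intros)
          then have "(\<lambda>k. ennreal (\<bar>sel x - P' k (f k x)\<bar> * norm (g x))) \<longlonglongrightarrow> ennreal (\<bar>sel x - sel x\<bar> * norm (g x))"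
            by (rule tendsto_ennrealI)
          then show ?thesis using True by simp
        qed simp
      qed
      show "AE x in lborel. ennreal (\<bar>sel x - P' k (f k x)\<bar> * norm (g x)) * indicator ?Q x \<le> ennreal (4 * norm (g x))" for k
      proof (rule AE_I2)
        fix x
        have "\<bar>sel x - P' k (f k x)\<bar> \<le> 4"
          using P'_bd[where k = k and s = "f k x"] by (auto simp: sel_def indicator_def)
        then have "\<bar>sel x - P' k (f k x)\<bar> * norm (g x) \<le> 4 * norm (g x)" by (intro mult_right_mono) auto
        then show "ennreal (\<bar>sel x - P' k (f k x)\<bar> * norm (g x)) * indicator ?Q x \<le> ennreal (4 * norm (g x))"
          by (auto simp: indicator_def intro: ennreal_leI)
      qed
    qed auto
    then have "(\<lambda>k. \<integral>\<^sup>+x. ennreal (\<bar>sel x - P' k (f k x)\<bar> * norm (g x)) * indicator ?Q x \<partial>lborel) \<longlonglongrightarrow> 0" by simp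
    from tendsto_add[OF ennreal_tendsto_cmult[OF _ lim_g, of "ennreal 2"] this]
    have t: "(\<lambda>k. ennreal 2 * (\<integral>\<^sup>+x\<in>?Q. ennreal (norm (grad (f k) x - g x)) \<partial>lborel) +
       (\<integral>\<^sup>+x. ennreal (\<bar>sel x - P' k (f k x)\<bar> * norm (g x)) * indicator ?Q x \<partial>lborel)) \<longlonglongrightarrow> 0"
      by simp
    have gm [measurable]: "grad (f k) \<in> borel_measurable borel" for k
    proof -
      have "continuous_on UNIV (grad (f k))"
        unfolding grad_def using f[of "Suc 0" k] by (auto intro!: continuous_on_vec_lambda)
      then show ?thesis by (rule borel_measurable_continuous_onI)
    qed
    have "(\<integral>\<^sup>+x. ennreal (norm (gw x - grad (\<phi> k) x)) \<partial>lebesgue_on ?U) \<le>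
      ennreal 2 * (\<integral>\<^sup>+x\<in>?Q. ennreal (norm (grad (f k) x - g x)) \<partial>lborel) +
       (\<integral>\<^sup>+x. ennreal (\<bar>sel x - P' k (f k x)\<bar> * norm (g x)) * indicator ?Q x \<partial>lborel)" for k
    proof -
      have "(\<integral>\<^sup>+x. ennreal (norm (gw x - grad (\<phi> k) x)) \<partial>lebesgue_on ?U) \<le>
        (\<integral>\<^sup>+x. ennreal 2 * (ennreal (norm (grad (f k) x - g x)) * indicator ?Q x) +
          ennreal (\<bar>sel x - P' k (f k x)\<bar> * norm (g x)) * indicator ?Q x \<partial>lborel)"
        unfolding lebesgue_on_nn_integral_eq_lborel[OF Us(1)]
      proof (rule nn_integral_mono)
        fix x
        have "ennreal (norm (gw x - grad (\<phi> k) x)) \<le> ennreal 2 * ennreal (norm (grad (f k) x - g x)) + ennreal (\<bar>sel x - P' k (f k x)\<bar> * norm (g x))"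
          if x: "x \<in> ?U"
        proof -
          \<comment> \<open>The error splits into the error of the slope times the fixed
            \<open>g\<close>, and the bounded slope times the error of the mollified
            gradient.\<close>
          have "gw x - grad (\<phi> k) x = (sel x - P' k (f k x)) *\<^sub>R g x - P' k (f k x) *\<^sub>R (grad (f k) x - g x)"
            unfolding grad_\<phi>[OF x] gw_def sel_def by (simp add: algebra_simps)
          also have "norm \<dots> \<le> \<bar>sel x - P' k (f k x)\<bar> * norm (g x) + \<bar>P' k (f k x)\<bar> * norm (grad (f k) x - g x)"
            by (rule order_trans[OF norm_triangle_ineq4]) simp
          also have "\<dots> \<le> \<bar>sel x - P' k (f k x)\<bar> * norm (g x) + 2 * norm (grad (f k) x - g x)"
            using P'_bd[where k = k and s = "f k x"] by (intro add_left_mono mult_right_mono) auto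
          finally have "norm (gw x - grad (\<phi> k) x) \<le> \<bar>sel x - P' k (f k x)\<bar> * norm (g x) + 2 * norm (grad (f k) x - g x)" .
          from ennreal_leI[OF this] show ?thesis by (simp add: ennreal_plus ennreal_mult add.commute)
        qed
        then show "ennreal (norm (gw x - grad (\<phi> k) x)) * indicator ?U x \<le> ennreal 2 * (ennreal (norm (grad (f k) x - g x)) * indicator ?Q x) +
          ennreal (\<bar>sel x - P' k (f k x)\<bar> * norm (g x)) * indicator ?Q x"
          using ocube_subset_cube[of c r] by (auto simp: indicator_def)
      qed
      also have "\<dots> = ennreal 2 * (\<integral>\<^sup>+x\<in>?Q. ennreal (norm (grad (f k) x - g x)) \<partial>lborel) +
         (\<integral>\<^sup>+x. ennreal (\<bar>sel x - P' k (f k x)\<bar> * norm (g x)) * indicator ?Q x \<partial>lborel)"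
        by (subst nn_integral_add) (auto simp: nn_integral_cmult)
      finally show ?thesis .
    qed
    then show ?thesis
      by (intro tendsto_sandwich[OF always_eventually always_eventually tendsto_const t]) auto
  qed
  let ?w = "\<lambda>x. max (u x - M) 0 - max (m - u x) 0"
  \<comment> \<open>From here on the conclusions for \<open>v\<close> are carried over to
    \<open>u\<close>, which agrees with it only almost everywhere.\<close>
  have AEw: "AE x in lebesgue_on ?U. ?w x = w x"
    using u(2) by eventually_elim (simp add: w_def \<Psi>_def)
  have mw: "?w \<in> borel_measurable (lebesgue_on ?U)" using u(1) by measurable
  have mw0: "w \<in> borel_measurable (lebesgue_on ?U)" using wint by auto
  have wint': "integrable (lebesgue_on ?U) ?w"
    using integrable_cong_AE[OF mw mw0 AEw] wint by blast
  have l1': "(\<lambda>k. \<integral>\<^sup>+x. ennreal \<bar>?w x - \<phi> k x\<bar> \<partial>lebesgue_on ?U) \<longlonglongrightarrow> 0"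
  proof -
    have "(\<integral>\<^sup>+x. ennreal \<bar>?w x - \<phi> k x\<bar> \<partial>lebesgue_on ?U) = (\<integral>\<^sup>+x. ennreal \<bar>w x - \<phi> k x\<bar> \<partial>lebesgue_on ?U)" for k
      by (rule nn_integral_cong_AE) (use AEw in eventually_elim, simp)
    then show ?thesis using l1 by simp
  qed
  have wg: "weak_gradient ?U ?w gw"
    by (rule weak_gradient_limit[OF open_ocube wint' gint \<phi>_tf l1' l2])
  have mtf: "h \<in> borel_measurable (lebesgue_on ?U)" if "h \<in> borel_measurable borel" for h :: "real ^ 'n \<Rightarrow> 'c::euclidean_space"
    using that by (intro measurable_restrict_space1 measurable_completion) simp
  have gpm: "grad (\<phi> k) \<in> borel_measurable borel" for k
  proof -
    have "continuous_on UNIV (grad (\<phi> k))"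
      unfolding grad_def using test_functionsD(5)[OF test_functions_partial[OF \<phi>_tf]] by (auto intro!: continuous_on_vec_lambda)
    then show ?thesis by (rule borel_measurable_continuous_onI)
  qed
  have "(\<lambda>k. luxemburg_norm ennreal ?U (\<lambda>x. ?w x - \<phi> k x)) \<longlonglongrightarrow> 0"
  proof (rule tendsto_sandwich[OF always_eventually always_eventually tendsto_const l1']; intro allI)
    fix k
    show "luxemburg_norm ennreal ?U (\<lambda>x. ?w x - \<phi> k x) \<le> (\<integral>\<^sup>+x. ennreal \<bar>?w x - \<phi> k x\<bar> \<partial>lebesgue_on ?U)"
      by (rule luxemburg_norm_L1_le[OF borel_measurable_diff[OF mw mtf[OF test_functionsD(6)[OF \<phi>_tf]]]])
  qed simp
  moreover have "(\<lambda>k. luxemburg_norm ennreal ?U (\<lambda>x. norm (gw x - grad (\<phi> k) x))) \<longlonglongrightarrow> 0"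
  proof (rule tendsto_sandwich[OF always_eventually always_eventually tendsto_const l2]; intro allI)
    fix k
    have "(\<lambda>x. norm (gw x - grad (\<phi> k) x)) \<in> borel_measurable (lebesgue_on ?U)"
      using gint mtf[OF gpm[of k]] by auto
    from luxemburg_norm_L1_le[OF this] show "luxemburg_norm ennreal ?U (\<lambda>x. norm (gw x - grad (\<phi> k) x)) \<le> (\<integral>\<^sup>+x. ennreal (norm (gw x - grad (\<phi> k) x)) \<partial>lebesgue_on ?U)"
      by simp
  qed simp
  moreover have "(\<lambda>x. norm (gw x)) \<in> orlicz ennreal ?U" "?w \<in> orlicz ennreal ?U"
    using gint wint' by (auto intro!: orlicz_L1)
  ultimately show ?thesis
    unfolding sobolev_11_zero_def orlicz_sobolev_def using wg \<phi>_tf by blast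
qed

section \<open>Vanishing oscillation\<close>

text \<open>A level set of positive measure is an atom of the distribution of \<open>v\<close> under
  the uniform measure on the cube, and a finite measure has only countably many atoms.\<close>

lemma countable_level_sets:
  fixes v :: "real ^ 'n::finite \<Rightarrow> real"
  assumes [measurable]: "v \<in> borel_measurable borel" and r: "r > 0"
  shows "countable {m. \<not> (AE x in lborel. x \<in> cube c r \<longrightarrow> v x \<noteq> m)}"
proof -
  let ?Q = "cube c r" and ?M = "uniform_measure lborel (cube c r)"
  interpret M: prob_space ?M
    using r by (intro prob_space_uniform_measure) (simp_all add: emeasure_cube[OF r])
  have "finite_measure (distr ?M borel v)"
    using M.prob_space_distr[of v borel] by (simp add: prob_space.finite_measure)
  then have "countable {m. measure (distr ?M borel v) {m} \<noteq> 0}"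
    by (rule finite_measure.countable_support)
  moreover have "AE x in lborel. x \<in> ?Q \<longrightarrow> v x \<noteq> m" if "measure (distr ?M borel v) {m} = 0" for m
  proof -
    have "measure ?M (v -` {m}) = 0"
      using that by (subst (asm) measure_distr) simp_all
    then have "emeasure ?M (v -` {m}) = 0"
      using M.emeasure_eq_measure by simp
    moreover have "v -` {m} \<in> sets borel" by (rule measurable_sets_borel[of v borel]) auto
    ultimately have "emeasure lborel (?Q \<inter> v -` {m}) / emeasure lborel ?Q = 0"
      by (simp add: emeasure_uniform_measure)
    then have "emeasure lborel (?Q \<inter> v -` {m}) = 0"
      by (simp add: ennreal_divide_eq_0_iff emeasure_cube[OF r])
    moreover have "?Q \<inter> v -` {m} \<in> sets lborel" using \<open>v -` {m} \<in> sets borel\<close> by simp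
    ultimately have "?Q \<inter> v -` {m} \<in> null_sets lborel" by (rule null_setsI)
    from AE_not_in[OF this] show ?thesis by eventually_elim auto
  qed
  then have "{m. \<not> (AE x in lborel. x \<in> ?Q \<longrightarrow> v x \<noteq> m)} \<subseteq> {m. measure (distr ?M borel v) {m} \<noteq> 0}"
    by blast
  ultimately show ?thesis by (rule countable_subset[rotated])
qed

lemma ex_between_not_in_countable:
  fixes a b :: real
  assumes "countable C" "a < b"
  shows "\<exists>m. a < m \<and> m < b \<and> m \<notin> C"
proof -
  have "uncountable ({a<..<b} - C)"
    using assms by (intro uncountable_minus_countable) (simp_all add: uncountable_open_interval)
  then have "{a<..<b} - C \<noteq> {}" by force
  then show ?thesis by auto
qed

text \<open>Serves to use the reflected and shifted mollifier as a test function in the weak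
  gradient identity, with the sign that reflection gives to partial derivatives.\<close>

lemma C_k_reflect:
  fixes \<eta> :: "real ^ 'n::finite \<Rightarrow> real"
  assumes "C_k k \<eta>"
  shows "C_k k (\<lambda>y. \<eta> (x - y))"
    and "k \<noteq> 0 \<Longrightarrow> partial i (\<lambda>y. \<eta> (x - y)) = (\<lambda>y. - partial i \<eta> (x - y))"
proof -
  have p: "((\<lambda>y. \<eta> (x - y)) has_derivative (\<lambda>h. - frechet_derivative \<eta> (at (x - y)) h)) (at y)"
    if "C_k (Suc k) \<eta>" for \<eta> :: "real ^ 'n \<Rightarrow> real" and k y
  proof -
    have d: "(\<eta> has_derivative frechet_derivative \<eta> (at (x - y))) (at (x - y))"
      using that by (simp flip: frechet_derivative_works)
    have "((\<lambda>y. x - y) has_derivative (\<lambda>h. - h)) (at y)"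
      by (auto intro!: derivative_eq_intros)
    from has_derivative_compose[OF this d] show ?thesis
      using linear_neg[OF has_derivative_linear[OF d]] by simp
  qed
  have q: "partial i (\<lambda>y. \<eta> (x - y)) = (\<lambda>y. - partial i \<eta> (x - y))"
    if "C_k (Suc k) \<eta>" for \<eta> :: "real ^ 'n \<Rightarrow> real" and k i
    using partial_eqI[OF p[OF that]] by (auto simp: partial_def)
  show "C_k k (\<lambda>y. \<eta> (x - y))"
    using assms
  proof (induction k arbitrary: \<eta>)
    case 0
    then show ?case
      using continuous_on_compose2[of UNIV \<eta> UNIV "\<lambda>y. x - y"] continuous_on_diff[OF continuous_on_const continuous_on_id]
      by auto
  next
    case (Suc k)
    have "C_k k (\<lambda>y. - partial i \<eta> (x - y))" for i
      using C_k_mult[OF C_k_const[of k "-1"] Suc.IH[of "partial i \<eta>"]] Suc.prems by simp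
    moreover have "(\<lambda>y. \<eta> (x - y)) differentiable (at y)" for y
      using p[OF Suc.prems] unfolding differentiable_def by blast
    ultimately show ?case by (simp add: q[OF Suc.prems])
  qed
  show "k \<noteq> 0 \<Longrightarrow> partial i (\<lambda>y. \<eta> (x - y)) = (\<lambda>y. - partial i \<eta> (x - y))"
    using q assms by (cases k) auto
qed

text \<open>The derivative first falls on the kernel; the weak gradient identity, tested with
  \<open>mollifier d (x - y)\<close> as a function of \<open>y\<close>, then moves it onto
  \<open>v\<close>. The bound on \<open>d\<close> keeps the support of this test function inside
  \<open>ocube c R2\<close>.\<close>

lemma grad_conv_mollifier:
  fixes v :: "real ^ 'n::finite \<Rightarrow> real"
  assumes v: "integrable lborel v" and g: "integrable lborel g" and d: "0 < d" "d < R2 - R"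
    and vg: "\<And>\<phi> i. \<phi> \<in> test_functions (ocube c R2) \<Longrightarrow>
      (LINT x|lborel. v x * partial i \<phi> x) = - (LINT x|lborel. g x $ i * \<phi> x)"
    and x: "x \<in> cube c R"
  shows "grad (conv (mollifier d) v) x = conv (mollifier d) g x"
proof -
  let ?\<eta> = "mollifier d :: real ^ 'n \<Rightarrow> real"
  note m = mollifier[OF d(1), where 'n = 'n]
  define \<phi> where "\<phi> y = ?\<eta> (x - y)" for y
  have sub: "closure {y. \<phi> y \<noteq> 0} \<subseteq> cball x d"
  proof (rule closure_minimal)
    show "{y. \<phi> y \<noteq> 0} \<subseteq> cball x d"
      using m(3) by (auto simp: \<phi>_def dist_norm) (meson linear)
  qed simp
  moreover have "cball x d \<subseteq> ocube c R2"
  proof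
    fix y assume "y \<in> cball x d"
    then have "norm (y - x) \<le> d" by (simp add: dist_norm norm_minus_commute)
    then have yx: "\<bar>y $ i - x $ i\<bar> \<le> d" for i using component_le_norm_cart[of "y - x" i] by simp
    have xc: "\<bar>x $ i - c $ i\<bar> \<le> R" for i using x by (simp add: cube_def)
    have "\<bar>y $ i - c $ i\<bar> < R2" for i
      using d(2) yx[of i] xc[of i] abs_triangle_ineq[of "y $ i - x $ i" "x $ i - c $ i"] by (smt (verit))
    then show "y \<in> ocube c R2" by (simp add: ocube_def)
  qed
  moreover have "compact (closure {y. \<phi> y \<noteq> 0})"
    using sub by (meson bounded_cball bounded_subset closed_closure compact_eq_bounded_closed)
  moreover have "C_k k \<phi>" for k
    unfolding \<phi>_def by (rule C_k_reflect(1)[OF test_functionsD(1)[OF m(1)]])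
  ultimately have \<phi>: "\<phi> \<in> test_functions (ocube c R2)" unfolding test_functions_def by blast
  have "partial i (conv ?\<eta> v) x = conv ?\<eta> g x $ i" for i
  proof -
    have "partial i \<phi> = (\<lambda>y. - partial i ?\<eta> (x - y))"
      unfolding \<phi>_def by (rule C_k_reflect(2)[OF test_functionsD(1)[OF m(1), of 1]]) simp
    then have "(LINT y|lborel. v y * (- partial i ?\<eta> (x - y))) = - (LINT y|lborel. g y $ i * ?\<eta> (x - y))"
      using vg[OF \<phi>, of i] by (simp add: \<phi>_def)
    then have "(LINT y|lborel. partial i ?\<eta> (x - y) * v y) = (LINT y|lborel. ?\<eta> (x - y) * g y $ i)"
      by (simp add: mult.commute)
    moreover have "conv ?\<eta> g x $ i = (LINT y|lborel. (?\<eta> (x - y) *\<^sub>R g y) $ i)"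
      unfolding conv_def by (rule integral_bounded_linear[OF bounded_linear_vec_nth conv_integrable_test[OF m(1) g], symmetric])
    ultimately show ?thesis by (simp add: partial_conv[OF m(1) v] conv_def)
  qed
  then show ?thesis by (simp add: grad_def vec_eq_iff)
qed

section \<open>The contradiction with the divergent integral\<close>

context real_young
begin

text \<open>Here \<open>v\<close> and \<open>g\<close> are integrable on the whole space, so that
  convolutions make sense everywhere, and represent \<open>u\<close> and its weak gradient near the
  cube. If no radius worked, the limit inferior of the shell energies would be at least
  \<open>(2 * r) ^ (CARD('n) - 1) * a (\<kappa> / r)\<close> for every small \<open>r\<close>,
  although its integral over the radii is finite.\<close>

lemma small_oscillation:
  fixes u v :: "real ^ 'n::finite \<Rightarrow> real" and g :: "real ^ 'n \<Rightarrow> real ^ 'n"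
  assumes card: "CARD('n) \<ge> 2" and R: "0 < R" "R < R2" and \<epsilon>: "\<epsilon> > 0"
    and growth: "CARD('n) = 2 \<or> CARD('n) \<ge> 2 \<and> (\<exists>q \<kappa>. q > real CARD('n) - 1 \<and> 0 < \<kappa> \<and> \<kappa> \<le> 1 \<and>
      (\<forall>t\<ge>t0. \<forall>\<mu>\<ge>1. \<kappa> * \<mu> powr q * a t \<le> a (\<mu> * t)))"
    and nontrivial: "t1 > 0" "a t1 > 0"
    and diverge: "\<And>\<kappa> R. 0 < \<kappa> \<Longrightarrow> 0 < R \<Longrightarrow> (\<integral>\<^sup>+r\<in>{0<..<R}. ennreal ((2 * r) ^ (CARD('n) - 1) * a (\<kappa> / r)) \<partial>lborel) = \<infinity>"
    and v: "integrable lborel v" and g: "integrable lborel g"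
    and vg: "\<And>\<phi> i. \<phi> \<in> test_functions (ocube c R2) \<Longrightarrow>
      (LINT x|lborel. v x * partial i \<phi> x) = - (LINT x|lborel. g x $ i * \<phi> x)"
    and energy: "(\<integral>\<^sup>+x. ennreal (a (norm (g x))) \<partial>lborel) < \<infinity>"
    and u: "\<And>r. 0 < r \<Longrightarrow> r < R \<Longrightarrow> u \<in> borel_measurable (lebesgue_on (ocube c r))"
      "\<And>r. 0 < r \<Longrightarrow> r < R \<Longrightarrow> AE x in lebesgue_on (ocube c r). u x = v x"
    and monotone: "\<And>r m M. 0 < r \<Longrightarrow> r < R \<Longrightarrow> m \<le> M \<Longrightarrow>
      (\<lambda>x. max (u x - M) 0 - max (m - u x) 0) \<in> sobolev_11_zero (ocube c r) \<Longrightarrow>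
      (AE x in lebesgue_on (ocube c r). m \<le> u x \<and> u x \<le> M)"
  shows "\<exists>r m M. 0 < r \<and> r < R \<and> M - m \<le> \<epsilon> \<and> (AE x in lebesgue_on (ocube c r). m \<le> u x \<and> u x \<le> M)"
proof (rule ccontr)
  assume neg: "\<not> ?thesis"
  have [measurable]: "v \<in> borel_measurable borel" "g \<in> borel_measurable borel" using v g by auto
  \<comment> \<open>The offset 2 keeps the radius of the kernel below \<open>R2 - R\<close> already
    for \<open>k = 0\<close>, as \<open>grad_conv_mollifier\<close> requires.\<close>
  define d where "d k = (R2 - R) / real (k + 2)" for k
  have d: "d k > 0" "d k < R2 - R" for k
  proof -
    have "(R2 - R) * 1 < (R2 - R) * real (k + 2)" using R by (intro mult_strict_left_mono) auto
    then show "d k < R2 - R" unfolding d_def by (subst pos_divide_less_eq) auto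
  qed (use R in \<open>simp add: d_def\<close>)
  have d0: "d \<longlonglongrightarrow> 0" unfolding d_def by (rule LIMSEQ_ignore_initial_segment[OF lim_const_over_n])
  note m = mollifier[OF d(1), where 'n = 'n]
  note int_conv = nn_integral_conv_diff_tendsto_0[OF v d(1) d0 sets_cube, of c R]
  have fin: "emeasure lborel (cube c R) < \<infinity>" by (simp add: emeasure_cube[OF R(1)])
  have cm [measurable]: "conv (mollifier (d k)) v \<in> borel_measurable borel" for k
    using test_functionsD(6)[OF m(1)] by (intro borel_measurable_conv) auto
  \<comment> \<open>Convergence of \<open>w\<close> to 0 in L1 gives a subsequence \<open>s\<close>
    that converges almost everywhere, which the slopes of the truncations need; \<open>f\<close> is
    the mollification along \<open>s\<close>.\<close>
  define w where "w k x = indicator (cube c R) x *\<^sub>R (conv (mollifier (d k)) v x - v x)" for k x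
  have wn: "(\<integral>\<^sup>+x. ennreal (norm (w k x)) \<partial>lborel) = (\<integral>\<^sup>+x\<in>cube c R. ennreal (norm (conv (mollifier (d k)) v x - v x)) \<partial>lborel)" for k
    by (intro nn_integral_cong) (simp add: w_def indicator_def)
  obtain s where s: "strict_mono s" "AE x in lborel. (\<lambda>k. w (s k) x) \<longlonglongrightarrow> 0"
  proof -
    have l: "(\<lambda>k. \<integral>\<^sup>+x. ennreal (norm (w k x)) \<partial>lborel) \<longlonglongrightarrow> 0"
      using int_conv[OF fin] by (simp only: wn)
    have l1: "(\<integral>\<^sup>+x. ennreal (norm (conv (mollifier (d k)) v x)) \<partial>lborel) < \<infinity>" for k
    proof -
      have "(\<integral>\<^sup>+x. ennreal (norm (conv (mollifier (d k)) v x)) \<partial>lborel) \<le>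
        (\<integral>\<^sup>+x. (\<integral>\<^sup>+y. ennreal (mollifier (d k) (x - y)) * ennreal (norm (v y)) \<partial>lborel) \<partial>lborel)"
        by (intro nn_integral_mono norm_conv_le[OF m(1,2) v])
      also have "\<dots> = (\<integral>\<^sup>+y. ennreal (norm (v y)) \<partial>lborel)"
        using test_functionsD(6)[OF m(1)] by (intro nn_integral_conv m(4)) auto
      also have "\<dots> < \<infinity>" using v unfolding integrable_iff_bounded by simp
      finally show ?thesis .
    qed
    have "integrable lborel (conv (mollifier (d k)) v)" for k
      using l1[of k] by (intro integrableI_bounded) auto
    then have wi: "integrable lborel (w k)" for k
      unfolding w_def using v by (intro integrable_mult_indicator Bochner_Integration.integrable_diff) auto
    have "(\<integral>\<^sup>+x. ennreal (norm (w k x)) \<partial>lborel) = ennreal (LINT x|lborel. norm (w k x))" for k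
      using wi[of k] by (intro nn_integral_eq_integral) auto
    then have "(\<lambda>k. ennreal (LINT x|lborel. norm (w k x))) \<longlonglongrightarrow> ennreal 0" using l by simp
    then have "(\<lambda>k. LINT x|lborel. norm (w k x)) \<longlonglongrightarrow> 0"
      by (subst (asm) tendsto_ennreal_iff) auto
    from tendsto_L1_AE_subseq[OF wi this] that show thesis by blast
  qed
  define f where "f k = conv (mollifier (d (s k))) v" for k
  have ds: "(\<lambda>k. d (s k)) \<longlonglongrightarrow> 0"
    using LIMSEQ_subseq_LIMSEQ[OF d0 s(1)] by (simp add: o_def)
  have Cf: "C_k j (f k)" for j k unfolding f_def by (rule C_k_conv[OF m(1) v])
  have gf: "grad (f k) x = conv (mollifier (d (s k))) g x" if "x \<in> cube c R" for k x
    unfolding f_def by (rule grad_conv_mollifier[OF v g d vg that])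
  have [measurable]: "f k \<in> borel_measurable borel" for k unfolding f_def by (rule cm)
  have pw: "AE x in lborel. x \<in> cube c R \<longrightarrow> (\<lambda>k. f k x) \<longlonglongrightarrow> v x"
    using s(2)
  proof eventually_elim
    case (elim x)
    then show ?case by (auto simp: w_def f_def intro: LIM_zero_cancel)
  qed
  have subseq_lim: "(\<lambda>k. \<integral>\<^sup>+x\<in>cube c r. ennreal \<bar>f (\<phi> k) x - v x\<bar> \<partial>lborel) \<longlonglongrightarrow> 0"
    "(\<lambda>k. \<integral>\<^sup>+x\<in>cube c r. ennreal (norm (grad (f (\<phi> k)) x - g x)) \<partial>lborel) \<longlonglongrightarrow> 0"
    if \<phi>: "strict_mono \<phi>" and r: "0 < r" "r < R" for \<phi> :: "nat \<Rightarrow> nat" and r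
  proof -
    have dd: "(\<lambda>k. d (s (\<phi> k))) \<longlonglongrightarrow> 0"
      using LIMSEQ_subseq_LIMSEQ[OF ds \<phi>] by (simp add: o_def)
    have "emeasure lborel (cube c r) < \<infinity>" by (simp add: emeasure_cube[OF r(1)])
    note l = nn_integral_conv_diff_tendsto_0[OF _ d(1) dd sets_cube this]
    show "(\<lambda>k. \<integral>\<^sup>+x\<in>cube c r. ennreal \<bar>f (\<phi> k) x - v x\<bar> \<partial>lborel) \<longlonglongrightarrow> 0"
      using l[OF v] by (simp add: f_def)
    have "x \<in> cube c R" if "x \<in> cube c r" for x
      using that r by (auto simp: cube_def intro: order_trans less_imp_le)
    then have "(\<integral>\<^sup>+x\<in>cube c r. ennreal (norm (grad (f (\<phi> k)) x - g x)) \<partial>lborel) =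
       (\<integral>\<^sup>+x\<in>cube c r. ennreal (norm (conv (mollifier (d (s (\<phi> k)))) g x - g x)) \<partial>lborel)" for k
      by (intro nn_integral_cong) (simp add: gf indicator_def)
    then show "(\<lambda>k. \<integral>\<^sup>+x\<in>cube c r. ennreal (norm (grad (f (\<phi> k)) x - g x)) \<partial>lborel) \<longlonglongrightarrow> 0"
      using l[OF g] by simp
  qed
  define Z where "Z r = liminf (\<lambda>k. shell_energy (f k) c r)" for r
  let ?C1 = "\<integral>\<^sup>+x. ennreal (a (norm (g x))) \<partial>lborel" and ?C2 = "\<integral>\<^sup>+x. ennreal (norm (v x)) \<partial>lborel"
  have "(\<integral>\<^sup>+r\<in>{0<..<R}. Z r \<partial>lborel) \<le> of_nat (2 * CARD('n)) * (?C1 + ?C2)"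
    unfolding Z_def
  proof (rule liminf_shell_energy[OF Cf])
    fix k
    have "(\<integral>\<^sup>+z\<in>cube c R. ennreal (a (norm (grad (f k) z))) \<partial>lborel) \<le> (\<integral>\<^sup>+x. ennreal (a (norm (conv (mollifier (d (s k))) g x))) \<partial>lborel)"
      by (intro nn_integral_mono) (simp add: gf indicator_def)
    also have "\<dots> \<le> ?C1"
      by (rule nn_integral_convex_conv_le[OF g d(1) convex nonneg mono])
    finally show "(\<integral>\<^sup>+z\<in>cube c R. ennreal (a (norm (grad (f k) z))) \<partial>lborel) \<le> ?C1" .
    have "(\<integral>\<^sup>+z\<in>cube c R. ennreal \<bar>f k z\<bar> \<partial>lborel) \<le>
        (\<integral>\<^sup>+x. (\<integral>\<^sup>+y. ennreal (mollifier (d (s k)) (x - y)) * ennreal (norm (v y)) \<partial>lborel) \<partial>lborel)"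
      using norm_conv_le[OF m(1,2) v, of "s k"]
      by (intro nn_integral_mono) (simp add: f_def indicator_def)
    also have "\<dots> = ?C2"
      using test_functionsD(6)[OF m(1)] by (intro nn_integral_conv m(4)) auto
    finally show "(\<integral>\<^sup>+z\<in>cube c R. ennreal \<bar>f k z\<bar> \<partial>lborel) \<le> ?C2" .
  qed
  also have "\<dots> < \<infinity>"
    using energy v unfolding integrable_iff_bounded by (simp add: ennreal_mult_less_top of_nat_less_top)
  finally have Zfin: "(\<integral>\<^sup>+r\<in>{0<..<R}. Z r \<partial>lborel) < \<infinity>" .
  obtain K where K: "K > 0" "\<And>(f :: real ^ 'n \<Rightarrow> real) c r i s T x y. C_k (Suc 0) f \<Longrightarrow> r > 0 \<Longrightarrow> T \<ge> t0 \<Longrightarrow> T > 0 \<Longrightarrow> a T > 0 \<Longrightarrow>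
    face_energy f c r i s \<le> ennreal ((2 * r) ^ CARD('n) * a T) \<Longrightarrow> x \<in> cube c r \<Longrightarrow> y \<in> cube c r \<Longrightarrow>
    \<bar>f (upd i s x) - f (upd i s y)\<bar> \<le> K * r * T"
    using face_oscillation[OF growth] by blast
  \<comment> \<open>For \<open>T = \<kappa> / r\<close> one face oscillates by at most
    \<open>\<epsilon> / 24\<close> and the boundary by \<open>\<epsilon> / 8\<close>. Another
    \<open>\<epsilon> / 8\<close> pays for passing to the limit \<open>m0\<close>, and levels at
    distance between \<open>\<epsilon> / 4\<close> and \<open>\<epsilon> / 2\<close> from
    \<open>m0\<close> differ by less than \<open>\<epsilon>\<close>.\<close>
  define \<kappa> where "\<kappa> = \<epsilon> / (24 * K)"
  have \<kappa>: "\<kappa> > 0" using \<epsilon> K(1) by (simp add: \<kappa>_def)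
  define t2 where "t2 = max t0 t1"
  have t2: "t2 > 0" using nontrivial by (simp add: t2_def)
  \<comment> \<open>For \<open>r < R1\<close> the level \<open>\<kappa> / r\<close> is at least
    \<open>t0\<close>, where the face estimate applies, and at least \<open>t1\<close>, where
    \<open>a\<close> is positive.\<close>
  define R1 where "R1 = min R (\<kappa> / t2)"
  have R1: "R1 > 0" "R1 \<le> R" using R \<kappa> t2 by (auto simp: R1_def)
  have lower: "ennreal ((2 * r) ^ (CARD('n) - 1) * a (\<kappa> / r)) \<le> Z r" if r: "0 < r" "r < R1" for r
  proof (rule ccontr)
    assume "\<not> ?thesis"
    then have less: "liminf (\<lambda>k. shell_energy (f k) c r) < ennreal ((2 * r) ^ (CARD('n) - 1) * a (\<kappa> / r))"
      by (simp add: Z_def)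
    let ?T = "\<kappa> / r"
    have rR: "r < R" using r R1 by simp
    have "r * t2 \<le> \<kappa>" using r t2 by (simp add: R1_def pos_less_divide_eq)
    then have "t2 \<le> ?T" using r by (simp add: pos_le_divide_eq mult.commute)
    then have T: "?T \<ge> t0" "?T > 0" "?T \<ge> t1" using t2 by (auto simp: t2_def)
    then have aT: "a ?T > 0" using monoD[OF mono T(3)] nontrivial by simp
    have KrT: "K * r * ?T = \<epsilon> / 24" using r K(1) by (simp add: \<kappa>_def)
    obtain \<phi> :: "nat \<Rightarrow> nat" and m0 where \<phi>: "strict_mono \<phi>"
      and ev: "\<And>\<delta>. \<delta> > 0 \<Longrightarrow> eventually (\<lambda>k. \<forall>x\<in>cube c r. (\<exists>i. \<bar>x $ i - c $ i\<bar> = r) \<longrightarrow> \<bar>f (\<phi> k) x - m0\<bar> < 3 * K * r * ?T + \<delta>) sequentially"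
      by (rule boundary_values_subsequence[OF card Cf r(1) aT _ K(2)[OF _ r(1) T(1,2) aT] less])
        (use KrT \<epsilon> in auto)
    \<comment> \<open>Both levels are picked outside this countable set, in the gaps left between
      the boundary values and distance \<open>\<epsilon> / 2\<close> from \<open>m0\<close>.\<close>
    define C where "C = {m. \<not> (AE x in lborel. x \<in> cube c r \<longrightarrow> v x \<noteq> m)}"
    have C: "countable C" unfolding C_def by (rule countable_level_sets[OF _ r(1)]) simp
    obtain M where M: "m0 + \<epsilon> / 4 < M" "M < m0 + \<epsilon> / 2" "M \<notin> C"
      using ex_between_not_in_countable[OF C, of "m0 + \<epsilon> / 4" "m0 + \<epsilon> / 2"] \<epsilon> by auto
    obtain m where m: "m0 - \<epsilon> / 2 < m" "m < m0 - \<epsilon> / 4" "m \<notin> C"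
      using ex_between_not_in_countable[OF C, of "m0 - \<epsilon> / 2" "m0 - \<epsilon> / 4"] \<epsilon> by auto
    have e8: "3 * K * r * ?T + \<epsilon> / 8 = \<epsilon> / 4" using KrT r by simp
    obtain N where N: "\<And>k x. k \<ge> N \<Longrightarrow> x \<in> cube c r \<Longrightarrow> \<exists>i. \<bar>x $ i - c $ i\<bar> = r \<Longrightarrow> \<bar>f (\<phi> k) x - m0\<bar> < \<epsilon> / 4"
      using ev[of "\<epsilon> / 8", unfolded e8 eventually_sequentially] \<epsilon> by auto
    \<comment> \<open>Dropping the first \<open>N\<close> terms makes the boundary bound valid for
      every index.\<close>
    define \<psi> where "\<psi> k = \<phi> (k + N)" for k
    have \<psi>: "strict_mono \<psi>" using \<phi> by (simp add: \<psi>_def strict_mono_def)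
    have crR: "x \<in> cube c R" if "x \<in> cube c r" for x
      using that rR by (auto simp: cube_def intro: order_trans less_imp_le)
    have "(\<lambda>x. max (u x - M) 0 - max (m - u x) 0) \<in> sobolev_11_zero (ocube c r)"
    proof (rule truncation_in_sobolev_11_zero[OF r(1) Cf u(1)[OF r(1) rR] u(2)[OF r(1) rR] v g subseq_lim[OF \<psi> r(1) rR]])
      show "AE x in lborel. x \<in> cube c r \<longrightarrow> (\<lambda>k. f (\<psi> k) x) \<longlonglongrightarrow> v x"
        using pw
      proof eventually_elim
        case (elim x)
        show ?case
          using elim crR[of x] LIMSEQ_subseq_LIMSEQ[OF _ \<psi>, of "\<lambda>k. f k x"] by (auto simp: o_def)
      qed
      show "m \<le> M" using m M \<epsilon> by linarith
      have "AE x in lborel. x \<in> cube c r \<longrightarrow> v x \<noteq> m" "AE x in lborel. x \<in> cube c r \<longrightarrow> v x \<noteq> M"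
        using m(3) M(3) by (auto simp: C_def)
      then show "AE x in lborel. x \<in> cube c r \<longrightarrow> v x \<noteq> m \<and> v x \<noteq> M"
        by eventually_elim auto
      fix k x assume x: "x \<in> cube c r" "x \<notin> ocube c r"
      then have "\<bar>f (\<psi> k) x - m0\<bar> < \<epsilon> / 4"
        unfolding \<psi>_def by (intro N not_ocube) auto
      then show "m < f (\<psi> k) x \<and> f (\<psi> k) x < M" using m(2) M(1) by linarith
    qed
    then have "AE x in lebesgue_on (ocube c r). m \<le> u x \<and> u x \<le> M"
      using m M \<epsilon> by (intro monotone[OF r(1) rR]) auto
    moreover have "M - m \<le> \<epsilon>" using m M by linarith
    ultimately show False using neg r(1) rR by blast
  qed
  have "(\<integral>\<^sup>+r\<in>{0<..<R1}. ennreal ((2 * r) ^ (CARD('n) - 1) * a (\<kappa> / r)) \<partial>lborel) \<le> (\<integral>\<^sup>+r\<in>{0<..<R}. Z r \<partial>lborel)"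
  proof (rule nn_integral_mono)
    fix r
    show "ennreal ((2 * r) ^ (CARD('n) - 1) * a (\<kappa> / r)) * indicator {0<..<R1} r \<le> Z r * indicator {0<..<R} r"
      using lower[of r] R1 by (auto simp: indicator_def)
  qed
  then show False using diverge[OF \<kappa> R1(1)] Zfin by simp
qed

end

section \<open>Young functions and the lower Boyd index\<close>

context real_young
begin

text \<open>Iterating the ratio \<open>k = \<lfloor>ln \<mu> / ln l\<rfloor>\<close> times stays
  below \<open>\<mu>\<close> and gains \<open>b ^ k\<close>. Since \<open>\<mu>\<close> is below
  \<open>l ^ (k + 1)\<close>, its power with exponent \<open>ln b / ln l\<close> is at most
  \<open>b ^ (k + 1)\<close>; the loss \<open>1 / b\<close> is this rounding.\<close>

lemma growth_of_ratio:
  assumes l: "l > 1" and b: "b \<ge> 1" and ratio: "\<And>t. t \<ge> t3 \<Longrightarrow> b * a t \<le> a (l * t)" and t3: "t3 > 0"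
    and t: "t \<ge> t3" and \<mu>: "\<mu> \<ge> 1"
  shows "1 / b * \<mu> powr (ln b / ln l) * a t \<le> a (\<mu> * t)"
proof -
  define k where "k = nat \<lfloor>ln \<mu> / ln l\<rfloor>"
  have k: "real k \<le> ln \<mu> / ln l" "ln \<mu> / ln l < real k + 1"
    using l \<mu> by (auto simp: k_def)
  have lk: "l ^ k \<le> \<mu>"
  proof -
    have "l ^ k = exp (real k * ln l)" using l by (simp add: exp_of_nat_mult)
    also have "\<dots> \<le> exp (ln \<mu>)" using k(1) l by (simp add: field_simps)
    finally show ?thesis using \<mu> by simp
  qed
  have it: "b ^ j * a t \<le> a (l ^ j * t)" for j
  proof (induction j)
    case (Suc j)
    have "t3 \<le> l ^ j * t"
      using l t t3 mult_mono[of 1 "l ^ j" t3 t] by simp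
    have "b ^ Suc j * a t = b * (b ^ j * a t)" by simp
    also have "\<dots> \<le> b * a (l ^ j * t)" using Suc b by (intro mult_left_mono) auto
    also have "\<dots> \<le> a (l * (l ^ j * t))" using \<open>t3 \<le> l ^ j * t\<close> by (rule ratio)
    finally show ?case by (simp add: mult.assoc)
  qed simp
  have "\<mu> powr (ln b / ln l) = exp (ln b * (ln \<mu> / ln l))"
    using \<mu> by (simp add: powr_def mult.commute)
  also have "\<dots> \<le> exp (ln b * (real k + 1))"
    using k(2) b by (intro exp_le_cancel_iff[THEN iffD2] mult_left_mono) auto
  also have "\<dots> = exp (real (Suc k) * ln b)" by (simp add: mult.commute add.commute)
  also have "\<dots> = b ^ Suc k" using b by (simp only: exp_of_nat_mult) simp
  finally have "1 / b * \<mu> powr (ln b / ln l) \<le> 1 / b * b ^ Suc k"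
    using b by (intro mult_left_mono) auto
  also have "\<dots> = b ^ k" using b by simp
  finally have "1 / b * \<mu> powr (ln b / ln l) * a t \<le> b ^ k * a t"
    by (intro mult_right_mono nonneg)
  also have "\<dots> \<le> a (l ^ k * t)" by (rule it)
  also have "\<dots> \<le> a (\<mu> * t)" using lk t t3 by (intro monoD[OF mono] mult_right_mono) auto
  finally show ?thesis .
qed

text \<open>The substitution \<open>r = \<kappa> / t\<close> turns
  \<open>r ^ N * a (\<kappa> / r)\<close> into
  \<open>\<kappa> ^ (N + 1) * a t / t ^ (N + 2)\<close>. It is carried out on compact intervals,
  followed by monotone convergence. With \<open>N = n - 1\<close> the exponent is
  \<open>n + 1\<close>.\<close>

lemma radial_integral_infinite:
  assumes inf: "\<And>b. b > 0 \<Longrightarrow> (\<integral>\<^sup>+t\<in>{b..}. ennreal (a t / t ^ (N + 2)) \<partial>lborel) = \<infinity>"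
    and \<kappa>: "\<kappa> > 0" and R: "R > 0"
  shows "(\<integral>\<^sup>+r\<in>{0<..<R}. ennreal ((2 * r) ^ N * a (\<kappa> / r)) \<partial>lborel) = \<infinity>" (is "?I = _")
proof -
  \<comment> \<open>Makes \<open>\<kappa> / b = R / 2\<close>, so that all \<open>t \<ge> b\<close>
    correspond to radii inside the interval.\<close>
  define b where "b = 2 * \<kappa> / R"
  have b: "b > 0" "\<kappa> / b < R" using \<kappa> R by (auto simp: b_def field_simps)
  \<comment> \<open>Written in the variable \<open>- r\<close>, because the substitution rule asks
    for a map with nonnegative derivative and \<open>t \<mapsto> - \<kappa> / t\<close> is
    increasing. A reflection undoes the sign at the end.\<close>
  define f where "f x = (- x) ^ N * a (\<kappa> / (- x))" for x
  have [measurable]: "f \<in> borel_measurable borel" unfolding f_def by measurable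
  have fin: "(\<integral>\<^sup>+t. ennreal (\<kappa> ^ (N + 1)) * (ennreal (a t / t ^ (N + 2)) * indicator {b..B} t) \<partial>lborel) \<le> ?I" if B: "B \<ge> b" for B
  proof -
    have "(\<integral>\<^sup>+t. ennreal (\<kappa> ^ (N + 1)) * (ennreal (a t / t ^ (N + 2)) * indicator {b..B} t) \<partial>lborel) =
      (\<integral>\<^sup>+t. f (- \<kappa> / t) * (\<kappa> / t\<^sup>2) * indicator {b..B} t \<partial>lborel)"
    proof (rule nn_integral_cong)
      fix t :: real
      have "f (- \<kappa> / t) * (\<kappa> / t\<^sup>2) = \<kappa> ^ (N + 1) * (a t / t ^ (N + 2))" if "t \<in> {b..B}"
        using that b(1) \<kappa> by (simp add: f_def power_divide power2_eq_square field_simps)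
      then show "ennreal (\<kappa> ^ (N + 1)) * (ennreal (a t / t ^ (N + 2)) * indicator {b..B} t) = ennreal (f (- \<kappa> / t) * (\<kappa> / t\<^sup>2) * indicator {b..B} t)"
        using \<kappa> b(1) nonneg[of t] by (auto simp: indicator_def simp flip: ennreal_mult)
    qed
    also have "\<dots> = (\<integral>\<^sup>+x. f x * indicator {- \<kappa> / b..- \<kappa> / B} x \<partial>lborel)"
    proof (rule nn_integral_substitution[symmetric])
      show "set_borel_measurable borel {- \<kappa> / b..- \<kappa> / B} f"
        unfolding set_borel_measurable_def by measurable
      show "((\<lambda>t. - \<kappa> / t) has_real_derivative \<kappa> / t\<^sup>2) (at t)" if "t \<in> {b..B}" for t
        using that b(1) by (auto intro!: derivative_eq_intros simp: power2_eq_square)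
      show "continuous_on {b..B} (\<lambda>t. \<kappa> / t\<^sup>2)"
        using b(1) by (intro continuous_intros) auto
    qed (use B \<kappa> in auto)
    also have "\<dots> = (\<integral>\<^sup>+x. ennreal (f (0 - x) * indicator {- \<kappa> / b..- \<kappa> / B} (0 - x)) \<partial>lborel)"
      by (rule nn_integral_lborel_reflect[symmetric]) measurable
    also have "\<dots> \<le> ?I"
    proof (rule nn_integral_mono)
      fix x :: real
      show "ennreal (f (0 - x) * indicator {- \<kappa> / b..- \<kappa> / B} (0 - x)) \<le> ennreal ((2 * x) ^ N * a (\<kappa> / x)) * indicator {0<..<R} x"
      proof (cases "0 - x \<in> {- \<kappa> / b..- \<kappa> / B}")
        case True
        then have x: "\<kappa> / B \<le> x" "x \<le> \<kappa> / b" by auto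
        moreover have "\<kappa> / B > 0" using B b \<kappa> by simp
        ultimately have "0 < x" "x < R" using b(2) by linarith+
        moreover have "x ^ N * a (\<kappa> / x) \<le> (2 * x) ^ N * a (\<kappa> / x)"
          using \<open>0 < x\<close> by (intro mult_right_mono power_mono nonneg) auto
        ultimately show ?thesis using True by (simp add: f_def ennreal_leI)
      qed simp
    qed
    finally show ?thesis .
  qed
  define F where "F j t = ennreal (\<kappa> ^ (N + 1)) * (ennreal (a t / t ^ (N + 2)) * indicator {b..b + real j} t)" for j t
  have "(SUP j. F j t) = ennreal (\<kappa> ^ (N + 1)) * (ennreal (a t / t ^ (N + 2)) * indicator {b..} t)" for t
  proof (rule antisym)
    show "(SUP j. F j t) \<le> ennreal (\<kappa> ^ (N + 1)) * (ennreal (a t / t ^ (N + 2)) * indicator {b..} t)"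
      by (intro SUP_least) (auto simp: F_def indicator_def)
    obtain j where "t - b \<le> real j" using real_arch_simple by blast
    then have "ennreal (\<kappa> ^ (N + 1)) * (ennreal (a t / t ^ (N + 2)) * indicator {b..} t) \<le> F j t"
      by (auto simp: F_def indicator_def)
    then show "ennreal (\<kappa> ^ (N + 1)) * (ennreal (a t / t ^ (N + 2)) * indicator {b..} t) \<le> (SUP j. F j t)"
      by (rule order_trans) (rule SUP_upper, simp)
  qed
  then have "ennreal (\<kappa> ^ (N + 1)) * (\<integral>\<^sup>+t\<in>{b..}. ennreal (a t / t ^ (N + 2)) \<partial>lborel) = (\<integral>\<^sup>+t. (SUP j. F j t) \<partial>lborel)"
    by (simp add: nn_integral_cmult)
  also have "\<dots> = (SUP j. \<integral>\<^sup>+t. F j t \<partial>lborel)"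
  proof (rule nn_integral_monotone_convergence_SUP)
    show "incseq F"
      by (auto simp: incseq_def le_fun_def F_def indicator_def)
    show "F j \<in> borel_measurable lborel" for j unfolding F_def by measurable
  qed
  also have "\<dots> \<le> ?I"
    unfolding F_def by (intro SUP_least fin) simp
  finally show ?thesis
    using inf[OF b(1)] \<kappa> by (simp add: ennreal_mult_top top_unique)
qed

end

section \<open>From Young functions to real convex functions\<close>

lemma young_function_convex:
  assumes "young_function A" "0 \<le> s" "0 \<le> t" "0 \<le> \<theta>" "\<theta> \<le> 1"
  shows "A (\<theta> * s + (1 - \<theta>) * t) \<le> ennreal \<theta> * A s + ennreal (1 - \<theta>) * A t"
proof -
  have "\<theta> \<in> {0..1}" using assms by simp
  then show ?thesis using assms(1-3) unfolding young_function_def by blast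
qed

lemma finite_valued_less_top: "finite_valued A \<Longrightarrow> 0 \<le> t \<Longrightarrow> A t < top"
  by (simp add: finite_valued_def)

lemma young_function_mono:
  assumes A: "young_function A" and st: "0 \<le> s" "s \<le> t"
  shows "A s \<le> A t"
proof (cases "t = 0")
  case False
  then have t: "t > 0" using st by simp
  have "A (s / t * t + (1 - s / t) * 0) \<le> ennreal (s / t) * A t + ennreal (1 - s / t) * A 0"
    using st t by (intro young_function_convex[OF A]) auto
  then have "A s \<le> ennreal (s / t) * A t" using A t by (simp add: young_function_def)
  also have "\<dots> \<le> 1 * A t" using st t by (intro mult_right_mono) auto
  finally show ?thesis by simp
qed (use st in simp)

text \<open>The scale \<open>l\<close> will be a constant admissible in the Luxemburg norm, so that
  the modular of the gradient becomes a plain integral of this function; \<open>max\<close> extends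
  it by \<open>A 0\<close> to negative arguments.\<close>

definition young_real :: "(real \<Rightarrow> ennreal) \<Rightarrow> real \<Rightarrow> real \<Rightarrow> real" where
  "young_real A l t = enn2real (A (max t 0 / l))"

lemma ennreal_young_real:
  assumes "finite_valued A" "l > 0" "t \<ge> 0"
  shows "ennreal (young_real A l t) = A (t / l)"
  using assms by (simp add: young_real_def finite_valued_def)

lemma real_young_young_real:
  assumes A: "young_function A" "finite_valued A" and l: "l > 0"
  shows "real_young (young_real A l)"
proof
  have mono: "young_real A l s \<le> young_real A l t" if "s \<le> t" for s t
  proof -
    have "A (max s 0 / l) \<le> A (max t 0 / l)"
      using that l by (intro young_function_mono[OF A(1)] divide_right_mono) auto
    then show ?thesis
      using A(2) l unfolding young_real_def finite_valued_def by (intro enn2real_mono) auto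
  qed
  then show "mono (young_real A l)" by (rule monoI)
  show "young_real A l 0 = 0" using A(1) by (simp add: young_real_def young_function_def)
  show nn': "young_real A l t \<ge> 0" for t by (simp add: young_real_def)
  show "convex_on UNIV (young_real A l)"
  proof (rule convex_onI)
    fix \<theta> x y :: real assume \<theta>: "0 < \<theta>" "\<theta> < 1"
    let ?x = "max x 0" and ?y = "max y 0"
    \<comment> \<open>Clamping at 0 only increases the argument, so monotonicity reduces convexity
      on the line to that of \<open>A\<close> on the nonnegative axis.\<close>
    have "(1 - \<theta>) * x + \<theta> * y \<le> (1 - \<theta>) * ?x + \<theta> * ?y"
      using \<theta> by (intro add_mono mult_left_mono) auto
    then have "young_real A l ((1 - \<theta>) *\<^sub>R x + \<theta> *\<^sub>R y) \<le> young_real A l ((1 - \<theta>) * ?x + \<theta> * ?y)"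
      by (intro mono) simp
    also have "\<dots> \<le> (1 - \<theta>) * young_real A l x + \<theta> * young_real A l y"
    proof -
      have nn: "0 \<le> (1 - \<theta>) * ?x + \<theta> * ?y" using \<theta> by simp
      have "ennreal (young_real A l ((1 - \<theta>) * ?x + \<theta> * ?y)) = A ((1 - \<theta>) * (?x / l) + (1 - (1 - \<theta>)) * (?y / l))"
        unfolding ennreal_young_real[OF A(2) l nn] by (simp add: add_divide_distrib)
      also have "\<dots> \<le> ennreal (1 - \<theta>) * A (?x / l) + ennreal (1 - (1 - \<theta>)) * A (?y / l)"
        using l \<theta> by (intro young_function_convex[OF A(1)]) auto
      also have "\<dots> = ennreal (1 - \<theta>) * ennreal (young_real A l x) + ennreal \<theta> * ennreal (young_real A l y)"
        using ennreal_young_real[OF A(2) l, of ?x] ennreal_young_real[OF A(2) l, of ?y] by (simp add: young_real_def)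
      also have "\<dots> = ennreal ((1 - \<theta>) * young_real A l x + \<theta> * young_real A l y)"
        using \<theta> nn' by (simp flip: ennreal_mult ennreal_plus)
      finally show ?thesis
        by (rule ennreal_le_iff[THEN iffD1, rotated]) (use \<theta> nn' in auto)
    qed
    finally show "young_real A l ((1 - \<theta>) *\<^sub>R x + \<theta> *\<^sub>R y) \<le> (1 - \<theta>) * young_real A l x + \<theta> * young_real A l y" .
  qed simp
qed

lemma young_function_positive:
  assumes "young_function A"
  obtains t where "t > 0" "A t > 0"
proof (rule ccontr)
  assume "\<not> thesis"
  then have "\<forall>t\<in>{0<..}. A t = 0" using that by (metis greaterThan_iff not_gr_zero)
  then have "A constant_on {0<..}" unfolding constant_on_def by blast
  then show False using assms by (simp add: young_function_def)
qed

section \<open>The lower Boyd index as a supremum\<close>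

definition ratio_liminf :: "(real \<Rightarrow> ennreal) \<Rightarrow> real \<Rightarrow> ennreal" where
  "ratio_liminf A l = Liminf at_top (\<lambda>t::real. A (l * t) / A t)"

lemma ln_ennreal_mono: "x \<le> y \<Longrightarrow> ln_ennreal x \<le> ln_ennreal y"
  unfolding ln_ennreal_def
  by (cases x; cases y) (auto simp: top_unique ennreal_eq_0_iff less_le)

text \<open>Put \<open>z\<close> strictly between \<open>y\<close> and the quotient and let
  \<open>b = l powr z\<close>. Then \<open>A (l * t) / A t\<close> exceeds \<open>b\<close> for all
  large \<open>t\<close>, and \<open>growth_of_ratio\<close> gives the exponent
  \<open>ln b / ln l = z\<close>. From \<open>y \<ge> 0\<close> follows \<open>z > 0\<close>, hence
  \<open>b \<ge> 1\<close>.\<close>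

lemma growth_of_index_quotient:
  assumes A: "young_function A" "finite_valued A" and l: "l > 1" and y: "0 \<le> y"
    and less: "y < ln_ennreal (ratio_liminf A l) / ereal (ln l)"
  obtains q \<kappa> t0 where "y < ereal q" "0 < \<kappa>" "\<kappa> \<le> 1" "t0 > 0" "A t0 > 0"
    "\<And>t \<mu>. t \<ge> t0 \<Longrightarrow> \<mu> \<ge> 1 \<Longrightarrow> \<kappa> * \<mu> powr q * young_real A 1 t \<le> young_real A 1 (\<mu> * t)"
proof -
  obtain z where z: "y < ereal z" "ereal z < ln_ennreal (ratio_liminf A l) / ereal (ln l)"
    using ereal_dense2[OF less] by blast
  have z0: "z > 0" using z(1) y by (metis ereal_less(2) le_less_trans)
  have ll: "ln l > 0" using l by simp
  define b where "b = l powr z"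
  have b: "b \<ge> 1" "ln b / ln l = z" using l z0 ll by (auto simp: b_def ge_one_powr_ge_zero ln_powr)
  have bH: "ennreal b < ratio_liminf A l"
  proof (cases "ratio_liminf A l")
    case (real h)
    have "h > 0"
    proof (rule ccontr)
      assume "\<not> h > 0"
      then have "h = 0" using real by simp
      then have "ln_ennreal (ratio_liminf A l) / ereal (ln l) = - \<infinity>"
        using real ll by (simp add: ln_ennreal_def)
      then show False using z(2) by simp
    qed
    then have "z < ln h / ln l" using z(2) real ll by (simp add: ln_ennreal_def)
    then have "z * ln l < ln h" using ll by (simp add: pos_less_divide_eq)
    then have "exp (z * ln l) < exp (ln h)" by simp
    then have "b < h" using \<open>h > 0\<close> l by (simp add: b_def powr_def)
    then show ?thesis using real \<open>h > 0\<close> by (simp add: ennreal_less_iff b_def)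
  qed (simp add: less_top)
  obtain t1 where t1: "t1 > 0" "A t1 > 0" using young_function_positive[OF A(1)] .
  have "eventually (\<lambda>t. ennreal b < A (l * t) / A t) at_top"
    using bH unfolding ratio_liminf_def by (rule less_LiminfD)
  then obtain t2 where t2: "\<And>t. t \<ge> t2 \<Longrightarrow> ennreal b < A (l * t) / A t"
    unfolding eventually_at_top_linorder by blast
  define t0 where "t0 = max t1 t2"
  have t0: "t0 > 0" "A t0 > 0"
    using t1 young_function_mono[OF A(1), of t1 t0] by (auto simp: t0_def)
  interpret real_young "young_real A 1" by (rule real_young_young_real[OF A]) simp
  have "b * young_real A 1 t \<le> young_real A 1 (l * t)" if t: "t \<ge> t0" for t
  proof -
    have tn: "t \<ge> 0" using t t0 by simp
    have At: "A t \<noteq> 0" using young_function_mono[OF A(1) _ t] t0 by auto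
    have Af: "A t < top" using finite_valued_less_top[OF A(2)] tn by blast
    have "ennreal b * A t \<le> A (l * t) / A t * A t"
      using t2[of t] t by (intro mult_right_mono) (auto simp: t0_def intro: less_imp_le)
    also have "\<dots> = A (l * t)"
      using At Af by (simp add: ennreal_divide_times ennreal_divide_self)
    finally have "ennreal (b * young_real A 1 t) \<le> ennreal (young_real A 1 (l * t))"
      using ennreal_young_real[OF A(2), of 1 t] ennreal_young_real[OF A(2), of 1 "l * t"] tn l b
      by (simp add: ennreal_mult nonneg)
    then show ?thesis by (simp add: nonneg)
  qed
  from growth_of_ratio[OF l b(1) this t0(1)]
  have "1 / b * \<mu> powr z * young_real A 1 t \<le> young_real A 1 (\<mu> * t)" if "t \<ge> t0" "\<mu> \<ge> 1" for t \<mu>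
    using that by (simp add: b(2))
  then show thesis using b(1) z(1) t0 by (intro that[of z "1 / b" t0]) auto
qed

text \<open>Fekete's argument: the quotients defining the index converge to their supremum over \<open>l > 1\<close>.\<close>

lemma lower_boyd_index_tendsto:
  fixes A :: "real \<Rightarrow> ennreal"
  assumes A: "young_function A" "finite_valued A"
  defines "F \<equiv> \<lambda>l. ln_ennreal (ratio_liminf A l) / ereal (ln l)"
  shows "(F \<longlongrightarrow> (SUP l\<in>{1<..}. F l)) at_top"
proof (rule order_tendstoI)
  fix y assume "y < (SUP l\<in>{1<..}. F l)"
  then obtain l where l: "l > 1" "y < F l" unfolding less_SUP_iff by auto
  obtain t1 where t1: "t1 > 0" "A t1 > 0" using young_function_positive[OF A(1)] .
  \<comment> \<open>A nonnegative \<open>y\<close> calls for iterating the ratio at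
    \<open>l\<close>; for a negative one, monotonicity of \<open>A\<close> makes all quotients
    nonnegative.\<close>
  show "eventually (\<lambda>l. y < F l) at_top"
  proof (cases "0 \<le> y")
    case True
    obtain q \<kappa> t0 where q: "y < ereal q" "0 < \<kappa>" "\<kappa> \<le> 1" "t0 > 0" "A t0 > 0"
      "\<And>t \<mu>. t \<ge> t0 \<Longrightarrow> \<mu> \<ge> 1 \<Longrightarrow> \<kappa> * \<mu> powr q * young_real A 1 t \<le> young_real A 1 (\<mu> * t)"
      using growth_of_index_quotient[OF A l(1) True l(2)[unfolded F_def]] by blast
    \<comment> \<open>The single factor \<open>l\<close> controls every \<open>\<mu> > 1\<close> up
      to the loss \<open>ln \<kappa> / ln \<mu>\<close>, which vanishes as \<open>\<mu>\<close>
      grows.\<close>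
    have lower: "ereal (q + ln \<kappa> / ln \<mu>) \<le> F \<mu>" if \<mu>: "\<mu> > 1" for \<mu>
    proof -
      have "ennreal (\<kappa> * \<mu> powr q) \<le> ratio_liminf A \<mu>"
        unfolding ratio_liminf_def
      proof (rule Liminf_bounded)
        show "eventually (\<lambda>t. ennreal (\<kappa> * \<mu> powr q) \<le> A (\<mu> * t) / A t) at_top"
          using eventually_ge_at_top[of t0]
        proof eventually_elim
          case (elim t)
          have tn: "t \<ge> 0" "t > 0" using elim q(4) by auto
          have At: "A t \<noteq> 0" using young_function_mono[OF A(1) _ elim] q(4,5) by auto
          have Af: "A t < top" using finite_valued_less_top[OF A(2)] tn by blast
          have "ennreal (\<kappa> * \<mu> powr q * young_real A 1 t) \<le> ennreal (young_real A 1 (\<mu> * t))"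
            using q(6)[OF elim] \<mu> by (intro ennreal_leI) simp
          then have "ennreal (\<kappa> * \<mu> powr q) * A t \<le> A (\<mu> * t)"
            using ennreal_young_real[OF A(2), of 1 t] ennreal_young_real[OF A(2), of 1 "\<mu> * t"] tn \<mu> q(2)
            by (simp add: ennreal_mult young_real_def)
          then have "ennreal (\<kappa> * \<mu> powr q) * A t / A t \<le> A (\<mu> * t) / A t"
            by (rule divide_right_mono_ennreal)
          then show ?case using At Af by (simp add: ennreal_mult_divide_eq)
        qed
      qed
      then have "ln_ennreal (ennreal (\<kappa> * \<mu> powr q)) \<le> ln_ennreal (ratio_liminf A \<mu>)" by (rule ln_ennreal_mono)
      moreover have "ln_ennreal (ennreal (\<kappa> * \<mu> powr q)) = ereal (ln \<kappa> + q * ln \<mu>)"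
        using q(2) \<mu> by (simp add: ln_ennreal_def ln_mult ln_powr)
      ultimately have "ereal (ln \<kappa> + q * ln \<mu>) / ereal (ln \<mu>) \<le> F \<mu>"
        unfolding F_def using \<mu> by (intro ereal_divide_right_mono) auto
      then show ?thesis using \<mu> by (simp add: add_divide_distrib add.commute)
    qed
    have "((\<lambda>\<mu>::real. ln \<kappa> / ln \<mu>) \<longlongrightarrow> 0) at_top"
      by (intro real_tendsto_divide_at_top[OF tendsto_const ln_at_top])
    then have "((\<lambda>\<mu>. q + ln \<kappa> / ln \<mu>) \<longlongrightarrow> q + 0) at_top" by (intro tendsto_intros)
    then have "((\<lambda>\<mu>. ereal (q + ln \<kappa> / ln \<mu>)) \<longlongrightarrow> ereal q) at_top" by simp
    then have "eventually (\<lambda>\<mu>. y < ereal (q + ln \<kappa> / ln \<mu>)) at_top"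
      using q(1) by (rule order_tendstoD(1))
    then show ?thesis
      using eventually_gt_at_top[of 1] by eventually_elim (use lower in \<open>auto intro: less_le_trans\<close>)
  next
    case False
    show ?thesis
      using eventually_gt_at_top[of 1]
    proof eventually_elim
      case (elim l)
      have "1 \<le> ratio_liminf A l"
        unfolding ratio_liminf_def
      proof (rule Liminf_bounded)
        show "eventually (\<lambda>t. 1 \<le> A (l * t) / A t) at_top"
          using eventually_ge_at_top[of t1]
        proof eventually_elim
          case (elim t)
          have At: "A t \<noteq> 0" using young_function_mono[OF A(1) _ elim] t1 by auto
          have Af: "A t < top" using finite_valued_less_top[OF A(2)] t1 elim by simp
          have "A t / A t \<le> A (l * t) / A t"
            using elim t1 \<open>1 < l\<close> by (intro divide_right_mono_ennreal young_function_mono[OF A(1)]) auto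
          then show ?case using At Af by (simp add: ennreal_divide_self)
        qed
      qed
      from ln_ennreal_mono[OF this] have "0 \<le> ln_ennreal (ratio_liminf A l)"
        by (simp add: ln_ennreal_def zero_ereal_def)
      then have "0 \<le> F l" unfolding F_def using elim by (intro zero_le_divide_ereal) auto
      then show ?case using False by simp
    qed
  qed
next
  fix y assume y: "(SUP l\<in>{1<..}. F l) < y"
  show "eventually (\<lambda>l. F l < y) at_top"
    using eventually_gt_at_top[of 1]
    by eventually_elim (use y SUP_upper[of _ "{1<..}" F] in \<open>auto intro: le_less_trans\<close>)
qed

text \<open>The index is given by \<open>Lim\<close>, whose value is known only through the
  convergence just shown. As it is a supremum, one factor \<open>l\<close> witnesses that it exceeds
  \<open>p\<close>, and iteration at this \<open>l\<close> leaves room for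
  \<open>q > p\<close>.\<close>

lemma growth_of_lower_boyd_index:
  assumes A: "young_function A" "finite_valued A" and p: "0 \<le> p" "lower_boyd_index A > ereal p"
  obtains q \<kappa> t0 where "q > p" "0 < \<kappa>" "\<kappa> \<le> 1"
    "\<And>t \<mu>. t \<ge> t0 \<Longrightarrow> \<mu> \<ge> 1 \<Longrightarrow> \<kappa> * \<mu> powr q * young_real A 1 t \<le> young_real A 1 (\<mu> * t)"
proof -
  have "lower_boyd_index A = Lim at_top (\<lambda>l. ln_ennreal (ratio_liminf A l) / ereal (ln l))"
    by (simp add: lower_boyd_index_def ratio_liminf_def)
  also have "\<dots> = (SUP l\<in>{1<..}. ln_ennreal (ratio_liminf A l) / ereal (ln l))"
    by (rule tendsto_Lim[OF _ lower_boyd_index_tendsto[OF A]]) simp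
  finally have "ereal p < (SUP l\<in>{1<..}. ln_ennreal (ratio_liminf A l) / ereal (ln l))"
    using p(2) by simp
  then obtain l where l: "l > 1" "ereal p < ln_ennreal (ratio_liminf A l) / ereal (ln l)"
    unfolding less_SUP_iff by auto
  have p0: "0 \<le> ereal p" using p(1) by simp
  obtain q \<kappa> t0 where q: "ereal p < ereal q" "0 < \<kappa>" "\<kappa> \<le> 1" "t0 > 0" "A t0 > 0"
    "\<And>t \<mu>. t \<ge> t0 \<Longrightarrow> \<mu> \<ge> 1 \<Longrightarrow> \<kappa> * \<mu> powr q * young_real A 1 t \<le> young_real A 1 (\<mu> * t)"
    using growth_of_index_quotient[OF A l(1) p0 l(2)] by blast
  from q(1) have "q > p" by simp
  from that[OF this q(2,3,6)] show thesis .
qed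

section \<open>The continuous representative\<close>

text \<open>By Lindelof countably many neighbourhoods suffice for each accuracy
  \<open>1 / (k + 1)\<close>, so all exceptional sets together are null. On the remaining dense set
  \<open>G\<close> the function \<open>u\<close> satisfies a Cauchy condition at every point of
  \<open>\<Omega>\<close> and extends continuously.\<close>

lemma continuous_representative:
  fixes u :: "'a::euclidean_space \<Rightarrow> real"
  assumes \<Omega>: "open \<Omega>"
    and osc: "\<And>x \<epsilon>. x \<in> \<Omega> \<Longrightarrow> \<epsilon> > 0 \<Longrightarrow>
      \<exists>W m M. open W \<and> x \<in> W \<and> M - m \<le> \<epsilon> \<and> (AE y in lebesgue. y \<in> W \<longrightarrow> m \<le> u y \<and> u y \<le> M)"
  shows "\<exists>v. continuous_on \<Omega> v \<and> (AE x in lebesgue. x \<in> \<Omega> \<longrightarrow> u x = v x)"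
proof -
  define P where "P k x T \<longleftrightarrow> (case T of (W, m, M) \<Rightarrow> open W \<and> x \<in> W \<and> M - m \<le> 1 / real (Suc k) \<and>
      (AE y in lebesgue. y \<in> W \<longrightarrow> m \<le> u y \<and> u y \<le> M))" for k x T
  have "\<exists>T. x \<in> \<Omega> \<longrightarrow> P k x T" for k x
  proof (cases "x \<in> \<Omega>")
    case True
    from osc[OF this, of "1 / real (Suc k)"] obtain W m M where
      "open W" "x \<in> W" "M - m \<le> 1 / real (Suc k)" "AE y in lebesgue. y \<in> W \<longrightarrow> m \<le> u y \<and> u y \<le> M"
      by auto
    then show ?thesis by (intro exI[of _ "(W, m, M)"]) (simp add: P_def)
  qed simp
  then have ex: "\<exists>T. P k x T" if "x \<in> \<Omega>" for k x using that by blast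
  define T where "T k x = (SOME T. P k x T)" for k x
  have T: "P k x (T k x)" if "x \<in> \<Omega>" for k x
    unfolding T_def by (rule someI_ex[OF ex[OF that]])
  define W where "W k x = fst (T k x)" for k x
  define m where "m k x = fst (snd (T k x))" for k x
  define M where "M k x = snd (snd (T k x))" for k x
  have W: "open (W k x)" "x \<in> W k x" "M k x - m k x \<le> 1 / real (Suc k)"
    "AE y in lebesgue. y \<in> W k x \<longrightarrow> m k x \<le> u y \<and> u y \<le> M k x" if "x \<in> \<Omega>" for k x
    using T[OF that, of k] by (auto simp: P_def W_def m_def M_def split: prod.splits)
  have "\<exists>C. countable C \<and> C \<subseteq> \<Omega> \<and> \<Omega> \<subseteq> (\<Union>x\<in>C. W k x)" for k
  proof -
    obtain F' where F': "F' \<subseteq> W k ` \<Omega>" "countable F'" "\<Union>F' = \<Union>(W k ` \<Omega>)"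
      using Lindelof[of "W k ` \<Omega>"] W(1) by (metis (no_types, lifting) image_iff)
    then obtain C where "C \<subseteq> \<Omega>" "countable C" "F' = W k ` C"
      using countable_subset_image[of F' "W k" \<Omega>] by metis
    moreover have "\<Omega> \<subseteq> \<Union>(W k ` \<Omega>)" using W(2) by blast
    ultimately show ?thesis using F'(3) by (intro exI[of _ C]) auto
  qed
  then obtain C where C: "\<And>k. countable (C k)" "\<And>k. C k \<subseteq> \<Omega>" "\<And>k. \<Omega> \<subseteq> (\<Union>x\<in>C k. W k x)" by metis
  define G where "G = {y. \<forall>k. \<forall>x\<in>C k. y \<in> W k x \<longrightarrow> m k x \<le> u y \<and> u y \<le> M k x}"
  have G: "AE y in lebesgue. y \<in> G"
  proof -
    have "AE y in lebesgue. \<forall>k. \<forall>x\<in>C k. y \<in> W k x \<longrightarrow> m k x \<le> u y \<and> u y \<le> M k x"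
      unfolding AE_all_countable
    proof
      fix k
      show "AE y in lebesgue. \<forall>x\<in>C k. y \<in> W k x \<longrightarrow> m k x \<le> u y \<and> u y \<le> M k x"
        using W(4) C(2) by (subst AE_ball_countable[OF C(1)]) blast
    qed
    then show ?thesis by (simp add: G_def)
  qed
  have close: "\<exists>\<delta>>0. \<forall>y\<in>G. \<forall>z\<in>G. dist y x < \<delta> \<longrightarrow> dist z x < \<delta> \<longrightarrow> \<bar>u y - u z\<bar> \<le> e"
    if x: "x \<in> \<Omega>" and e: "e > 0" for x e
  proof -
    obtain k where k: "1 / real (Suc k) < e" using nat_approx_posE[OF e] by blast
    obtain p where p: "p \<in> C k" "x \<in> W k p" using C(3) x by blast
    have Wp: "open (W k p)" "M k p - m k p \<le> 1 / real (Suc k)" using W(1,3) C(2) p(1) by blast+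
    obtain \<delta> where \<delta>: "\<delta> > 0" "\<And>y. dist y x < \<delta> \<Longrightarrow> y \<in> W k p"
      using Wp(1) p(2) unfolding open_dist by blast
    have "\<bar>u y - u z\<bar> \<le> e" if "y \<in> G" "z \<in> G" "dist y x < \<delta>" "dist z x < \<delta>" for y z
    proof -
      have "m k p \<le> u y \<and> u y \<le> M k p" "m k p \<le> u z \<and> u z \<le> M k p"
        using that \<delta>(2) p(1) unfolding G_def by blast+
      then show ?thesis using Wp(2) k by linarith
    qed
    then show ?thesis using \<delta>(1) by blast
  qed
  \<comment> \<open>A null set contains no ball, so \<open>G\<close> meets every ball.\<close>
  have dense: "\<exists>y\<in>G. dist y x < d" if "d > 0" for x d
  proof (rule ccontr)
    assume "\<not> ?thesis"
    then have "ball x d \<subseteq> - G" by (auto simp: dist_commute)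
    moreover obtain N where "{y \<in> space lebesgue. y \<notin> G} \<subseteq> N" "N \<in> null_sets lebesgue"
      using G by (auto elim!: AE_E simp: null_sets_def)
    ultimately have "ball x d \<subseteq> N" "negligible N"
      by (auto simp: negligible_iff_null_sets)
    then have "negligible (ball x d)" by (rule negligible_subset[rotated])
    then show False using open_not_negligible[of "ball x d"] that by auto
  qed
  have "\<exists>Y. \<forall>j. Y j \<in> G \<and> dist (Y j) x < 1 / real (Suc j)" for x
  proof (rule choice, rule allI)
    fix j :: nat
    show "\<exists>y. y \<in> G \<and> dist y x < 1 / real (Suc j)" using dense[of "1 / real (Suc j)" x] by auto
  qed
  then obtain Y where Y: "\<And>x j. Y x j \<in> G" "\<And>x j. dist (Y x j) x < 1 / real (Suc j)" by metis
  have Yev: "\<exists>N. \<forall>j\<ge>N. dist (Y x j) x < \<delta>" if \<delta>: "\<delta> > 0" for x \<delta>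
  proof -
    obtain N where N: "1 / real (Suc N) < \<delta>" using nat_approx_posE[OF \<delta>] by blast
    have "dist (Y x j) x < \<delta>" if "j \<ge> N" for j
    proof -
      have "1 / real (Suc j) \<le> 1 / real (Suc N)" using that by (intro divide_left_mono) auto
      then show ?thesis using Y(2)[of x j] N by linarith
    qed
    then show ?thesis by blast
  qed
  \<comment> \<open>The limit along one chosen sequence from \<open>G\<close>; \<open>vclose\<close>
    shows that it controls all nearby values of \<open>u\<close> on \<open>G\<close>.\<close>
  define v where "v x = lim (\<lambda>j. u (Y x j))" for x
  have lim: "(\<lambda>j. u (Y x j)) \<longlonglongrightarrow> v x" if x: "x \<in> \<Omega>" for x
  proof -
    have "Cauchy (\<lambda>j. u (Y x j))"
    proof (rule metric_CauchyI)
      fix e :: real assume "e > 0"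
      obtain \<delta> where \<delta>: "\<delta> > 0" "\<And>y z. y \<in> G \<Longrightarrow> z \<in> G \<Longrightarrow> dist y x < \<delta> \<Longrightarrow> dist z x < \<delta> \<Longrightarrow> \<bar>u y - u z\<bar> \<le> e / 2"
        using close[OF x, of "e / 2"] \<open>e > 0\<close> by auto
      obtain N where N: "\<And>j. j \<ge> N \<Longrightarrow> dist (Y x j) x < \<delta>" using Yev[OF \<delta>(1)] by blast
      have "dist (u (Y x j)) (u (Y x k)) < e" if "j \<ge> N" "k \<ge> N" for j k
        using \<delta>(2)[OF Y(1) Y(1) N[OF that(1)] N[OF that(2)]] \<open>e > 0\<close> by (simp add: dist_real_def)
      then show "\<exists>N. \<forall>j\<ge>N. \<forall>k\<ge>N. dist (u (Y x j)) (u (Y x k)) < e" by blast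
    qed
    then show ?thesis unfolding v_def by (simp add: Cauchy_convergent_iff convergent_LIMSEQ_iff)
  qed
  have vclose: "\<exists>\<delta>>0. \<forall>z\<in>G. dist z x < \<delta> \<longrightarrow> \<bar>v x - u z\<bar> \<le> e"
    if x: "x \<in> \<Omega>" and e: "e > 0" for x e
  proof -
    obtain \<delta> where \<delta>: "\<delta> > 0" "\<And>y z. y \<in> G \<Longrightarrow> z \<in> G \<Longrightarrow> dist y x < \<delta> \<Longrightarrow> dist z x < \<delta> \<Longrightarrow> \<bar>u y - u z\<bar> \<le> e"
      using close[OF x e] by auto
    obtain N where N: "\<And>j. j \<ge> N \<Longrightarrow> dist (Y x j) x < \<delta>" using Yev[OF \<delta>(1)] by blast
    have "\<bar>v x - u z\<bar> \<le> e" if "z \<in> G" "dist z x < \<delta>" for z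
    proof (rule LIMSEQ_le_const2)
      show "(\<lambda>j. \<bar>u (Y x j) - u z\<bar>) \<longlonglongrightarrow> \<bar>v x - u z\<bar>"
        by (intro tendsto_intros lim x)
      show "\<exists>N. \<forall>j\<ge>N. \<bar>u (Y x j) - u z\<bar> \<le> e"
        using \<delta>(2)[OF Y(1) that(1) N that(2)] by blast
    qed
    then show ?thesis using \<delta>(1) by blast
  qed
  have "continuous_on \<Omega> v"
    unfolding continuous_on_iff
  proof (intro ballI allI impI)
    fix x e assume x: "x \<in> \<Omega>" and e: "(e::real) > 0"
    obtain \<delta> where \<delta>: "\<delta> > 0" "\<And>z. z \<in> G \<Longrightarrow> dist z x < \<delta> \<Longrightarrow> \<bar>v x - u z\<bar> \<le> e / 3"
      using vclose[OF x, of "e / 3"] e by auto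
    have "dist (v x') (v x) < e" if x': "x' \<in> \<Omega>" "dist x' x < \<delta> / 2" for x'
    proof -
      obtain \<delta>' where \<delta>': "\<delta>' > 0" "\<And>z. z \<in> G \<Longrightarrow> dist z x' < \<delta>' \<Longrightarrow> \<bar>v x' - u z\<bar> \<le> e / 3"
        using vclose[OF x'(1), of "e / 3"] e by auto
      obtain z where z: "z \<in> G" "dist z x' < min \<delta>' (\<delta> / 2)"
        using dense[of "min \<delta>' (\<delta> / 2)" x'] \<delta>(1) \<delta>'(1) by auto
      have "dist z x < \<delta>" using dist_triangle[of z x x'] z(2) x'(2) by simp
      then have "\<bar>v x - u z\<bar> \<le> e / 3" "\<bar>v x' - u z\<bar> \<le> e / 3"
        using \<delta>(2)[OF z(1)] \<delta>'(2)[OF z(1)] z(2) by simp_all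
      then show ?thesis unfolding dist_real_def using e by linarith
    qed
    then show "\<exists>d>0. \<forall>x'\<in>\<Omega>. dist x' x < d \<longrightarrow> dist (v x') (v x) < e"
      using \<delta>(1) by (intro exI[of _ "\<delta> / 2"]) auto
  qed
  moreover have "u x = v x" if "x \<in> \<Omega>" "x \<in> G" for x
  proof -
    have "\<bar>v x - u x\<bar> \<le> e" if "e > 0" for e
      using vclose[OF \<open>x \<in> \<Omega>\<close> that] \<open>x \<in> G\<close> by auto
    then have "\<bar>v x - u x\<bar> \<le> 0" by (rule field_le_epsilon[of _ 0, simplified])
    then show ?thesis by simp
  qed
  then have "AE x in lebesgue. x \<in> \<Omega> \<longrightarrow> u x = v x" using G by auto
  ultimately show ?thesis by blast
qed

section \<open>Borel representatives cut off to a compact set\<close>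

lemma borel_representative_real:
  fixes h :: "'a::euclidean_space \<Rightarrow> real"
  assumes h: "integrable (lebesgue_on K) h" and [measurable]: "K \<in> sets borel"
  shows "\<exists>h'. integrable lborel h' \<and> (\<forall>x. x \<notin> K \<longrightarrow> h' x = 0) \<and> (AE x in lborel. x \<in> K \<longrightarrow> h' x = h x)"
proof -
  define H where "H x = indicator K x *\<^sub>R h x" for x
  have H: "integrable lebesgue H"
    using h unfolding H_def by (subst (asm) integrable_restrict_space) auto
  then obtain g where g: "g \<in> borel_measurable lborel" "AE x in lborel. H x = g x"
    using completion_ex_borel_measurable_real[OF borel_measurable_integrable[OF H]] by blast
  define h' where "h' x = indicator K x * g x" for x
  have hm [measurable]: "h' \<in> borel_measurable borel" using g(1) unfolding h'_def by simp
  have "AE x in lborel. h' x = H x"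
    using g(2) by eventually_elim (auto simp: h'_def H_def indicator_def)
  then have "AE x in lebesgue. h' x = H x" by (rule AE_completion)
  then have "integrable lebesgue h'"
    using H hm by (subst integrable_cong_AE[of _ _ H]) (auto intro: measurable_completion)
  then have "integrable lborel h'" using hm by (simp add: integrable_completion)
  moreover have "AE x in lborel. x \<in> K \<longrightarrow> h' x = h x"
    using g(2) by eventually_elim (auto simp: h'_def H_def indicator_def)
  ultimately show ?thesis by (intro exI[of _ h']) (auto simp: h'_def)
qed

lemma borel_representative_vec:
  fixes h :: "'a::euclidean_space \<Rightarrow> real ^ 'n::finite"
  assumes h: "integrable (lebesgue_on K) h" and K: "K \<in> sets borel"
  shows "\<exists>h'. integrable lborel h' \<and> (\<forall>x. x \<notin> K \<longrightarrow> h' x = 0) \<and> (AE x in lborel. x \<in> K \<longrightarrow> h' x = h x)"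
proof -
  have "integrable (lebesgue_on K) (\<lambda>x. h x $ i)" for i
    using integrable_bounded_linear[OF bounded_linear_vec_nth h] .
  from borel_representative_real[OF this K]
  obtain w where w: "\<And>i. integrable lborel (w i)" "\<And>i x. x \<notin> K \<Longrightarrow> w i x = 0"
    "\<And>i. AE x in lborel. x \<in> K \<longrightarrow> w i x = h x $ i" by metis
  define h' where "h' x = (\<Sum>i\<in>UNIV. w i x *\<^sub>R axis i (1::real))" for x
  have nth: "h' x $ i = w i x" for x i
    by (simp add: h'_def axis_def if_distrib[of "\<lambda>c. _ * c"] cong: if_cong)
  have "integrable lborel h'" unfolding h'_def using w(1) by auto
  moreover have "h' x = 0" if "x \<notin> K" for x using w(2)[OF that] by (simp add: vec_eq_iff nth)
  moreover have "AE x in lborel. \<forall>i. x \<in> K \<longrightarrow> w i x = h x $ i"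
    unfolding AE_all_countable using w(3) by blast
  then have "AE x in lborel. x \<in> K \<longrightarrow> h' x = h x"
    by eventually_elim (simp add: vec_eq_iff nth)
  ultimately show ?thesis by (intro exI[of _ h']) auto
qed

text \<open>Test functions supported in \<open>V \<subseteq> K\<close> do not see that
  \<open>v\<close> and \<open>h\<close> were set to zero outside \<open>K\<close>, nor their change
  on null sets inside.\<close>

lemma local_weak_gradient:
  fixes u :: "real ^ 'n::finite \<Rightarrow> real" and g :: "real ^ 'n \<Rightarrow> real ^ 'n"
  assumes wg: "weak_gradient U u g" and U: "open U" and K: "compact K" "K \<subseteq> U"
    and v: "integrable lborel v" "\<And>x. x \<notin> K \<Longrightarrow> v x = 0" "AE x in lborel. x \<in> K \<longrightarrow> v x = u x"
    and h: "integrable lborel h" "\<And>x. x \<notin> K \<Longrightarrow> h x = 0" "AE x in lborel. x \<in> K \<longrightarrow> h x = g x"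
    and \<phi>: "\<phi> \<in> test_functions V" and V: "V \<subseteq> K"
  shows "(LINT x|lborel. v x * partial i \<phi> x) = - (LINT x|lborel. h x $ i * \<phi> x)"
proof -
  have [measurable]: "K \<in> sets borel" "U \<in> sets borel" using K U by (auto dest: compact_imp_closed)
  have \<phi>U: "\<phi> \<in> test_functions U"
    using \<phi> V K(2) unfolding test_functions_def by blast
  have zero: "\<eta> x = 0" if "\<eta> \<in> test_functions V" "x \<notin> K" for \<eta> :: "real ^ 'n \<Rightarrow> real" and x
    using test_functionsD(3)[OF that(1)] closure_subset[of "{x. \<eta> x \<noteq> 0}"] that(2) V by auto
  have [measurable]: "\<phi> \<in> borel_measurable borel" "partial i \<phi> \<in> borel_measurable borel"
    using test_functionsD(6)[OF \<phi>] test_functionsD(6)[OF test_functions_partial[OF \<phi>]] by auto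
  have eq: "(LINT x|lebesgue_on U. F x * \<eta> x) = (LINT x|lborel. F' x * \<eta> x)"
    if F: "integrable (lebesgue_on K) F" and F': "integrable lborel F'" and FF: "AE x in lborel. x \<in> K \<longrightarrow> F' x = F x"
      and \<eta>: "\<eta> \<in> test_functions V" for F F' \<eta> :: "real ^ 'n \<Rightarrow> real"
  proof -
    have [measurable]: "\<eta> \<in> borel_measurable borel" "F' \<in> borel_measurable borel"
      using test_functionsD(6)[OF \<eta>] F' by auto
    have m\<eta>: "\<eta> \<in> borel_measurable lebesgue" "F' \<in> borel_measurable lebesgue"
      by (auto intro: measurable_completion)
    have "integrable lebesgue (\<lambda>x. indicator K x *\<^sub>R F x)"
      using F by (subst (asm) integrable_restrict_space) auto
    then have mF: "(\<lambda>x. indicator K x *\<^sub>R F x) \<in> borel_measurable lebesgue" by auto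
    have "(LINT x|lebesgue_on U. F x * \<eta> x) = (LINT x|lebesgue. indicator U x *\<^sub>R (F x * \<eta> x))"
      by (subst integral_restrict_space) auto
    also have "\<dots> = (LINT x|lebesgue. (indicator K x *\<^sub>R F x) * \<eta> x)"
      using zero[OF \<eta>] K(2) by (intro Bochner_Integration.integral_cong) (auto simp: indicator_def)
    also have "\<dots> = (LINT x|lebesgue. F' x * \<eta> x)"
    proof (rule integral_cong_AE)
      show "(\<lambda>x. (indicator K x *\<^sub>R F x) * \<eta> x) \<in> borel_measurable lebesgue" "(\<lambda>x. F' x * \<eta> x) \<in> borel_measurable lebesgue"
        using mF m\<eta> by auto
      show "AE x in lebesgue. (indicator K x *\<^sub>R F x) * \<eta> x = F' x * \<eta> x"
        using AE_completion[OF FF] by eventually_elim (use zero[OF \<eta>] in \<open>auto simp: indicator_def\<close>)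
    qed
    also have "\<dots> = (LINT x|lborel. F' x * \<eta> x)" by (rule integral_completion) simp
    finally show ?thesis .
  qed
  have uK: "integrable (lebesgue_on K) u" and gK: "integrable (lebesgue_on K) (\<lambda>x. g x $ i)"
    using wg K integrable_bounded_linear[OF bounded_linear_vec_nth, of "lebesgue_on K" g i]
    unfolding weak_gradient_def locally_integrable_def by blast+
  have hi: "integrable lborel (\<lambda>x. h x $ i)" "AE x in lborel. x \<in> K \<longrightarrow> h x $ i = g x $ i"
    using integrable_bounded_linear[OF bounded_linear_vec_nth h(1)] h(3) by auto
  have "(LINT x|lebesgue_on U. u x * partial i \<phi> x) = - (LINT x|lebesgue_on U. g x $ i * \<phi> x)"
    using wg \<phi>U unfolding weak_gradient_def by blast
  then show ?thesis
    using eq[OF uK v(1,3) test_functions_partial[OF \<phi>]] eq[OF gK hi \<phi>] by simp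
qed

lemma orlicz_modular:
  assumes "f \<in> orlicz A E"
  obtains l where "l > 0" "(\<integral>\<^sup>+x. A (\<bar>f x\<bar> / l) \<partial>lebesgue_on E) \<le> 1"
proof -
  have "luxemburg_norm A E f < \<infinity>" using assms by (simp add: orlicz_def)
  then show thesis unfolding luxemburg_norm_def Inf_less_iff using that by blast
qed

theorem corollary3p10:
  fixes A :: "real \<Rightarrow> ennreal"
    and \<Omega> :: "(real ^ 'n::finite) set"
    and u :: "real ^ 'n \<Rightarrow> real"
  assumes "CARD('n) \<ge> 2"
    and "open \<Omega>"
    and "young_function A" and "finite_valued A"
    and "\<forall>a>0. (\<integral>\<^sup>+t\<in>{a..}. A t / ennreal (t ^ (CARD('n) + 1)) \<partial>lborel) = \<infinity>"
    and "CARD('n) = 2 \<or>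
      CARD('n) \<ge> 3 \<and> lower_boyd_index A > ereal (real CARD('n) - 1)"
    and "u \<in> orlicz_sobolev_loc A \<Omega>"
    and "weakly_monotone \<Omega> u"
  shows "\<exists>v. continuous_on \<Omega> v \<and> (AE x in lebesgue_on \<Omega>. u x = v x)"
proof -
  note A = assms(3,4)
  have \<Omega>s: "\<Omega> \<in> sets lebesgue" using assms(2) by auto
  have growth: "CARD('n) = 2 \<or> CARD('n) \<ge> 2 \<and> (\<exists>q \<kappa> t0. q > real CARD('n) - 1 \<and> 0 < \<kappa> \<and> \<kappa> \<le> 1 \<and>
      (\<forall>t\<ge>t0. \<forall>\<mu>\<ge>1. \<kappa> * \<mu> powr q * young_real A 1 t \<le> young_real A 1 (\<mu> * t)))"
  proof (cases "CARD('n) = 2")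
    case False
    then have "lower_boyd_index A > ereal (real CARD('n) - 1)" using assms(6) by blast
    from growth_of_lower_boyd_index[OF A _ this] obtain q \<kappa> t0 where
      "q > real CARD('n) - 1" "0 < \<kappa>" "\<kappa> \<le> 1"
      "\<And>t \<mu>. t \<ge> t0 \<Longrightarrow> \<mu> \<ge> 1 \<Longrightarrow> \<kappa> * \<mu> powr q * young_real A 1 t \<le> young_real A 1 (\<mu> * t)"
      using assms(1) by auto
    then show ?thesis using assms(1) by blast
  qed simp
  obtain t1 where t1: "t1 > 0" "A t1 > 0" using young_function_positive[OF A(1)] .
  have wm: "AE x in lebesgue_on U. m \<le> u x \<and> u x \<le> M"
    if "open U" "compactly_contained U \<Omega>" "m \<le> M"
      "(\<lambda>x. max (u x - M) 0 - max (m - u x) 0) \<in> sobolev_11_zero U" for U m M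
    using assms(8) that unfolding weakly_monotone_def by blast
  have "\<exists>W m M. open W \<and> c \<in> W \<and> M - m \<le> \<epsilon> \<and> (AE y in lebesgue. y \<in> W \<longrightarrow> m \<le> u y \<and> u y \<le> M)"
    if c: "c \<in> \<Omega>" and \<epsilon>: "\<epsilon> > 0" for c \<epsilon>
  proof -
    obtain R3 where R3: "R3 > 0" "cube c R3 \<subseteq> \<Omega>"
    proof -
      obtain e where e: "e > 0" "cball c e \<subseteq> \<Omega>" using assms(2) c open_contains_cball by blast
      \<comment> \<open>Division by the dimension, because the Euclidean norm is estimated by the
        sum of the coordinates.\<close>
      define R3 where "R3 = e / real CARD('n)"
      have "cube c R3 \<subseteq> cball c e"
      proof
        fix x assume x: "x \<in> cube c R3"
        have "norm (x - c) \<le> (\<Sum>i\<in>UNIV. \<bar>(x - c) $ i\<bar>)" by (rule norm_le_l1_cart)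
        also have "\<dots> \<le> (\<Sum>i\<in>(UNIV::'n set). R3)" using x by (intro sum_mono) (simp add: cube_def)
        also have "\<dots> = e" by (simp add: R3_def)
        finally show "x \<in> cball c e" by (simp add: dist_norm norm_minus_commute)
      qed
      then show thesis using that[of R3] e by (auto simp: R3_def)
    qed
    \<comment> \<open>Three nested cubes: the weak gradient lives on the one of size
      \<open>R3\<close>, the representatives are cut off at \<open>R2\<close>, and the radii up to
      \<open>R\<close> leave room for mollification.\<close>
    define R2 where "R2 = R3 / 2"
    define R where "R = R3 / 4"
    have R: "0 < R" "R < R2" "R2 < R3" using R3(1) by (auto simp: R_def R2_def)
    let ?U = "ocube c R3" and ?K = "cube c R2"
    have KU: "?K \<subseteq> ?U" using R(3) by (auto simp: cube_def ocube_def intro: le_less_trans)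
    have cc: "compactly_contained (ocube c r) \<Omega>" "bounded (ocube c r)" if "r \<le> R3" for r
    proof -
      have sub: "closure (ocube c r) \<subseteq> cube c r" using ocube_subset_cube closed_cube by (rule closure_minimal)
      have "cube c r \<subseteq> cube c R3" using that by (auto simp: cube_def intro: order_trans)
      with sub R3(2) have "closure (ocube c r) \<subseteq> \<Omega>" by blast
      moreover have "bounded (ocube c r)" using compact_imp_bounded[OF compact_cube] ocube_subset_cube by (rule bounded_subset)
      ultimately show "compactly_contained (ocube c r) \<Omega>" "bounded (ocube c r)"
        unfolding compactly_contained_def by (auto simp: compact_closure)
    qed
    have "u \<in> orlicz_sobolev A ?U"
      using assms(7) cc[of R3] open_ocube unfolding orlicz_sobolev_loc_def by blast
    then obtain g where wg: "weak_gradient ?U u g" and go: "(\<lambda>x. norm (g x)) \<in> orlicz A ?U"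
      unfolding orlicz_sobolev_def by blast
    \<comment> \<open>A finite Luxemburg norm yields a scale at which the modular of the gradient is
      at most 1; \<open>A\<close> is rescaled by it from here on.\<close>
    obtain l where l: "l > 0" "(\<integral>\<^sup>+x. A (\<bar>norm (g x)\<bar> / l) \<partial>lebesgue_on ?U) \<le> 1"
      using orlicz_modular[OF go] .
    have "locally_integrable ?U u" "locally_integrable ?U g"
      using wg by (simp_all add: weak_gradient_def)
    from this[unfolded locally_integrable_def, rule_format, OF conjI[OF compact_cube KU]]
    have uK: "integrable (lebesgue_on ?K) u" and gK: "integrable (lebesgue_on ?K) g" .
    obtain v where v: "integrable lborel v" "\<And>x. x \<notin> ?K \<Longrightarrow> v x = 0" "AE x in lborel. x \<in> ?K \<longrightarrow> v x = u x"
      using borel_representative_real[OF uK sets_cube] by blast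
    obtain h where h: "integrable lborel h" "\<And>x. x \<notin> ?K \<Longrightarrow> h x = 0" "AE x in lborel. x \<in> ?K \<longrightarrow> h x = g x"
      using borel_representative_vec[OF gK sets_cube] by blast
    interpret real_young "young_real A l" by (rule real_young_young_real[OF A l(1)])
    have rp: "young_real A l t = young_real A 1 (t / l)" for t
    proof -
      have "max (t / l) 0 = max t 0 / l"
        using l(1) by (cases "t \<ge> 0") (simp_all add: max_def divide_le_0_iff)
      then show ?thesis by (simp add: young_real_def)
    qed
    have "\<exists>r m M. 0 < r \<and> r < R \<and> M - m \<le> \<epsilon> \<and> (AE x in lebesgue_on (ocube c r). m \<le> u x \<and> u x \<le> M)"
    proof -
      have growth': "\<exists>t0. CARD('n) = 2 \<or> CARD('n) \<ge> 2 \<and> (\<exists>q \<kappa>. q > real CARD('n) - 1 \<and> 0 < \<kappa> \<and> \<kappa> \<le> 1 \<and>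
        (\<forall>t\<ge>t0. \<forall>\<mu>\<ge>1. \<kappa> * \<mu> powr q * young_real A l t \<le> young_real A l (\<mu> * t)))"
        using growth
      proof (elim disjE conjE exE)
        fix q \<kappa> t0
        assume q: "q > real CARD('n) - 1" "0 < \<kappa>" "\<kappa> \<le> 1"
          and gr: "\<forall>t\<ge>t0. \<forall>\<mu>\<ge>1. \<kappa> * \<mu> powr q * young_real A 1 t \<le> young_real A 1 (\<mu> * t)"
        \<comment> \<open>Rescaling preserves \<open>q\<close> and \<open>\<kappa>\<close> and only
          moves the threshold to \<open>t0 * l\<close>.\<close>
        have "\<kappa> * \<mu> powr q * young_real A l t \<le> young_real A l (\<mu> * t)" if "t \<ge> t0 * l" "\<mu> \<ge> 1" for t \<mu>
        proof -
          have "t / l \<ge> t0" using that(1) l(1) by (simp add: pos_le_divide_eq)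
          then show ?thesis using gr that(2) unfolding rp times_divide_eq_right[symmetric] by blast
        qed
        then show ?thesis using assms(1) q by blast
      qed blast
      then obtain t0 where growth'': "CARD('n) = 2 \<or> CARD('n) \<ge> 2 \<and> (\<exists>q \<kappa>. q > real CARD('n) - 1 \<and> 0 < \<kappa> \<and> \<kappa> \<le> 1 \<and>
        (\<forall>t\<ge>t0. \<forall>\<mu>\<ge>1. \<kappa> * \<mu> powr q * young_real A l t \<le> young_real A l (\<mu> * t)))" by blast
      have N: "CARD('n) - 1 + 2 = CARD('n) + 1" using assms(1) by simp
      interpret A1: real_young "young_real A 1" by (rule real_young_young_real[OF A]) simp
      have inf: "(\<integral>\<^sup>+t\<in>{b..}. ennreal (young_real A 1 t / t ^ (CARD('n) - 1 + 2)) \<partial>lborel) = \<infinity>" if "b > 0" for b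
      proof -
        have "(\<integral>\<^sup>+t\<in>{b..}. ennreal (young_real A 1 t / t ^ (CARD('n) - 1 + 2)) \<partial>lborel) =
          (\<integral>\<^sup>+t\<in>{b..}. A t / ennreal (t ^ (CARD('n) + 1)) \<partial>lborel)"
        proof (rule nn_integral_cong)
          fix t :: real
          have "ennreal (young_real A 1 t / t ^ (CARD('n) - 1 + 2)) = A t / ennreal (t ^ (CARD('n) + 1))" if "t \<ge> b"
          proof -
            have "t > 0" using that \<open>b > 0\<close> by simp
            then have "ennreal (young_real A 1 t / t ^ (CARD('n) + 1)) = ennreal (young_real A 1 t) / ennreal (t ^ (CARD('n) + 1))"
              by (intro divide_ennreal[symmetric] A1.nonneg) simp
            then show ?thesis using ennreal_young_real[OF A(2), of 1 t] \<open>t > 0\<close> by (simp add: N)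
          qed
          then show "ennreal (young_real A 1 t / t ^ (CARD('n) - 1 + 2)) * indicator {b..} t = A t / ennreal (t ^ (CARD('n) + 1)) * indicator {b..} t"
            by (auto simp: indicator_def)
        qed
        then show ?thesis using assms(5) that by simp
      qed
      show ?thesis
      proof (rule small_oscillation[OF assms(1) R(1,2) \<epsilon> growth'' _ _ _ v(1) h(1)])
        show "t1 * l > 0" using t1 l by simp
        show "young_real A l (t1 * l) > 0"
          using t1 l finite_valued_less_top[OF A(2), of t1] by (simp add: young_real_def enn2real_positive_iff)
      next
        fix \<kappa> R :: real assume "0 < \<kappa>" "0 < R"
        \<comment> \<open>The rescaling turns \<open>\<kappa>\<close> into
          \<open>\<kappa> / l\<close>; divergence holds for every positive constant.\<close>
        then have "(\<integral>\<^sup>+r\<in>{0<..<R}. ennreal ((2 * r) ^ (CARD('n) - 1) * young_real A 1 (\<kappa> / l / r)) \<partial>lborel) = \<infinity>"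
          using l(1) by (intro A1.radial_integral_infinite inf) auto
        then show "(\<integral>\<^sup>+r\<in>{0<..<R}. ennreal ((2 * r) ^ (CARD('n) - 1) * young_real A l (\<kappa> / r)) \<partial>lborel) = \<infinity>"
          by (simp add: rp mult.commute)
      next
        fix \<phi> i assume "\<phi> \<in> test_functions (ocube c R2)"
        then show "(LINT x|lborel. v x * partial i \<phi> x) = - (LINT x|lborel. h x $ i * \<phi> x)"
          by (intro local_weak_gradient[OF wg open_ocube compact_cube KU v h]) (auto intro: ocube_subset_cube[THEN subsetD])
      next
        have "(\<integral>\<^sup>+x. ennreal (young_real A l (norm (h x))) \<partial>lborel) = (\<integral>\<^sup>+x. ennreal (young_real A l (norm (h x))) \<partial>lebesgue)"
          by (simp add: nn_integral_completion)
        also have "\<dots> \<le> (\<integral>\<^sup>+x. A (\<bar>norm (g x)\<bar> / l) * indicator ?U x \<partial>lebesgue)"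
        proof (rule nn_integral_mono_AE)
          show "AE x in lebesgue. ennreal (young_real A l (norm (h x))) \<le> A (\<bar>norm (g x)\<bar> / l) * indicator ?U x"
            using AE_completion[OF h(3)]
          proof eventually_elim
            case (elim x)
            show ?case
            proof (cases "x \<in> ?K")
              case True
              then show ?thesis using elim KU ennreal_young_real[OF A(2) l(1), of "norm (g x)"] by auto
            qed (simp add: h(2) zero)
          qed
        qed
        also have "\<dots> = (\<integral>\<^sup>+x. A (\<bar>norm (g x)\<bar> / l) \<partial>lebesgue_on ?U)"
          using open_ocube[of c R3] by (subst nn_integral_restrict_space) auto
        also have "\<dots> < \<infinity>" using l(2) by (rule le_less_trans) simp
        finally show "(\<integral>\<^sup>+x. ennreal (young_real A l (norm (h x))) \<partial>lborel) < \<infinity>" .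
      next
        fix r assume r: "0 < r" "r < R"
        have sub: "ocube c r \<subseteq> ?K" using r R by (auto simp: ocube_def cube_def intro: less_imp_le less_trans)
        have "ocube c r \<subseteq> \<Omega>" using sub KU ocube_subset_cube R3(2) by blast
        then show "u \<in> borel_measurable (lebesgue_on (ocube c r))"
          using assms(7) unfolding orlicz_sobolev_loc_def by (auto intro: measurable_restrict_mono)
        have "AE x in lebesgue. x \<in> ocube c r \<longrightarrow> u x = v x"
          using AE_completion[OF v(3)] by eventually_elim (use sub in auto)
        then show "AE x in lebesgue_on (ocube c r). u x = v x"
          using open_ocube[of c r] by (subst AE_restrict_space_iff) auto
        fix m M :: real assume "m \<le> M"
          "(\<lambda>x. max (u x - M) 0 - max (m - u x) 0) \<in> sobolev_11_zero (ocube c r)"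
        then show "AE x in lebesgue_on (ocube c r). m \<le> u x \<and> u x \<le> M"
          using r R by (intro wm[OF open_ocube cc(1)]) auto
      qed
    qed
    then obtain r m M where r: "0 < r" "M - m \<le> \<epsilon>" "AE x in lebesgue_on (ocube c r). m \<le> u x \<and> u x \<le> M" by blast
    have "AE x in lebesgue. x \<in> ocube c r \<longrightarrow> m \<le> u x \<and> u x \<le> M"
      using r(3) open_ocube[of c r] by (subst (asm) AE_restrict_space_iff) auto
    moreover have "c \<in> ocube c r" using r(1) by (simp add: ocube_def)
    ultimately show ?thesis using r(2) open_ocube[of c r] by blast
  qed
  from continuous_representative[OF assms(2) this]
  obtain v where "continuous_on \<Omega> v" "AE x in lebesgue. x \<in> \<Omega> \<longrightarrow> u x = v x" by blast
  then show ?thesis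
    using \<Omega>s by (intro exI[of _ v]) (simp add: AE_restrict_space_iff)
qed

end
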